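(* Let $V$ be a finite-dimensional real or complex vector space, let $\mu$ be a probability measure on $\mathrm{GL}(V)$ with finite first moment and let $W$ be a $\mu$-invariant subspace of $V$. Suppose $\lambda_1(V/W)<\beta_{\min}(W)$. Then the following are equivalent: (i) There exists a $\mu$-stationary probability measure on $P(V)\setminus P(W)$. (ii) There exists a non-zero $\Gamma_\mu$-invariant subspace of $V$ in direct sum with $W$ (i.e. a non-zero $\Gamma_\mu$-invariant subspace $W'$ with $W'\cap W=\{0\}$).
   Context: Measures are Borel; fix any norm on $V$. $\mu$ has finite first moment if $\int \log\max\{\|g\|,\|g^{-1}\|\}\,d\mu(g)<\infty$. $\Gamma_\mu$ is the semigroup generated by the support of $\mu$; a subspace is $\mu$-invariant if it is $\Gamma_\mu$-invariant; then $\mu$ induces measures on $\mathrm{GL}(W)$ and $\mathrm{GL}(V/W)$. A probability measure $\nu$ is $\mu$-stationary if $\mu*\nu=\nu$, where $\int f\,d(\mu*\nu)=\iint f(gx)\,d\mu(g)\,d\nu(x)$, and ergodic if it is extremal among $\mu$-stationary probability measures. The top Lyapunov exponent of $\mu$ is the a.s. limit of $\frac1n\log\|X_n\cdots X_1\|$ with $X_i$ iid of law $\mu$; $\lambda_1(V/W)$ is the top Lyapunov exponent of the measure induced on $\mathrm{GL}(V/W)$. For a non-zero $\mu$-invariant subspace $W$, $\beta_{\min}(W)$ is the smallest Furstenberg--Kifer--Hennion exponent of $\mu$ on $W$: the smallest of the (finitely many) values taken by the cocycle average $\alpha(\eta)=\iint\log\frac{\|gv\|}{\|v\|}\,d\mu(g)\,d\eta([v])$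 as $\eta$ ranges over the ergodic $\mu$-stationary probability measures on $P(W)$. Equivalently, it is the smallest of the almost sure limits $\lim_n\frac1n\log\|X_n\cdots X_1v\|$ over $v\in W\setminus\{0\}$. *)

theory Defs
  imports "HOL-Probability.Probability"
begin

text \<open>
  The scalars are a type of sort \<open>{real_normed_field, euclidean_space}\<close>: a
  finite-dimensional normed field extension of the reals, that is, the real or the complex
  numbers. The space \<open>V\<close> is \<open>'k ^ 'n\<close> with its Euclidean norm, and elements of \<open>GL(V)\<close> are
  invertible matrices acting by \<open>(*v)\<close>; a subspace of \<open>V\<close> is a \<open>'k\<close>-subspace (\<open>vec.subspace\<close>).
\<close>

definition GL :: "('k::{real_normed_field, euclidean_space} ^ 'n ^ 'n) set" where
  "GL = {g. invertible g}"

definition GL_borel :: "('k::{real_normed_field, euclidean_space} ^ 'n ^ 'n) measure" where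
  "GL_borel = restrict_space borel GL"

definition finite_first_moment ::
    "('k::{real_normed_field, euclidean_space} ^ 'n ^ 'n) measure \<Rightarrow> bool" where
  "finite_first_moment \<mu> \<longleftrightarrow>
     integrable \<mu> (\<lambda>g. ln (max (onorm ((*v) g)) (onorm ((*v) (matrix_inv g)))))"

definition measure_support ::
    "('k::{real_normed_field, euclidean_space} ^ 'n ^ 'n) measure \<Rightarrow> ('k ^ 'n ^ 'n) set" where
  "measure_support \<mu> = {g \<in> GL. \<forall>U. open U \<and> g \<in> U \<longrightarrow> emeasure \<mu> (U \<inter> GL) > 0}"

inductive_set semigroup_of ::
    "('k::{real_normed_field, euclidean_space} ^ 'n ^ 'n) measure \<Rightarrow> ('k ^ 'n ^ 'n) set"
  for \<mu> where
  supp: "g \<in> measure_support \<mu> \<Longrightarrow> g \<in> semigroup_of \<mu>"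
| mult: "g \<in> semigroup_of \<mu> \<Longrightarrow> h \<in> semigroup_of \<mu> \<Longrightarrow> g ** h \<in> semigroup_of \<mu>"

definition invariant_subspace ::
    "('k::{real_normed_field, euclidean_space} ^ 'n ^ 'n) measure \<Rightarrow> ('k ^ 'n) set \<Rightarrow> bool" where
  "invariant_subspace \<mu> W \<longleftrightarrow>
     vec.subspace W \<and> (\<forall>g\<in>semigroup_of \<mu>. (*v) g ` W \<subseteq> W)"


text \<open>
  \<open>proj W\<close> is \<open>P(W)\<close>, as the set of lines contained in \<open>W\<close>; \<open>P(V)\<close> is \<open>proj UNIV\<close>. It carries the
  Borel \<open>\<sigma>\<close>-algebra of the quotient topology of \<open>V - {0}\<close>. A probability measure on a subset \<open>A\<close>
  of \<open>P(V)\<close> is identified with its extension to \<open>P(V)\<close>, a probability measure giving mass 1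
  to \<open>A\<close>.
\<close>

definition proj :: "('k::{real_normed_field, euclidean_space} ^ 'n) set \<Rightarrow> ('k ^ 'n) set set" where
  "proj W = (\<lambda>v. vec.span {v}) ` (W - {0})"

definition proj_borel :: "('k::{real_normed_field, euclidean_space} ^ 'n) set measure" where
  "proj_borel =
     sigma (proj UNIV) {U. U \<subseteq> proj UNIV \<and> open {v. v \<noteq> 0 \<and> vec.span {v} \<in> U}}"

definition convolve ::
    "('k::{real_normed_field, euclidean_space} ^ 'n ^ 'n) measure \<Rightarrow> ('k ^ 'n) set measure
      \<Rightarrow> ('k ^ 'n) set measure" where
  "convolve \<mu> \<nu> = distr (\<mu> \<Otimes>\<^sub>M \<nu>) proj_borel (\<lambda>(g, L). (*v) g ` L)"

definition stationary_on ::
    "('k::{real_normed_field, euclidean_space} ^ 'n ^ 'n) measure \<Rightarrow> ('k ^ 'n) set set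
      \<Rightarrow> ('k ^ 'n) set measure \<Rightarrow> bool" where
  "stationary_on \<mu> A \<nu> \<longleftrightarrow>
     prob_space \<nu> \<and> sets \<nu> = sets proj_borel \<and> emeasure \<nu> A = 1 \<and> convolve \<mu> \<nu> = \<nu>"

definition ergodic_on ::
    "('k::{real_normed_field, euclidean_space} ^ 'n ^ 'n) measure \<Rightarrow> ('k ^ 'n) set set
      \<Rightarrow> ('k ^ 'n) set measure \<Rightarrow> bool" where
  "ergodic_on \<mu> A \<nu> \<longleftrightarrow> stationary_on \<mu> A \<nu> \<and>
     (\<forall>\<nu>1 \<nu>2. \<forall>t\<in>{0<..<1::real}.
        stationary_on \<mu> A \<nu>1 \<and> stationary_on \<mu> A \<nu>2 \<and>
        (\<forall>B\<in>sets proj_borel. measure \<nu> B = t * measure \<nu>1 B + (1 - t) * measure \<nu>2 B)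
        \<longrightarrow> \<nu>1 = \<nu> \<and> \<nu>2 = \<nu>)"


text \<open>The quotient below does not depend on which non-zero vector of the line \<open>L\<close> is chosen.\<close>

definition log_cocycle ::
    "('k::{real_normed_field, euclidean_space} ^ 'n ^ 'n) \<Rightarrow> ('k ^ 'n) set \<Rightarrow> real" where
  "log_cocycle g L = (let v = (SOME v. v \<in> L \<and> v \<noteq> 0) in ln (norm (g *v v) / norm v))"

definition cocycle_average ::
    "('k::{real_normed_field, euclidean_space} ^ 'n ^ 'n) measure \<Rightarrow> ('k ^ 'n) set measure
      \<Rightarrow> real" where
  "cocycle_average \<mu> \<eta> = (\<integral>L. (\<integral>g. log_cocycle g L \<partial>\<mu>) \<partial>\<eta>)"

text \<open>
  For \<open>W \<noteq> {0}\<close> the infimum is over a non-empty finite set, so it is the smallest value; for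
  \<open>W = {0}\<close> it is \<open>\<infinity>\<close>.
\<close>

definition beta_min ::
    "('k::{real_normed_field, euclidean_space} ^ 'n ^ 'n) measure \<Rightarrow> ('k ^ 'n) set \<Rightarrow> ereal" where
  "beta_min \<mu> W = (INF \<eta>\<in>{\<eta>. ergodic_on \<mu> (proj W) \<eta>}. ereal (cocycle_average \<mu> \<eta>))"


text \<open>
  \<open>V/W\<close> is the set of cosets of \<open>W\<close> with the quotient norm. When \<open>g\<close> is invertible and preserves
  \<open>W\<close>, it maps the coset \<open>v + W\<close> onto the coset \<open>g v + W\<close>, so the map it induces on \<open>V/W\<close> is
  the image map.
\<close>

definition quot_space ::
    "('k::{real_normed_field, euclidean_space} ^ 'n) set \<Rightarrow> ('k ^ 'n) set set" where
  "quot_space W = range (\<lambda>v. (+) v ` W)"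

definition quot_norm :: "('k::{real_normed_field, euclidean_space} ^ 'n) set \<Rightarrow> real" where
  "quot_norm C = (INF v\<in>C. norm v)"

definition quot_map ::
    "('k::{real_normed_field, euclidean_space} ^ 'n ^ 'n) \<Rightarrow> ('k ^ 'n) set \<Rightarrow> ('k ^ 'n) set" where
  "quot_map g C = (*v) g ` C"

definition quot_onorm ::
    "('k::{real_normed_field, euclidean_space} ^ 'n) set
      \<Rightarrow> (('k ^ 'n) set \<Rightarrow> ('k ^ 'n) set) \<Rightarrow> real" where
  "quot_onorm W T = (SUP C\<in>{C \<in> quot_space W. quot_norm C \<le> 1}. quot_norm (T C))"

text \<open>\<open>random_product X n\<close> is \<open>X (n - 1) ** \<dots> ** X 0\<close>.\<close>

primrec random_product ::
    "(nat \<Rightarrow> 'k::{real_normed_field, euclidean_space} ^ 'n ^ 'n) \<Rightarrow> nat \<Rightarrow> 'k ^ 'n ^ 'n" where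
  "random_product X 0 = mat 1"
| "random_product X (Suc n) = X n ** random_product X n"

text \<open>Unlike \<open>ln\<close>, whose value at 0 is 0; it matters for \<open>W = V\<close>, where \<open>\<lambda>\<^sub>1(V/W) = -\<infinity>\<close>.\<close>

definition elog :: "real \<Rightarrow> ereal" where
  "elog x = (if x = 0 then -\<infinity> else ereal (ln x))"

text \<open>
  The top Lyapunov exponent of the measure induced by \<open>\<mu>\<close> on \<open>GL(V/W)\<close>: the almost sure limit
  along a sequence of independent matrices of law \<open>\<mu>\<close>.
\<close>

definition top_lyapunov_quot ::
    "('k::{real_normed_field, euclidean_space} ^ 'n ^ 'n) measure \<Rightarrow> ('k ^ 'n) set \<Rightarrow> ereal" where
  "top_lyapunov_quot \<mu> W =
     (THE l. AE X in (\<Pi>\<^sub>M i\<in>(UNIV::nat set). \<mu>).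
        (\<lambda>n. elog (quot_onorm W (quot_map (random_product X n))) / ereal (real n)) \<longlonglongrightarrow> l)"

end

theory Submission
  imports Defs
begin

text \<open>
  The implication from (ii) to (i) is compactness: on a non-zero invariant subspace \<open>W'\<close>, averages
  along an orbit of the random walk accumulate at a stationary measure on \<open>P(W')\<close>
  (\<open>krylov_bogoliubov\<close>), and \<open>P(W')\<close> does not meet \<open>P(W)\<close>.

  For the converse, let \<open>\<nu>\<close> be a stationary measure that does not charge \<open>P(W)\<close>, and let
  \<open>\<lambda>\<^sub>1(V/W) < \<rho> < \<beta>\<^sub>m\<^sub>i\<^sub>n(W)\<close>. The quotient of the norm of a vector by its distance to \<open>W\<close> is a function
  on projective space that is finite \<open>\<nu>\<close>-almost everywhere. Along the random walk started from \<open>\<nu>\<close> its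
  law does not change, so it is subexponential in probability. Therefore the vectors of \<open>\<nu>\<close>-almost
  every line grow in probability no faster than their images in \<open>V/W\<close>, that is, at rate at most \<open>\<rho>\<close>
  (\<open>slow_growth_off_subspace\<close>). The vectors that grow at rate at most \<open>\<rho>\<close> along a suitable sequence of
  times form a subspace \<open>F\<close>, and \<open>\<nu>\<close> lives on \<open>P(F)\<close>. The smallest subspace \<open>E\<close> with \<open>\<nu>(P(E)) = 1\<close> is
  non-zero, invariant (\<open>minimal_full_subspace\<close>) and contained in \<open>F\<close>. It meets \<open>W\<close> only in 0: from a
  non-zero vector of \<open>F \<inter> W\<close>, averages along its orbit would produce a stationary measure on \<open>P(W)\<close>
  with cocycle average at most \<open>\<rho>\<close> (\<open>beta_min_le_growth\<close>), which contradicts \<open>\<rho> < \<beta>\<^sub>m\<^sub>i\<^sub>n(W)\<close>.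

  Three ingredients are of independent interest. Weak compactness of the probability measures on
  projective space is reduced to Helly's selection theorem on the real line by means of a
  space-filling curve (\<open>proj_prob_weakly_compact\<close>). The exponent \<open>\<beta>\<^sub>m\<^sub>i\<^sub>n\<close> is defined by ergodic measures
  but bounds the cocycle average of every stationary measure, because a minimising stationary
  measure can be chosen extremal (\<open>ex_ergodic_le\<close>). The exponent \<open>\<lambda>\<^sub>1(V/W)\<close> is defined as an almost sure
  limit, whose existence is Kingman's subadditive ergodic theorem (\<open>kingman\<close>), obtained here from a
  covering argument and Kolmogorov's zero-one law.
\<close>

section \<open>A continuous curve that covers the unit ball\<close>

text \<open>
  Schoenberg's function: it has period 2, vanishes on \<open>[0, 1/3]\<close> and is 1 on \<open>[2/3, 1]\<close>, so that it
  reads off the first digit of a ternary expansion with digits 0 and 2. The cosine makes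
  periodicity and continuity immediate.
\<close>

definition digit_reader :: "real \<Rightarrow> real" where
  "digit_reader t = max 0 (min 1 (1 / 2 - cos (pi * t)))"

lemma continuous_on_digit_reader [continuous_intros]:
  fixes f :: "'a::t2_space \<Rightarrow> real"
  shows "continuous_on A f \<Longrightarrow> continuous_on A (\<lambda>x. digit_reader (f x))"
  unfolding digit_reader_def by (intro continuous_intros)

lemma digit_reader_bounds: "0 \<le> digit_reader t" "digit_reader t \<le> 1"
  by (auto simp: digit_reader_def)

lemma digit_reader_periodic: "digit_reader (2 * of_nat k + u) = digit_reader u"
proof -
  have "cos (pi * (2 * of_nat k + u)) = cos (pi * u)"
    using cos_2npi[of k] sin_2npi[of k] by (simp add: distrib_left cos_add mult_ac)
  then show ?thesis by (simp add: digit_reader_def)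
qed

text \<open>
  Multiplication by \<open>3 ^ m\<close> turns the digits before position \<open>m\<close> into an even integer, which the
  period absorbs; what remains is \<open>2 a\<^sub>m / 3\<close> plus at most \<open>1/3\<close>.
\<close>

lemma digit_reader_ternary:
  fixes a :: "nat \<Rightarrow> nat"
  assumes a: "\<And>i. a i \<le> 1"
  shows "digit_reader (3 ^ m * (\<Sum>i. 2 * real (a i) / 3 ^ Suc i)) = real (a m)"
    and "0 \<le> (\<Sum>i. 2 * real (a i) / 3 ^ Suc i)" "(\<Sum>i. 2 * real (a i) / 3 ^ Suc i) \<le> 1"
proof -
  have geo: "(\<lambda>i. 2 / 3 ^ Suc i :: real) sums 1"
  proof -
    have "(\<lambda>i. 2 / 3 * (1 / 3) ^ i :: real) sums (2 / 3 * (1 / (1 - 1 / 3)))"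
      by (intro sums_mult geometric_sums) simp
    then show ?thesis by (simp add: power_divide)
  qed
  have le: "2 * real (b i) / 3 ^ Suc i \<le> 2 / 3 ^ Suc i" if "\<And>i. b i \<le> 1" for b :: "nat \<Rightarrow> nat" and i
    using that[of i] by (simp add: divide_right_mono)
  have summ: "summable (\<lambda>i. 2 * real (b i) / 3 ^ Suc i)" if "\<And>i. b i \<le> 1" for b :: "nat \<Rightarrow> nat"
    by (rule summable_comparison_test'[OF sums_summable[OF geo], of 0]) (use le[OF that] in auto)
  have nonneg: "0 \<le> (\<Sum>i. 2 * real (b i) / 3 ^ Suc i)" if "\<And>i. b i \<le> 1" for b :: "nat \<Rightarrow> nat"
    by (rule suminf_nonneg[OF summ[OF that]]) simp
  have le1: "(\<Sum>i. 2 * real (b i) / 3 ^ Suc i) \<le> 1" if "\<And>i. b i \<le> 1" for b :: "nat \<Rightarrow> nat"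
    using suminf_le[OF le[OF that] summ[OF that] sums_summable[OF geo]] sums_unique[OF geo] by simp
  show "0 \<le> (\<Sum>i. 2 * real (a i) / 3 ^ Suc i)" "(\<Sum>i. 2 * real (a i) / 3 ^ Suc i) \<le> 1"
    using nonneg[of a] le1[of a] a by simp_all
  define u where "u = (\<Sum>i. 2 * real (a (i + m)) / 3 ^ Suc i)"
  have "(\<Sum>i. 2 * real (a i) / 3 ^ Suc i) = (\<Sum>i. 2 * real (a (i + m)) / 3 ^ Suc (i + m)) + (\<Sum>i<m. 2 * real (a i) / 3 ^ Suc i)"
    by (rule suminf_split_initial_segment[OF summ[OF a]])
  also have "(\<Sum>i. 2 * real (a (i + m)) / 3 ^ Suc (i + m)) = (\<Sum>i. (1 / 3 ^ m) * (2 * real (a (i + m)) / 3 ^ Suc i))"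
    by (simp add: power_add mult_ac)
  also have "\<dots> = (1 / 3 ^ m) * u"
    unfolding u_def by (rule suminf_mult[OF summ[of "\<lambda>i. a (i + m)"]]) (rule a)
  finally have "3 ^ m * (\<Sum>i. 2 * real (a i) / 3 ^ Suc i) = 3 ^ m * (\<Sum>i<m. 2 * real (a i) / 3 ^ Suc i) + u"
    by (simp add: algebra_simps)
  also have "3 ^ m * (\<Sum>i<m. 2 * real (a i) / 3 ^ Suc i) = 2 * of_nat (\<Sum>i<m. a i * 3 ^ (m - Suc i))"
    unfolding sum_distrib_left of_nat_sum
  proof (rule sum.cong[OF refl])
    fix i assume "i \<in> {..<m}"
    then have "(3::real) ^ m = 3 ^ Suc i * 3 ^ (m - Suc i)" by (subst power_add[symmetric]) simp
    then show "3 ^ m * (2 * real (a i) / 3 ^ Suc i) = 2 * real (a i * 3 ^ (m - Suc i))" by simp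
  qed
  finally have red: "digit_reader (3 ^ m * (\<Sum>i. 2 * real (a i) / 3 ^ Suc i)) = digit_reader u"
    by (simp only: digit_reader_periodic)
  define r where "r = (\<Sum>i. 2 * real (a (Suc i + m)) / 3 ^ Suc i)"
  have r: "0 \<le> r" "r \<le> 1"
    unfolding r_def using nonneg[of "\<lambda>i. a (Suc i + m)"] le1[of "\<lambda>i. a (Suc i + m)"] a by simp_all
  have "u = (\<Sum>i. 2 * real (a (Suc i + m)) / 3 ^ Suc (Suc i)) + 2 * real (a m) / 3"
    unfolding u_def using suminf_split_initial_segment[OF summ[of "\<lambda>i. a (i + m)"], of 1] a by simp
  also have "(\<Sum>i. 2 * real (a (Suc i + m)) / 3 ^ Suc (Suc i)) = (\<Sum>i. (1 / 3) * (2 * real (a (Suc i + m)) / 3 ^ Suc i))"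
    by simp
  also have "\<dots> = r / 3"
    unfolding r_def using suminf_mult[OF summ[of "\<lambda>i. a (Suc i + m)"], of "1/3"] a by simp
  finally have u: "u = r / 3 + 2 * real (a m) / 3" .
  consider "a m = 0" | "a m = 1" using a[of m] by linarith
  then have "digit_reader u = real (a m)"
  proof cases
    case 1
    have "cos (pi * u) \<ge> cos (pi / 3)"
      by (rule cos_monotone_0_pi_le) (use u 1 r in \<open>auto simp: field_simps\<close>)
    then show ?thesis using 1 by (simp add: digit_reader_def cos_60)
  next
    case 2
    have "u \<ge> 2 / 3" "u \<le> 1" using u 2 r by auto
    then have "pi * (2 / 3) \<le> pi * u" "pi * u \<le> pi" by (auto intro!: mult_left_mono)
    then have "cos (pi * u) \<le> cos (pi * (2 / 3))"
      by (intro cos_monotone_0_pi_le) auto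
    also have "cos (pi * (2 / 3)) = - (1 / 2)"
      using cos_120 by (simp add: mult.commute)
    finally show ?thesis using 2 by (simp add: digit_reader_def)
  qed
  then show "digit_reader (3 ^ m * (\<Sum>i. 2 * real (a i) / 3 ^ Suc i)) = real (a m)"
    using red by simp
qed

text \<open>
  The partial sums of the expansion are \<open>\<lfloor>2 ^ n x\<rfloor> / 2 ^ n\<close>.
\<close>

lemma binary_expansion:
  fixes x :: real
  assumes "0 \<le> x" "x < 1"
  obtains a :: "nat \<Rightarrow> nat" where "\<And>k. a k \<le> 1" "(\<lambda>k. real (a k) / 2 ^ Suc k) sums x"
proof -
  define z where "z k = \<lfloor>2 ^ k * x\<rfloor>" for k
  have z: "2 * z k \<le> z (Suc k)" "z (Suc k) \<le> 2 * z k + 1" for k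
    proof -
    have "real_of_int (z k) \<le> 2 ^ k * x" "2 ^ k * x < real_of_int (z k) + 1" unfolding z_def by linarith+
    then show "2 * z k \<le> z (Suc k)" "z (Suc k) \<le> 2 * z k + 1"
      unfolding z_def[of "Suc k"] by (auto simp: le_floor_iff floor_le_iff)
  qed
  define a where "a k = nat (z (Suc k) - 2 * z k)" for k
  have a: "real (a k) = of_int (z (Suc k)) - 2 * of_int (z k)" for k
    using z[of k] by (simp add: a_def)
  have "(\<Sum>k<n. real (a k) / 2 ^ Suc k) = of_int (z n) / 2 ^ n" for n
  proof (induction n)
    case 0
    have "z 0 = 0" using assms by (simp add: z_def floor_eq_iff)
    then show ?case by simp
  next
    case (Suc n)
    then show ?case by (simp add: a field_simps)
  qed
  moreover have "(\<lambda>n. of_int (z n) / 2 ^ n) \<longlonglongrightarrow> x"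
  proof (rule tendsto_sandwich)
    have "x - (1/2) ^ n \<le> of_int (z n) / 2 ^ n" for n
    proof -
      have "2 ^ n * x - 1 \<le> of_int (z n)" unfolding z_def by linarith
      then have "(2 ^ n * x - 1) / 2 ^ n \<le> of_int (z n) / 2 ^ n" by (rule divide_right_mono) simp
      then show ?thesis by (simp add: diff_divide_distrib power_one_over)
    qed
    then show "\<forall>\<^sub>F n in sequentially. x - (1/2) ^ n \<le> of_int (z n) / 2 ^ n" by simp
    have "of_int (z n) / 2 ^ n \<le> x" for n
    proof -
      have "of_int (z n) \<le> 2 ^ n * x" unfolding z_def by linarith
      then show ?thesis by (simp add: field_simps)
    qed
    then show "\<forall>\<^sub>F n in sequentially. of_int (z n) / 2 ^ n \<le> x" by simp
    show "(\<lambda>n. x - (1/2) ^ n) \<longlonglongrightarrow> x"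
      using tendsto_diff[OF tendsto_const[of x] LIMSEQ_realpow_zero[of "1/2"]] by simp
  qed simp
  ultimately have "(\<lambda>k. real (a k) / 2 ^ Suc k) sums x" by (simp add: sums_def)
  moreover have "a k \<le> 1" for k using z[of k] by (simp add: a_def)
  ultimately show ?thesis using that by blast
qed

text \<open>
  Schoenberg's space-filling curve. The ternary digits of the time, dealt out cyclically to the
  coordinates, are the binary digits of the coordinates.
\<close>

theorem ex_continuous_curve_covering_ball:
  obtains \<gamma> :: "real \<Rightarrow> 'a::euclidean_space"
  where "continuous_on UNIV \<gamma>" "cball 0 1 \<subseteq> \<gamma> ` {0..1}"
proof -
  define d where "d = DIM('a)"
  have d: "d > 0" by (simp add: d_def)
  obtain e :: "nat \<Rightarrow> 'a" where e: "bij_betw e {..<d} Basis"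
    using finite_same_card_bij[of "{..<d}" "Basis :: 'a set"] by (auto simp: d_def)
  define c where "c j t = (\<Sum>k. digit_reader (3 ^ (d * k + j) * t) / 2 ^ Suc k)" for j t
  \<comment> \<open>Binary expansions are needed only for numbers in \<open>[1/4, 3/4]\<close>: the affine map sends this interval onto \<open>[-1, 1]\<close>.\<close>
  define \<gamma> :: "real \<Rightarrow> 'a" where "\<gamma> t = (\<Sum>j<d. (4 * c j t - 2) *\<^sub>R e j)" for t
  have cont_c: "continuous_on UNIV (c j)" for j
  proof (rule uniform_limit_theorem)
    show "\<forall>\<^sub>F n in sequentially. continuous_on UNIV (\<lambda>t. \<Sum>k<n. digit_reader (3 ^ (d * k + j) * t) / 2 ^ Suc k)"
      by (intro always_eventually allI continuous_intros) auto
    show "uniform_limit UNIV (\<lambda>n t. \<Sum>k<n. digit_reader (3 ^ (d * k + j) * t) / 2 ^ Suc k) (c j) sequentially"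
      unfolding c_def
    proof (rule Weierstrass_m_test[where M = "\<lambda>k. 1 / 2 ^ Suc k"])
      show "norm (digit_reader (3 ^ (d * k + j) * t) / 2 ^ Suc k) \<le> 1 / 2 ^ Suc k" for k t
        using digit_reader_bounds[of "3 ^ (d * k + j) * t"] by (simp add: divide_right_mono)
      show "summable (\<lambda>k. 1 / 2 ^ Suc k :: real)"
        using power_half_series by (auto simp: sums_iff power_divide)
    qed
  qed simp
  have "continuous_on UNIV \<gamma>" unfolding \<gamma>_def by (intro continuous_intros cont_c)
  moreover have "v \<in> \<gamma> ` {0..1}" if "v \<in> cball 0 1" for v
  proof -
    define x where "x j = (v \<bullet> e j + 2) / 4" for j
    have "0 \<le> x j \<and> x j < 1" if "j < d" for j
    proof -
      have "e j \<in> Basis" using e that by (auto simp: bij_betw_def)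
      then have "\<bar>v \<bullet> e j\<bar> \<le> 1" using Basis_le_norm[of "e j" v] \<open>v \<in> cball 0 1\<close> by simp
      then show ?thesis by (auto simp: x_def)
    qed
    then have "\<exists>a::nat \<Rightarrow> nat. (\<forall>k. a k \<le> 1) \<and> (\<lambda>k. real (a k) / 2 ^ Suc k) sums x j" if "j < d" for j
      using binary_expansion[of "x j"] that by metis
    then obtain a :: "nat \<Rightarrow> nat \<Rightarrow> nat"
      where a: "\<And>j k. j < d \<Longrightarrow> a j k \<le> 1" "\<And>j. j < d \<Longrightarrow> (\<lambda>k. real (a j k) / 2 ^ Suc k) sums x j"
      by metis
    define b where "b i = a (i mod d) (i div d)" for i
    have b: "b i \<le> 1" for i using a(1)[of "i mod d"] d by (simp add: b_def)
    define t where "t = (\<Sum>i. 2 * real (b i) / 3 ^ Suc i)"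
    have c: "c j t = x j" if j: "j < d" for j
    proof -
      have "digit_reader (3 ^ (d * k + j) * t) = real (a j k)" for k
        using digit_reader_ternary(1)[of b "d * k + j"] b j by (simp add: t_def b_def)
      then show ?thesis using a(2)[OF j] by (simp add: c_def sums_iff)
    qed
    have "\<gamma> t = (\<Sum>j<d. (v \<bullet> e j) *\<^sub>R e j)"
      unfolding \<gamma>_def by (intro sum.cong) (auto simp: c x_def field_simps)
    also have "\<dots> = (\<Sum>i\<in>Basis. (v \<bullet> i) *\<^sub>R i)"
      using sum.reindex_bij_betw[OF e, of "\<lambda>i. (v \<bullet> i) *\<^sub>R i"] by simp
    also have "\<dots> = v" by (rule euclidean_representation)
    finally have "v = \<gamma> t" by simp
    moreover have "t \<in> {0..1}" using digit_reader_ternary(2,3)[of b] b by (simp add: t_def)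
    ultimately show ?thesis by blast
  qed
  ultimately show ?thesis using that by blast
qed

section \<open>Measures on projective space\<close>

abbreviation line :: "'k::{real_normed_field, euclidean_space} ^ 'n \<Rightarrow> ('k ^ 'n) set" where
  "line v \<equiv> vec.span {v}"

lemma norm_smult: "norm (c *s v) = norm c * norm v"
  for c :: "'k::real_normed_field" and v :: "'k ^ 'n"
  by (simp add: norm_vec_def norm_mult L2_set_right_distrib)

lemma scaleR_eq_smult: "r *\<^sub>R v = (of_real r :: 'k) *s v"
  for v :: "'k::real_normed_field ^ 'n"
  by (simp add: vec_eq_iff scaleR_conv_of_real[of r "v $ _"])

lemma continuous_on_smult [continuous_intros]:
  fixes v :: "'a::topological_space \<Rightarrow> 'k::real_normed_field ^ 'n"
  assumes "continuous_on A c" "continuous_on A v"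
  shows "continuous_on A (\<lambda>x. c x *s v x)"
  unfolding vector_scalar_mult_def by (intro continuous_intros assms)

lemma vec_subspace_imp_subspace: "vec.subspace W \<Longrightarrow> subspace W"
  for W :: "('k::real_normed_field ^ 'n) set"
  by (auto simp: subspace_def vec.subspace_def scaleR_eq_smult)

lemma closed_vec_subspace: "vec.subspace W \<Longrightarrow> closed W"
  for W :: "('k::{real_normed_field, euclidean_space} ^ 'n) set"
  by (intro closed_subspace vec_subspace_imp_subspace)

lemma mem_line_iff: "w \<in> line v \<longleftrightarrow> (\<exists>c. w = c *s v)"
  by (auto simp: vec.span_singleton)

lemma line_self: "v \<in> line v"
  by (simp add: vec.span_base)

lemma line_smult: "c \<noteq> 0 \<Longrightarrow> line (c *s v) = line v"
  by (auto simp: set_eq_iff mem_line_iff intro: exI[of _ "_ * c"] exI[of _ "_ / c"])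

lemma line_eq_if_mem: "w \<in> line v \<Longrightarrow> w \<noteq> 0 \<Longrightarrow> line w = line v"
  by (metis line_smult mem_line_iff vector_smult_lzero)

lemma line_subset_iff: "vec.subspace W \<Longrightarrow> line v \<subseteq> W \<longleftrightarrow> v \<in> W"
  using vec.span_minimal[of "{v}" W] line_self[of v] by auto

lemma line_in_proj: "v \<noteq> 0 \<Longrightarrow> v \<in> W \<Longrightarrow> line v \<in> proj W"
  by (auto simp: proj_def)

lemma line_in_proj_iff: "vec.subspace W \<Longrightarrow> v \<noteq> 0 \<Longrightarrow> line v \<in> proj W \<longleftrightarrow> v \<in> W"
  by (auto simp: proj_def) (metis line_self line_subset_iff vec.span_superset insert_subset subset_iff)

lemma proj_mono: "W \<subseteq> W' \<Longrightarrow> proj W \<subseteq> proj W'"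
  by (auto simp: proj_def)

lemma mult_image_line: "(*v) g ` line v = line (g *v v)"
  by (auto simp: vec.span_singleton vec.scale[symmetric] image_image)

lemma space_proj_borel [simp]: "space proj_borel = proj UNIV"
  and sets_proj_borel: "sets proj_borel
    = sigma_sets (proj UNIV) {U. U \<subseteq> proj UNIV \<and> open {v. v \<noteq> 0 \<and> line v \<in> U}}"
  unfolding proj_borel_def by (auto simp: space_measure_of_conv sets_measure_of_conv)

lemma open_in_proj_borel:
  "U \<subseteq> proj UNIV \<Longrightarrow> open {v. v \<noteq> 0 \<and> line v \<in> U} \<Longrightarrow> U \<in> sets proj_borel"
  unfolding sets_proj_borel by (rule sigma_sets.Basic) simp

lemma line_measurable [measurable]: "line \<in> measurable (restrict_space borel (- {0})) proj_borel"
  unfolding proj_borel_def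
proof (rule measurable_measure_of)
  fix U assume "U \<in> {U. U \<subseteq> proj UNIV \<and> open {v. v \<noteq> 0 \<and> line v \<in> U}}"
  then have U: "open {v. v \<noteq> 0 \<and> line v \<in> U}" by simp
  have "line -` U \<inter> space (restrict_space borel (- {0})) = {v. v \<noteq> 0 \<and> line v \<in> U} \<inter> - {0}"
    by (auto simp: space_restrict_space)
  also have "\<dots> \<in> sets (restrict_space borel (- {0}))"
    using borel_open[OF U] unfolding sets_restrict_space by blast
  finally show "line -` U \<inter> space (restrict_space borel (- {0})) \<in> sets (restrict_space borel (- {0}))" .
qed (auto simp: space_restrict_space proj_def)

lemma measurable_line_compose:
  assumes "f \<in> borel_measurable M" "\<And>x. x \<in> space M \<Longrightarrow> f x \<noteq> 0"
  shows "(\<lambda>x. line (f x)) \<in> measurable M proj_borel"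
  by (rule measurable_compose[OF _ line_measurable])
    (use assms in \<open>auto intro: measurable_restrict_space2\<close>)

text \<open>
  The continuous functions on projective space, as a quotient of \<open>V - {0}\<close>. They serve as test
  functions for weak convergence.
\<close>

definition proj_continuous :: "(('k::{real_normed_field, euclidean_space} ^ 'n) set \<Rightarrow> real) \<Rightarrow> bool" where
  "proj_continuous f \<longleftrightarrow> continuous_on (- {0}) (\<lambda>v. f (line v))"

lemma proj_continuous_measurable:
  assumes "proj_continuous f"
  shows "f \<in> borel_measurable proj_borel"
proof (rule borel_measurableI)
  fix S :: "real set" assume "open S"
  have "open ((\<lambda>v. f (line v)) -` S \<inter> - {0})"
    using assms \<open>open S\<close> unfolding proj_continuous_def
    by (subst (asm) continuous_on_open_vimage) auto
  moreover have "(\<lambda>v. f (line v)) -` S \<inter> - {0} = {v. v \<noteq> 0 \<and> line v \<in> f -` S \<inter> proj UNIV}"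
    by (auto simp: proj_def)
  ultimately show "f -` S \<inter> space proj_borel \<in> sets proj_borel"
    by (intro open_in_proj_borel) auto
qed

definition sphere_curve :: "real \<Rightarrow> 'a::euclidean_space" where
  "sphere_curve = (SOME \<gamma>. continuous_on UNIV \<gamma> \<and> cball 0 1 \<subseteq> \<gamma> ` {0..1})"

lemma sphere_curve: "continuous_on UNIV (sphere_curve :: real \<Rightarrow> 'a::euclidean_space)"
  "cball 0 1 \<subseteq> (sphere_curve :: real \<Rightarrow> 'a::euclidean_space) ` {0..1}"
proof -
  have "\<exists>\<gamma> :: real \<Rightarrow> 'a. continuous_on UNIV \<gamma> \<and> cball 0 1 \<subseteq> \<gamma> ` {0..1}"
    using ex_continuous_curve_covering_ball by blast
  from someI_ex[OF this]
  show "continuous_on UNIV (sphere_curve :: real \<Rightarrow> 'a)"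
    "cball 0 1 \<subseteq> (sphere_curve :: real \<Rightarrow> 'a) ` {0..1}"
    unfolding sphere_curve_def by auto
qed

definition unit_times :: "(real \<Rightarrow> 'a::euclidean_space) \<Rightarrow> real set" where
  "unit_times \<gamma> = {t \<in> {0..1}. norm (\<gamma> t) = 1}"

lemma compact_unit_times:
  assumes "continuous_on UNIV \<gamma>"
  shows "compact (unit_times \<gamma>)"
proof -
  have "closed {t. norm (\<gamma> t) = 1}"
    using assms by (intro closed_Collect_eq continuous_intros)
  then have "compact ({0..1} \<inter> {t. norm (\<gamma> t) = 1})" by (intro compact_Int_closed) auto
  then show ?thesis by (rule back_subst[of compact]) (auto simp: unit_times_def)
qed

text \<open>
  The first time at which the curve passes through a unit vector of the line. It embeds projective
  space measurably into the real line, with a left inverse that is continuous on the compact set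
  \<open>unit_times sphere_curve\<close>.
\<close>

definition line_code :: "('k::{real_normed_field, euclidean_space} ^ 'n) set \<Rightarrow> real" where
  "line_code L = Inf {t \<in> unit_times (sphere_curve :: real \<Rightarrow> 'k ^ 'n). sphere_curve t \<in> L}"

text \<open>
  A unit vector of the line that depends measurably on the line.
\<close>

definition rep :: "('k::{real_normed_field, euclidean_space} ^ 'n) set \<Rightarrow> 'k ^ 'n" where
  "rep L = sphere_curve (line_code L)"

lemma unit_times_nonzero: "t \<in> unit_times \<gamma> \<Longrightarrow> \<gamma> t \<noteq> 0"
  by (auto simp: unit_times_def)

lemma line_code_attained:
  fixes L :: "('k::{real_normed_field, euclidean_space} ^ 'n) set"
  assumes L: "L \<in> proj UNIV"
  shows "line_code L \<in> unit_times (sphere_curve :: real \<Rightarrow> 'k ^ 'n)" "rep L \<in> L"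
    and line_code_le: "\<And>t. t \<in> unit_times (sphere_curve :: real \<Rightarrow> 'k ^ 'n)
      \<Longrightarrow> sphere_curve t \<in> L \<Longrightarrow> line_code L \<le> t"
proof -
  let ?\<gamma> = "sphere_curve :: real \<Rightarrow> 'k ^ 'n"
  obtain v where v: "v \<noteq> 0" "L = line v" using L by (auto simp: proj_def)
  let ?S = "{t \<in> unit_times ?\<gamma>. ?\<gamma> t \<in> L}"
  have "of_real (1 / norm v) *s v \<in> cball 0 1" using v by (simp add: norm_smult norm_divide)
  then obtain t where t: "t \<in> {0..1}" "?\<gamma> t = of_real (1 / norm v) *s v"
    using sphere_curve(2) by (metis (no_types, lifting) image_iff subset_iff)
  have "t \<in> ?S" using t v by (auto simp: unit_times_def norm_smult norm_divide mem_line_iff)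
  moreover have bdd: "bdd_below ?S" by (intro bdd_belowI[of _ 0]) (auto simp: unit_times_def)
  moreover have "closed ?S"
  proof -
    have "closed (?\<gamma> -` L)" unfolding v
      by (intro continuous_closed_vimage closed_vec_subspace vec.subspace_span)
        (use sphere_curve(1) in \<open>auto simp: continuous_on_eq_continuous_at\<close>)
    then have "closed (unit_times ?\<gamma> \<inter> ?\<gamma> -` L)"
      using compact_unit_times[OF sphere_curve(1)] compact_imp_closed by blast
    then show ?thesis by (simp add: Int_def)
  qed
  ultimately have "Inf ?S \<in> ?S" by (intro closed_contains_Inf) auto
  then show "line_code L \<in> unit_times ?\<gamma>" "rep L \<in> L" by (auto simp: line_code_def rep_def)
  show "line_code L \<le> t" if "t \<in> unit_times ?\<gamma>" "?\<gamma> t \<in> L" for t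
    unfolding line_code_def using bdd that by (intro cInf_lower) auto
qed

text \<open>
  In a bounded region the cone is the continuous image of a compact set of pairs \<open>(c, t)\<close>.
\<close>

lemma closed_cone_over_curve:
  fixes \<gamma> :: "real \<Rightarrow> 'k::{real_normed_field, euclidean_space} ^ 'n"
  assumes \<gamma>: "continuous_on UNIV \<gamma>"
    and K: "compact K" "\<And>t. t \<in> K \<Longrightarrow> norm (\<gamma> t) = 1"
  shows "closed {c *s \<gamma> t |c t. t \<in> K}"
  unfolding closed_sequential_limits
proof (intro allI impI, elim conjE)
  fix x l assume x: "\<forall>n. x n \<in> {c *s \<gamma> t |c t. t \<in> K}" "x \<longlonglongrightarrow> l"
  obtain B where B: "\<And>n. norm (x n) \<le> B"
    using convergent_imp_bounded[OF x(2)] by (auto simp: bounded_iff)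
  let ?I = "(\<lambda>(c, t). c *s \<gamma> t) ` (cball 0 B \<times> K)"
  have "continuous_on (cball 0 B \<times> K) (\<lambda>(c, t). c *s \<gamma> t)"
    unfolding case_prod_beta
    by (intro continuous_intros continuous_on_compose2[OF \<gamma>]) auto
  then have "compact ?I" by (intro compact_continuous_image compact_Times K) auto
  moreover have "x n \<in> ?I" for n
  proof -
    obtain c t where ct: "x n = c *s \<gamma> t" "t \<in> K" using x(1) by blast
    then have "norm c \<le> B" using B[of n] K(2) by (simp add: norm_smult)
    with ct show ?thesis by (auto intro!: image_eqI[of _ _ "(c, t)"])
  qed
  ultimately have "l \<in> ?I" using x(2) closed_sequentially[OF compact_imp_closed] by metis
  then show "l \<in> {c *s \<gamma> t |c t. t \<in> K}" by auto
qed

text \<open>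
  The lines with code at most \<open>t\<close> are those that the curve meets up to time \<open>t\<close>. They form the cone
  over a compact piece of the curve, which is closed.
\<close>

lemma line_code_measurable [measurable]: "line_code \<in> borel_measurable (proj_borel :: ('k::{real_normed_field, euclidean_space} ^ 'n) set measure)"
proof (subst borel_measurable_iff_le, rule allI)
  let ?\<gamma> = "sphere_curve :: real \<Rightarrow> 'k ^ 'n"
  fix t :: real
  let ?K = "unit_times ?\<gamma> \<inter> {..t}"
  let ?U = "{L \<in> proj (UNIV :: ('k ^ 'n) set). \<not> line_code L \<le> t}"
  have K: "compact ?K" using compact_unit_times[OF sphere_curve(1)] by (rule compact_Int_closed) simp
  have "closed {c *s ?\<gamma> u |c u. u \<in> ?K}"
    by (rule closed_cone_over_curve[OF sphere_curve(1) K]) (auto simp: unit_times_def)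
  then have "closed (insert 0 {c *s ?\<gamma> u |c u. u \<in> ?K})" by (rule closed_insert)
  moreover have "{v. v \<noteq> 0 \<and> line v \<in> ?U} = - insert 0 {c *s ?\<gamma> u |c u. u \<in> ?K}" (is "?l = ?r")
  proof -
    have "line_code (line v) \<le> t \<longleftrightarrow> v \<in> {c *s ?\<gamma> u |c u. u \<in> ?K}" if "v \<noteq> 0" for v
    proof
      assume le: "line_code (line v) \<le> t"
      have L: "line v \<in> proj UNIV" using that by (intro line_in_proj) auto
      have "line (rep (line v)) = line v"
        using line_code_attained[OF L] unit_times_nonzero by (intro line_eq_if_mem) (auto simp: rep_def)
      then obtain c where "v = c *s rep (line v)" using line_self[of v] mem_line_iff by metis
      then show "v \<in> {c *s ?\<gamma> u |c u. u \<in> ?K}"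
        using line_code_attained(1)[OF L] le unfolding rep_def by blast
    next
      assume "v \<in> {c *s ?\<gamma> u |c u. u \<in> ?K}"
      then obtain c u where u: "v = c *s ?\<gamma> u" "u \<in> ?K" by blast
      then have "line v = line (?\<gamma> u)" using that by (intro line_eq_if_mem) (auto simp: mem_line_iff)
      then have "line_code (line v) \<le> u"
        using that u line_self by (intro line_code_le line_in_proj) auto
      then show "line_code (line v) \<le> t" using u by auto
    qed
    then show ?thesis by (auto simp: line_in_proj)
  qed
  ultimately have "?U \<in> sets proj_borel" by (intro open_in_proj_borel) (auto simp: open_Compl)
  then have "space proj_borel - ?U \<in> sets proj_borel" by blast
  also have "space proj_borel - ?U = {L \<in> space proj_borel. line_code L \<le> t}" by auto
  finally show "{L \<in> space (proj_borel :: ('k ^ 'n) set measure). line_code L \<le> t} \<in> sets proj_borel" .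
qed

lemma rep_measurable [measurable]: "rep \<in> borel_measurable (proj_borel :: ('k::{real_normed_field, euclidean_space} ^ 'n) set measure)"
  unfolding rep_def[abs_def]
  by (rule measurable_compose[OF line_code_measurable borel_measurable_continuous_onI[OF sphere_curve(1)]])

lemma norm_rep: "L \<in> proj UNIV \<Longrightarrow> norm (rep L) = 1"
  using line_code_attained(1) by (auto simp: rep_def unit_times_def)

lemma rep_nonzero: "L \<in> proj UNIV \<Longrightarrow> rep L \<noteq> 0"
  using norm_rep[of L] by auto

lemma line_rep:
  assumes "L \<in> proj UNIV"
  shows "line (rep L) = L"
proof -
  obtain v where "L = line v" using assms by (auto simp: proj_def)
  then show ?thesis using line_eq_if_mem line_code_attained(2)[OF assms] rep_nonzero[OF assms] by blast
qed

lemma smult_rep: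
  fixes v :: "'k::{real_normed_field, euclidean_space} ^ 'n"
  assumes "v \<noteq> 0"
  obtains c where "v = c *s rep (line v)" "norm c = norm v" "c \<noteq> 0"
proof -
  have L: "line v \<in> proj UNIV" using assms by (intro line_in_proj) auto
  obtain c where c: "v = c *s rep (line v)"
    using line_rep[OF L] line_self[of v] mem_line_iff by metis
  then have "norm v = norm c" using norm_rep[OF L] norm_smult by (metis mult.right_neutral)
  with c assms show ?thesis by (intro that[of c]) auto
qed

definition proj_prob :: "('k::{real_normed_field, euclidean_space} ^ 'n) set measure \<Rightarrow> bool" where
  "proj_prob \<nu> \<longleftrightarrow> prob_space \<nu> \<and> sets \<nu> = sets proj_borel"

lemma proj_probD:
  assumes "proj_prob \<nu>"
  shows "prob_space \<nu>" "sets \<nu> = sets proj_borel" "space \<nu> = proj UNIV"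
  using assms sets_eq_imp_space_eq[of \<nu> proj_borel] by (auto simp: proj_prob_def)

lemma proj_prob_measurable: "proj_prob \<nu> \<Longrightarrow> f \<in> measurable proj_borel N \<Longrightarrow> f \<in> measurable \<nu> N"
  using measurable_cong_sets[OF proj_probD(2) refl] by blast

definition proj_weak_conv ::
    "(nat \<Rightarrow> ('k::{real_normed_field, euclidean_space} ^ 'n) set measure) \<Rightarrow> ('k ^ 'n) set measure \<Rightarrow> bool" where
  "proj_weak_conv \<nu> \<eta> \<longleftrightarrow> (\<forall>f. proj_continuous f \<longrightarrow> (\<lambda>n. \<integral>L. f L \<partial>\<nu> n) \<longlonglongrightarrow> (\<integral>L. f L \<partial>\<eta>))"

text \<open>
  The codes of the lines have laws on \<open>[0, 1]\<close>, so Helly's selection theorem provides a weak limit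
  on the real line. The limit is carried by the compact set of unit times, and the curve transports
  it back to projective space.
\<close>

theorem proj_prob_weakly_compact:
  fixes \<nu> :: "nat \<Rightarrow> ('k::{real_normed_field, euclidean_space} ^ 'n) set measure"
  assumes \<nu>: "\<And>n. proj_prob (\<nu> n)"
  obtains r \<eta> where "strict_mono r" "proj_prob \<eta>" "proj_weak_conv (\<lambda>n. \<nu> (r n)) \<eta>"
proof -
  let ?\<gamma> = "sphere_curve :: real \<Rightarrow> 'k ^ 'n"
  define K where "K = unit_times ?\<gamma>"
  have K: "compact K" unfolding K_def by (rule compact_unit_times[OF sphere_curve(1)])
  have code_K: "line_code L \<in> K" if "L \<in> proj (UNIV :: ('k ^ 'n) set)" for L
    using line_code_attained(1)[OF that] by (simp add: K_def)
  define m where "m n = distr (\<nu> n) borel line_code" for n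
  have [measurable]: "line_code \<in> borel_measurable (\<nu> n)" for n
    by (rule proj_prob_measurable[OF \<nu> line_code_measurable])
  have rd: "real_distribution (m n)" for n
    unfolding m_def using prob_space.real_distribution_distr[OF proj_probD(1)[OF \<nu>]] by simp
  have mass: "measure (m n) {-1<..1} = 1" for n
  proof -
    interpret prob_space "\<nu> n" using \<nu> by (rule proj_probD)
    have "line_code -` {-1<..1} \<inter> space (\<nu> n) = space (\<nu> n)"
      using code_K proj_probD(3)[OF \<nu>] by (fastforce simp: K_def unit_times_def)
    then show ?thesis by (simp add: m_def measure_distr prob_space)
  qed
  have "tight m"
    unfolding tight_def
  proof (intro conjI allI impI rd)
    fix \<epsilon> :: real assume "0 < \<epsilon>"
    then show "\<exists>a b. a < b \<and> (\<forall>n. 1 - \<epsilon> < measure (m n) {a<..b})"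
      using mass by (intro exI[of _ "-1"] exI[of _ "1"] conjI allI) auto
  qed
  then obtain r M where r: "strict_mono r" and M: "real_distribution M" "weak_conv_m (m \<circ> id \<circ> r) M"
    using tight_imp_convergent_subsubsequence[of m id] strict_mono_id by blast
  have conv: "weak_conv_m (\<lambda>n. m (r n)) M" using M(2) by (simp add: comp_def)
  interpret M: real_distribution M by fact
  have lim: "(\<lambda>n. \<integral>L. h (line_code L) \<partial>\<nu> (r n)) \<longlonglongrightarrow> (\<integral>t. h t \<partial>M)"
    if h: "continuous_on UNIV h" "\<And>t. \<bar>h t\<bar> \<le> B" for h :: "real \<Rightarrow> real" and B
  proof -
    have "(\<lambda>n. integral\<^sup>L (m (r n)) h) \<longlonglongrightarrow> integral\<^sup>L M h"
      using rd M(1) conv h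
      by (intro weak_conv_imp_integral_bdd_continuous_conv[where B = B])
        (auto simp: continuous_on_eq_continuous_at)
    moreover have "integral\<^sup>L (m (r n)) h = (\<integral>L. h (line_code L) \<partial>\<nu> (r n))" for n
      unfolding m_def
      by (intro integral_distr) (auto intro: borel_measurable_continuous_onI h)
    ultimately show ?thesis by simp
  qed
  have "space (\<nu> 0) \<noteq> {}" using prob_space.not_empty[OF proj_probD(1)[OF \<nu>]] by auto
  then obtain L0 where L0: "L0 \<in> proj (UNIV :: ('k ^ 'n) set)" using proj_probD(3)[OF \<nu>] by auto
  then have "K \<noteq> {}" using code_K by auto
  have "AE t in M. t \<in> K"
  proof -
    define h where "h t = min 1 (infdist t K)" for t :: real
    have "(\<lambda>n. \<integral>L. h (line_code L) \<partial>\<nu> (r n)) \<longlonglongrightarrow> (\<integral>t. h t \<partial>M)"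
      by (rule lim[of h 1]) (auto simp: h_def infdist_nonneg intro!: continuous_intros)
    moreover have "(\<integral>L. h (line_code L) \<partial>\<nu> n) = 0" for n
    proof -
      have "(\<integral>L. h (line_code L) \<partial>\<nu> n) = (\<integral>L. 0 \<partial>\<nu> n)"
        by (rule Bochner_Integration.integral_cong) (use code_K proj_probD(3)[OF \<nu>] in \<open>auto simp: h_def\<close>)
      then show ?thesis by simp
    qed
    ultimately have "(\<integral>t. h t \<partial>M) = 0" by (simp add: LIMSEQ_const_iff)
    moreover have "h \<in> borel_measurable borel"
      unfolding h_def by (intro borel_measurable_continuous_onI continuous_intros)
    then have "integrable M h"
      by (intro M.integrable_const_bound[where B = 1]) (auto simp: h_def infdist_nonneg)
    ultimately have "AE t in M. h t = 0"
      by (subst (asm) integral_nonneg_eq_0_iff_AE) (auto simp: h_def infdist_nonneg)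
    then show ?thesis
    proof eventually_elim
      case (elim t)
      then have "infdist t K = 0" by (auto simp: h_def min_def split: if_splits)
      then show ?case using in_closed_iff_infdist_zero[OF compact_imp_closed[OF K] \<open>K \<noteq> {}\<close>] by blast
    qed
  qed
  \<comment> \<open>The fixed unit vector off \<open>K\<close> keeps \<open>w\<close> non-zero everywhere.\<close>
  define w where "w t = (if t \<in> K then ?\<gamma> t else rep L0)" for t
  have w_nonzero: "w t \<noteq> 0" for t
    using rep_nonzero[OF L0] by (auto simp: w_def K_def unit_times_def)
  have [measurable]: "K \<in> sets borel" using K by (intro borel_closed compact_imp_closed)
  have [measurable]: "?\<gamma> \<in> borel_measurable borel"
    by (rule borel_measurable_continuous_onI[OF sphere_curve(1)])
  have w_meas: "w \<in> borel_measurable borel" unfolding w_def by measurable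
  have p: "(\<lambda>t. line (w t)) \<in> measurable M proj_borel"
    by (rule measurable_line_compose) (use w_meas w_nonzero in \<open>auto simp: measurable_cong_sets[OF M.events_eq_borel refl]\<close>)
  define \<eta> where "\<eta> = distr M proj_borel (\<lambda>t. line (w t))"
  have "proj_prob \<eta>" unfolding proj_prob_def \<eta>_def using M.prob_space_distr[OF p] by simp
  moreover have "proj_weak_conv (\<lambda>n. \<nu> (r n)) \<eta>"
    unfolding proj_weak_conv_def
  proof (intro allI impI)
    fix f :: "('k ^ 'n) set \<Rightarrow> real" assume f: "proj_continuous f"
    have cont: "continuous_on K (\<lambda>t. f (line (?\<gamma> t)))"
      using f unfolding proj_continuous_def
      by (rule continuous_on_compose2[where g = "\<lambda>v. f (line v)"])
        (auto intro!: continuous_on_subset[OF sphere_curve(1)] simp: K_def unit_times_def)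
    have "bounded ((\<lambda>t. f (line (?\<gamma> t))) ` K)"
      by (intro compact_imp_bounded compact_continuous_image cont K)
    then obtain B where "0 < B" "\<And>t. t \<in> K \<Longrightarrow> norm (f (line (?\<gamma> t))) \<le> B"
      unfolding bounded_pos by blast
    then have B: "0 \<le> B" "\<And>t. t \<in> K \<Longrightarrow> norm (f (line (?\<gamma> t))) \<le> B" by auto
    \<comment> \<open>Weak convergence on the line needs a test function that is continuous everywhere, not only on \<open>K\<close>.\<close>
    obtain h where h: "continuous_on UNIV h" "\<And>t. t \<in> K \<Longrightarrow> h t = f (line (?\<gamma> t))" "\<And>t. norm (h t) \<le> B"
      by (rule Tietze[OF cont, of UNIV B]) (use B compact_imp_closed[OF K] in auto)
    have "(\<lambda>n. \<integral>L. h (line_code L) \<partial>\<nu> (r n)) \<longlonglongrightarrow> (\<integral>t. h t \<partial>M)"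
      by (rule lim[OF h(1)]) (use h(3) in simp)
    moreover have "(\<integral>L. h (line_code L) \<partial>\<nu> n) = (\<integral>L. f L \<partial>\<nu> n)" for n
    proof (rule Bochner_Integration.integral_cong)
      fix L assume "L \<in> space (\<nu> n)"
      then have L: "L \<in> proj UNIV" using proj_probD(3)[OF \<nu>] by simp
      show "h (line_code L) = f L" using h(2)[OF code_K[OF L]] line_rep[OF L] by (simp add: rep_def)
    qed simp
    moreover have "(\<integral>t. h t \<partial>M) = (\<integral>L. f L \<partial>\<eta>)"
    proof -
      have [measurable]: "h \<in> borel_measurable M" "(\<lambda>t. f (line (w t))) \<in> borel_measurable M"
        using borel_measurable_continuous_onI[OF h(1)] measurable_compose[OF p proj_continuous_measurable[OF f]]
        by (simp_all add: measurable_cong_sets[OF M.events_eq_borel refl])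
      have "(\<integral>t. h t \<partial>M) = (\<integral>t. f (line (w t)) \<partial>M)"
      proof (rule integral_cong_AE)
        show "AE t in M. h t = f (line (w t))"
          using \<open>AE t in M. t \<in> K\<close> by eventually_elim (simp add: w_def h)
      qed measurable
      then show ?thesis unfolding \<eta>_def by (simp add: integral_distr[OF p proj_continuous_measurable[OF f]])
    qed
    ultimately show "(\<lambda>n. \<integral>L. f L \<partial>\<nu> (r n)) \<longlonglongrightarrow> (\<integral>L. f L \<partial>\<eta>)" by simp
  qed
  ultimately show ?thesis using r that by blast
qed

lemma proj_continuous_bounded:
  fixes f :: "('k::{real_normed_field, euclidean_space} ^ 'n) set \<Rightarrow> real"
  assumes "proj_continuous f"
  obtains B where "B \<ge> 0" "\<And>L. L \<in> proj UNIV \<Longrightarrow> \<bar>f L\<bar> \<le> B"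
proof -
  have "continuous_on (sphere 0 1 :: ('k ^ 'n) set) (\<lambda>v. f (line v))"
    using assms unfolding proj_continuous_def by (rule continuous_on_subset) auto
  then have "bounded ((\<lambda>v. f (line v)) ` sphere 0 1)"
    by (intro compact_imp_bounded compact_continuous_image) auto
  then obtain B where B: "B > 0" "\<And>v. v \<in> sphere 0 1 \<Longrightarrow> norm (f (line v)) \<le> B"
    unfolding bounded_pos by blast
  have "\<bar>f L\<bar> \<le> B" if "L \<in> proj UNIV" for L
    using B(2)[of "rep L"] norm_rep[OF that] line_rep[OF that] by simp
  with B show ?thesis using that[of B] by simp
qed

lemma proj_continuous_integrable:
  assumes "proj_continuous f" "proj_prob \<nu>"
  shows "integrable \<nu> f"
proof -
  interpret prob_space \<nu> using assms by (auto dest: proj_probD)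
  obtain B where "\<And>L. L \<in> proj UNIV \<Longrightarrow> \<bar>f L\<bar> \<le> B" using proj_continuous_bounded[OF assms(1)] by blast
  then show ?thesis
    using proj_prob_measurable[OF assms(2) proj_continuous_measurable[OF assms(1)]] proj_probD(3)[OF assms(2)]
    by (intro integrable_const_bound[where B = B] AE_I2) auto
qed

lemma infdist_smult:
  fixes C :: "('k::{real_normed_field, euclidean_space} ^ 'n) set"
  assumes cone: "\<And>c v. v \<in> C \<Longrightarrow> c *s v \<in> C" and c: "c \<noteq> 0"
  shows "infdist (c *s v) C = norm c * infdist v C"
proof (cases "C = {}")
  case False
  have le: "infdist (c *s v) C \<le> norm c * infdist v C" if "c \<noteq> 0" for c v
  proof -
    have "infdist (c *s v) C / norm c \<le> dist v a" if "a \<in> C" for a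
    proof -
      have "infdist (c *s v) C \<le> dist (c *s v) (c *s a)" by (intro infdist_le cone that)
      also have "\<dots> = norm c * dist v a"
        unfolding dist_norm vec.scale_right_diff_distrib[symmetric] by (rule norm_smult)
      finally show ?thesis using \<open>c \<noteq> 0\<close> by (simp add: field_simps)
    qed
    then have "infdist (c *s v) C / norm c \<le> infdist v C"
      using False by (auto simp: infdist_def intro!: cINF_greatest)
    then show ?thesis using that by (simp add: field_simps)
  qed
  have "infdist (inverse c *s (c *s v)) C \<le> norm (inverse c) * infdist (c *s v) C"
    using c by (intro le) simp
  then have "norm c * infdist v C \<le> infdist (c *s v) C"
    using c by (simp add: norm_divide field_simps)
  with le[OF c, of v] show ?thesis by simp
qed (simp add: infdist_def)

text \<open>
  The distance to a cone is homogeneous, so it descends from vectors to lines after division by the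
  norm. This is the source of all the explicit continuous functions on projective space used below.
\<close>

lemma infdist_rep_line:
  fixes C :: "('k::{real_normed_field, euclidean_space} ^ 'n) set"
  assumes cone: "\<And>c v. v \<in> C \<Longrightarrow> c *s v \<in> C" and v: "v \<noteq> 0"
  shows "infdist (rep (line v)) C = infdist v C / norm v"
proof -
  obtain c where c: "v = c *s rep (line v)" "norm c = norm v" "c \<noteq> 0" using smult_rep[OF v] .
  have "infdist v C = norm v * infdist (rep (line v)) C"
    using infdist_smult[OF cone c(3), of "rep (line v)"] c(1,2) by simp
  then show ?thesis using v by simp
qed

lemma proj_continuous_infdist_rep:
  fixes C :: "('k::{real_normed_field, euclidean_space} ^ 'n) set"
  assumes cone: "\<And>c v. v \<in> C \<Longrightarrow> c *s v \<in> C"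
  shows "proj_continuous (\<lambda>L. infdist (rep L) C)"
proof -
  have "continuous_on (- {0}) (\<lambda>v. infdist v C / norm v)" by (intro continuous_intros) auto
  then show ?thesis unfolding proj_continuous_def
    by (rule continuous_on_eq) (use infdist_rep_line[OF cone] in auto)
qed

definition cone_of :: "('k::{real_normed_field, euclidean_space} ^ 'n) set set \<Rightarrow> ('k ^ 'n) set" where
  "cone_of U = {v. v \<noteq> 0 \<and> line v \<in> U}"

lemma proj_cone_of: "U \<subseteq> proj UNIV \<Longrightarrow> proj (cone_of U) = U"
  by (auto simp: proj_def cone_of_def image_iff)

lemma smult_Compl_cone_of: "v \<in> - cone_of U \<Longrightarrow> c *s v \<in> - cone_of U"
  using line_smult[of c v] by (cases "c = 0") (auto simp: cone_of_def)

lemma open_cone_of_proj: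
  fixes V :: "('k::{real_normed_field, euclidean_space} ^ 'n) set"
  assumes "open V"
  shows "open (cone_of (proj V))"
proof -
  have "cone_of (proj V) = (\<Union>c\<in>- {0}. (\<lambda>v. c *s v) -` V \<inter> - {0})"
  proof (intro equalityI subsetI)
    fix v assume "v \<in> cone_of (proj V)"
    then obtain w where w: "v \<noteq> 0" "w \<in> V" "w \<noteq> 0" "line v = line w" by (auto simp: cone_of_def proj_def)
    then obtain c where "w = c *s v" using line_self[of w] mem_line_iff[of w v] by auto
    then show "v \<in> (\<Union>c\<in>- {0}. (\<lambda>v. c *s v) -` V \<inter> - {0})" using w by auto
  next
    fix v assume "v \<in> (\<Union>c\<in>- {0}. (\<lambda>v. c *s v) -` V \<inter> - {0})"
    then obtain c where c: "c \<noteq> 0" "c *s v \<in> V" "v \<noteq> 0" by auto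
    then have "line (c *s v) \<in> proj V" by (intro line_in_proj) auto
    then show "v \<in> cone_of (proj V)" using c line_smult[of c v] by (simp add: cone_of_def)
  qed
  moreover have "open ((\<lambda>v. c *s v) -` V \<inter> - {0})" for c :: 'k
  proof -
    have "continuous_on UNIV (\<lambda>v :: 'k ^ 'n. c *s v)" by (intro continuous_intros)
    then show ?thesis using assms by (intro open_Int open_vimage) auto
  qed
  ultimately show ?thesis by (metis (no_types, lifting) open_UN)
qed

lemma open_cone_measurable: "U \<subseteq> proj UNIV \<Longrightarrow> open (cone_of U) \<Longrightarrow> U \<in> sets proj_borel"
  by (intro open_in_proj_borel) (auto simp: cone_of_def)

lemma proj_measurable:
  fixes W :: "('a::{real_normed_field, euclidean_space} ^ 'b) set"
  assumes "vec.subspace W"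
  shows "proj W \<in> sets proj_borel"
proof -
  have "cone_of (proj UNIV - proj W) = - W"
  proof (intro set_eqI)
    fix v :: "'a ^ 'b"
    show "v \<in> cone_of (proj UNIV - proj W) \<longleftrightarrow> v \<in> - W"
      using line_in_proj_iff[OF assms, of v] line_in_proj[of v UNIV] vec.subspace_0[OF assms]
      by (cases "v = 0") (auto simp: cone_of_def)
  qed
  then have "proj UNIV - proj W \<in> sets proj_borel"
    using closed_vec_subspace[OF assms] by (intro open_cone_measurable) (auto simp: open_Compl)
  then have "space proj_borel - (proj UNIV - proj W) \<in> sets proj_borel" by blast
  also have "space proj_borel - (proj UNIV - proj W) = proj W" using proj_mono[of W UNIV] by auto
  finally show ?thesis .
qed

text \<open>
  Continuous functions that increase with \<open>m\<close> to the indicator of an open set \<open>U\<close> of lines.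
\<close>

definition bump :: "('k::{real_normed_field, euclidean_space} ^ 'n) set set \<Rightarrow> nat \<Rightarrow> ('k ^ 'n) set \<Rightarrow> real" where
  "bump U m L = min 1 (real m * infdist (rep L) (- cone_of U))"

lemma proj_continuous_bump: "proj_continuous (bump U m)"
proof -
  have "proj_continuous (\<lambda>L. infdist (rep L) (- cone_of U))"
    by (rule proj_continuous_infdist_rep) (rule smult_Compl_cone_of)
  then show ?thesis
    unfolding proj_continuous_def bump_def
    by (intro continuous_on_min continuous_on_mult continuous_on_const)
qed

lemma bump_bounds: "0 \<le> bump U m L" "bump U m L \<le> 1" "\<bar>bump U m L\<bar> \<le> 1"
  by (auto simp: bump_def infdist_nonneg)

lemma bump_tendsto_indicator:
  assumes U: "open (cone_of U)" and L: "L \<in> proj UNIV"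
  shows "(\<lambda>m. bump U m L) \<longlonglongrightarrow> indicator U L"
proof (cases "L \<in> U")
  case False
  then have "rep L \<in> - cone_of U" using line_rep[OF L] by (simp add: cone_of_def)
  then show ?thesis using False by (simp add: bump_def)
next
  case True
  let ?d = "infdist (rep L) (- cone_of U)"
  have "rep L \<notin> - cone_of U" using True line_rep[OF L] rep_nonzero[OF L] by (simp add: cone_of_def)
  moreover have "0 \<in> - cone_of U" by (simp add: cone_of_def)
  ultimately have "?d > 0"
    using in_closed_iff_infdist_zero[of "- cone_of U" "rep L"] U infdist_nonneg[of "rep L" "- cone_of U"]
    by (auto simp: closed_def less_le)
  then obtain m0 :: nat where "1 / ?d < real m0" using reals_Archimedean2 by blast
  then have "1 \<le> real m * ?d" if "m \<ge> m0" for m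
  proof -
    have "1 / ?d \<le> real m" using \<open>1 / ?d < real m0\<close> that by simp
    then show ?thesis using \<open>?d > 0\<close> by (simp add: field_simps)
  qed
  then have "bump U m L = indicator U L" if "m \<ge> m0" for m
    using True that by (simp add: bump_def min_absorb1)
  then have "\<forall>\<^sub>F m in sequentially. bump U m L = indicator U L"
    by (auto simp: eventually_sequentially)
  then show ?thesis by (rule tendsto_eventually)
qed

lemma measure_eq_lim_bump:
  assumes U: "open (cone_of U)" "U \<subseteq> proj UNIV" and \<nu>: "proj_prob \<nu>"
  shows "(\<lambda>m. \<integral>L. bump U m L \<partial>\<nu>) \<longlonglongrightarrow> measure \<nu> U"
proof -
  interpret prob_space \<nu> using \<nu> by (rule proj_probD)
  have [measurable]: "U \<in> sets \<nu>" using open_cone_measurable[OF U(2,1)] proj_probD(2)[OF \<nu>] by simp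
  have "(\<lambda>m. \<integral>L. bump U m L \<partial>\<nu>) \<longlonglongrightarrow> (\<integral>L. indicator U L \<partial>\<nu>)"
  proof (rule integral_dominated_convergence[where w = "\<lambda>_. 1"])
    show "bump U m \<in> borel_measurable \<nu>" for m
      by (rule proj_prob_measurable[OF \<nu> proj_continuous_measurable[OF proj_continuous_bump]])
    show "AE L in \<nu>. (\<lambda>m. bump U m L) \<longlonglongrightarrow> indicator U L"
      using bump_tendsto_indicator[OF U(1)] proj_probD(3)[OF \<nu>] by (intro AE_I2) auto
    show "AE L in \<nu>. norm (bump U m L) \<le> 1" for m
      using bump_bounds[of U m] by (intro AE_I2) auto
  qed auto
  then show ?thesis by simp
qed

text \<open>
  Every open set of lines is an increasing union of sets \<open>proj (\<Union>A)\<close> with \<open>A\<close> a finite part of a fixed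
  countable basis. The bumps of these countably many sets determine their measures, hence the
  measures of all open sets.
\<close>

theorem ex_determining_sequence:
  obtains F :: "nat \<Rightarrow> ('k::{real_normed_field, euclidean_space} ^ 'n) set \<Rightarrow> real"
  where "\<And>i. proj_continuous (F i)" "\<And>i L. \<bar>F i L\<bar> \<le> 1"
    and "\<And>\<nu> \<eta>. proj_prob \<nu> \<Longrightarrow> proj_prob \<eta> \<Longrightarrow> (\<And>i. (\<integral>L. F i L \<partial>\<nu>) = (\<integral>L. F i L \<partial>\<eta>)) \<Longrightarrow> \<nu> = \<eta>"
proof -
  obtain B :: "('k ^ 'n) set set" where B: "countable B" "topological_basis B" using ex_countable_basis by blast
  define I where "I = {A. finite A \<and> A \<subseteq> B} \<times> (UNIV :: nat set)"
  have I: "countable I" "I \<noteq> {}"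
    unfolding I_def using countable_Collect_finite_subset[OF B(1)] by auto
  define F where "F i = (case from_nat_into I i of (A, m) \<Rightarrow> bump (proj (\<Union>A)) m)" for i
  show ?thesis
  proof (rule that[of F])
    show "proj_continuous (F i)" for i by (simp add: F_def case_prod_beta proj_continuous_bump)
    show "\<bar>F i L\<bar> \<le> 1" for i L by (simp add: F_def case_prod_beta bump_bounds)
  next
    fix \<nu> \<eta> :: "('k ^ 'n) set measure"
    assume \<nu>: "proj_prob \<nu>" and \<eta>: "proj_prob \<eta>" and eq: "\<And>i. (\<integral>L. F i L \<partial>\<nu>) = (\<integral>L. F i L \<partial>\<eta>)"
    interpret \<nu>: prob_space \<nu> using \<nu> by (rule proj_probD)
    interpret \<eta>: prob_space \<eta> using \<eta> by (rule proj_probD)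
    have open_A: "open (cone_of (proj (\<Union>A)))" if "A \<subseteq> B" for A
      using that B(2) by (intro open_cone_of_proj open_Union) (auto intro: topological_basis_open)
    have fin: "measure \<nu> (proj (\<Union>A)) = measure \<eta> (proj (\<Union>A))" if A: "finite A" "A \<subseteq> B" for A
    proof -
      have "(\<integral>L. bump (proj (\<Union>A)) m L \<partial>\<nu>) = (\<integral>L. bump (proj (\<Union>A)) m L \<partial>\<eta>)" for m
      proof -
        have "(A, m) \<in> I" using A by (simp add: I_def)
        then obtain i where "from_nat_into I i = (A, m)" using range_from_nat_into[OF I(2,1)] by (metis imageE)
        then show ?thesis using eq[of i] by (simp add: F_def)
      qed
      then show ?thesis
        using measure_eq_lim_bump[OF open_A[OF A(2)] proj_mono \<nu>] measure_eq_lim_bump[OF open_A[OF A(2)] proj_mono \<eta>]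
        by (auto intro: LIMSEQ_unique)
    qed
    let ?E = "{U. U \<subseteq> proj (UNIV :: ('k ^ 'n) set) \<and> open (cone_of U)}"
    have eq_open: "measure \<nu> U = measure \<eta> U" if U: "U \<in> ?E" for U
    proof (cases "U = {}")
      case False
      obtain B' where B': "B' \<subseteq> B" "\<Union>B' = cone_of U"
        using U B(2) unfolding topological_basis_def by blast
      have "B' \<noteq> {}" using False B' proj_cone_of[of U] U by (auto simp: proj_def)
      moreover have "countable B'" using B' B(1) countable_subset by blast
      ultimately have B'_range: "range (from_nat_into B') = B'" by (rule range_from_nat_into)
      define A where "A n = proj (\<Union>(from_nat_into B' ` {..<n}))" for n :: nat
      have sub: "from_nat_into B' ` {..<n} \<subseteq> B" for n using B'_range B' by blast
      have meas: "A n \<in> sets proj_borel" for n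
        unfolding A_def by (intro open_cone_measurable proj_mono open_A sub) simp
      have "(\<Union>n. A n) = proj (\<Union>(range (from_nat_into B')))"
        unfolding A_def proj_def by auto
      also have "\<dots> = U" using B'_range B' proj_cone_of[of U] U by simp
      finally have Un: "(\<Union>n. A n) = U" .
      have inc: "incseq A" unfolding A_def incseq_def by (intro allI impI proj_mono Union_mono image_mono) auto
      have "measure \<nu> (A n) = measure \<eta> (A n)" for n unfolding A_def by (intro fin sub) simp
      moreover have "(\<lambda>n. measure \<nu> (A n)) \<longlonglongrightarrow> measure \<nu> U"
        using \<nu>.finite_Lim_measure_incseq[OF _ inc] meas proj_probD(2)[OF \<nu>] Un by auto
      moreover have "(\<lambda>n. measure \<eta> (A n)) \<longlonglongrightarrow> measure \<eta> U"
        using \<eta>.finite_Lim_measure_incseq[OF _ inc] meas proj_probD(2)[OF \<eta>] Un by auto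
      ultimately show ?thesis by (auto intro: LIMSEQ_unique)
    qed simp
    have gen: "sets (proj_borel :: ('k ^ 'n) set measure) = sigma_sets (proj UNIV) ?E"
      unfolding sets_proj_borel cone_of_def ..
    show "\<nu> = \<eta>"
    proof (rule measure_eqI_generator_eq[where A = "\<lambda>_. proj UNIV" and \<Omega> = "proj UNIV" and E = ?E])
      show "Int_stable ?E"
      proof (rule Int_stableI, elim CollectE conjE, intro CollectI conjI)
        fix U U' :: "('k ^ 'n) set set" assume "open (cone_of U)" "open (cone_of U')"
        moreover have "cone_of (U \<inter> U') = cone_of U \<inter> cone_of U'" by (auto simp: cone_of_def)
        ultimately show "open (cone_of (U \<inter> U'))" by (simp add: open_Int)
      qed auto
      show "emeasure \<nu> U = emeasure \<eta> U" if "U \<in> ?E" for U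
        using eq_open[OF that] by (simp add: \<nu>.emeasure_eq_measure \<eta>.emeasure_eq_measure)
      have "cone_of (proj UNIV) = - {0 :: 'k ^ 'n}" by (auto simp: cone_of_def line_in_proj)
      then show "range (\<lambda>_ :: nat. proj (UNIV :: ('k ^ 'n) set)) \<subseteq> ?E" by (auto simp: open_Compl)
      show "emeasure \<nu> (proj UNIV) \<noteq> \<infinity>" for i :: nat by simp
    qed (use gen proj_probD(2)[OF \<nu>] proj_probD(2)[OF \<eta>] in auto)
  qed
qed

section \<open>The subadditive ergodic theorem\<close>

locale measure_preserving_system = prob_space M for M :: "'a measure" +
  fixes T :: "'a \<Rightarrow> 'a"
  assumes T_measurable [measurable]: "T \<in> measurable M M"
    and distr_T: "distr M M T = M"
begin

lemma iterate_measurable [measurable]: "(T ^^ n) \<in> measurable M M"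
  by (induction n) simp_all

lemma T_in_space: "x \<in> space M \<Longrightarrow> T x \<in> space M"
  using measurable_space[OF T_measurable] .

lemma iterate_in_space: "x \<in> space M \<Longrightarrow> (T ^^ n) x \<in> space M"
  using measurable_space[OF iterate_measurable] .

lemma distr_iterate: "distr M M (T ^^ n) = M"
proof (induction n)
  case (Suc n)
  have "distr M M (T ^^ Suc n) = distr (distr M M (T ^^ n)) M T"
    unfolding funpow.simps by (rule distr_distr[symmetric]) simp_all
  then show ?case by (simp only: Suc.IH distr_T)
qed (simp add: id_def)

lemma
  fixes f :: "'a \<Rightarrow> real"
  assumes [measurable]: "f \<in> borel_measurable M"
  shows integral_iterate: "(\<integral>x. f ((T ^^ n) x) \<partial>M) = (\<integral>x. f x \<partial>M)"
    and integrable_iterate_iff: "integrable M (\<lambda>x. f ((T ^^ n) x)) \<longleftrightarrow> integrable M f"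
proof -
  show "(\<integral>x. f ((T ^^ n) x) \<partial>M) = (\<integral>x. f x \<partial>M)"
    using integral_distr[of "T ^^ n" M M f] by (simp add: distr_iterate)
  show "integrable M (\<lambda>x. f ((T ^^ n) x)) \<longleftrightarrow> integrable M f"
    using integrable_distr_eq[of "T ^^ n" M M f] by (simp add: distr_iterate)
qed

lemma integrable_iterate:
  fixes f :: "'a \<Rightarrow> real"
  shows "integrable M f \<Longrightarrow> integrable M (\<lambda>x. f ((T ^^ n) x))"
  using integrable_iterate_iff[of f n] by auto

end

lemma sum_lessThan_add:
  fixes f :: "nat \<Rightarrow> 'b::comm_monoid_add"
  shows "(\<Sum>i<m + n. f i) = (\<Sum>i<m. f i) + (\<Sum>i<n. f (m + i))"
  by (induction n) (simp_all add: add.assoc)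

lemma iterate_iterate: "(f ^^ i) ((f ^^ s) x) = (f ^^ (s + i)) x"
  using funpow_add[of i s f] by (simp add: add.commute)

text \<open>
  The bound \<open>a_Suc\<close> is two-sided: it makes \<open>a n\<close> integrable, and it makes the lower growth rate of
  \<open>a n x\<close> exactly invariant under \<open>T\<close>.
\<close>

locale subadditive_process = measure_preserving_system +
  fixes a :: "nat \<Rightarrow> 'a \<Rightarrow> real" and Y :: "'a \<Rightarrow> real"
  assumes a_measurable [measurable]: "\<And>n. a n \<in> borel_measurable M"
    and Y_integrable: "integrable M Y"
    and a_0: "\<And>x. x \<in> space M \<Longrightarrow> a 0 x = 0"
    and subadditive: "\<And>m n x. x \<in> space M \<Longrightarrow> a (m + n) x \<le> a m x + a n ((T ^^ m) x)"
    and a_Suc: "\<And>n x. x \<in> space M \<Longrightarrow> \<bar>a (Suc n) x - a n (T x)\<bar> \<le> Y x"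
begin

lemma Y_measurable [measurable]: "Y \<in> borel_measurable M"
  using Y_integrable by auto

lemma Y_nonneg: "x \<in> space M \<Longrightarrow> 0 \<le> Y x"
  using a_Suc[of x 0] by linarith

lemma abs_a_le: "x \<in> space M \<Longrightarrow> \<bar>a n x\<bar> \<le> (\<Sum>i<n. Y ((T ^^ i) x))"
proof (induction n arbitrary: x)
  case (Suc n)
  have "\<bar>a (Suc n) x\<bar> \<le> Y x + (\<Sum>i<n. Y ((T ^^ i) (T x)))"
    using Suc.IH[OF T_in_space[OF Suc.prems]] a_Suc[OF Suc.prems, of n] by linarith
  then show ?case by (simp add: sum.lessThan_Suc_shift funpow_swap1 del: sum.lessThan_Suc)
qed (simp add: a_0)

lemma a_integrable: "integrable M (a n)"
proof (rule Bochner_Integration.integrable_bound)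
  show "integrable M (\<lambda>x. \<Sum>i<n. Y ((T ^^ i) x))"
    by (intro Bochner_Integration.integrable_sum integrable_iterate Y_integrable)
  show "AE x in M. norm (a n x) \<le> norm (\<Sum>i<n. Y ((T ^^ i) x))"
    using order_trans[OF abs_a_le abs_ge_self] by (intro AE_I2) simp
qed simp

text \<open>
  By subadditivity the infimum is also the limit of the same quotients.
\<close>

definition time_constant :: real where
  "time_constant = (INF n\<in>{1..}. (\<integral>x. a n x \<partial>M) / real n)"

lemma abs_integral_a_le: "\<bar>\<integral>x. a n x \<partial>M\<bar> \<le> real n * (\<integral>x. Y x \<partial>M)"
proof -
  have "\<bar>\<integral>x. a n x \<partial>M\<bar> \<le> (\<integral>x. \<bar>a n x\<bar> \<partial>M)" by (rule integral_abs_bound)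
  also have "\<dots> \<le> (\<integral>x. (\<Sum>i<n. Y ((T ^^ i) x)) \<partial>M)"
    using abs_a_le a_integrable
    by (intro integral_mono_AE Bochner_Integration.integrable_sum integrable_iterate Y_integrable AE_I2) auto
  also have "\<dots> = real n * (\<integral>x. Y x \<partial>M)"
    by (simp add: Bochner_Integration.integral_sum integrable_iterate Y_integrable integral_iterate)
  finally show ?thesis .
qed

lemma bdd_below_time_constant: "bdd_below ((\<lambda>n. (\<integral>x. a n x \<partial>M) / real n) ` {1..})"
proof (rule bdd_belowI2)
  fix n :: nat assume "n \<in> {1..}"
  then show "- (\<integral>x. Y x \<partial>M) \<le> (\<integral>x. a n x \<partial>M) / real n"
    using abs_integral_a_le[of n] by (simp add: field_simps abs_le_iff)
qed

lemma time_constant_le: "n \<ge> 1 \<Longrightarrow> real n * time_constant \<le> (\<integral>x. a n x \<partial>M)"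
  unfolding time_constant_def
  using cINF_lower[OF bdd_below_time_constant, of n] by (simp add: field_simps)

lemma time_constant_approx:
  assumes "time_constant < c"
  obtains n where "n \<ge> 1" "(\<integral>x. a n x \<partial>M) / real n < c"
  using assms cINF_less_iff[OF _ bdd_below_time_constant, of c] that
  unfolding time_constant_def by auto

text \<open>
  The covering argument of Katznelson and Weiss. Almost every orbit can be cut into pieces of
  length at most \<open>N\<close> on which \<open>a\<close> grows at rate at most \<open>c\<close>, except at the rare points \<open>B N\<close> that wait
  longer than \<open>N\<close> for such a piece, and near the end of the orbit. Subadditivity adds up the pieces,
  and invariance of the measure turns the exceptional terms into a small error after integration.
\<close>

lemma time_constant_le_if_low_somewhere:
  assumes low: "AE x in M. \<exists>n\<ge>1. a n x \<le> real n * c"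
  shows "time_constant \<le> c"
proof (rule field_le_epsilon)
  fix \<epsilon> :: real assume "\<epsilon> > 0"
  define Z where "Z x = Y x + \<bar>c\<bar>" for x
  have Z_int: "integrable M Z" unfolding Z_def using Y_integrable by simp
  then have [measurable]: "Z \<in> borel_measurable M" by auto
  have Z_nonneg: "0 \<le> Z x" if "x \<in> space M" for x
    using Y_nonneg[OF that] by (simp add: Z_def)
  define B where "B N = {x \<in> space M. \<forall>n\<in>{1..N}. real n * c < a n x}" for N :: nat
  have B [measurable]: "B N \<in> sets M" for N unfolding B_def by measurable
  have "(\<lambda>N. \<integral>x. indicator (B N) x * Z x \<partial>M) \<longlonglongrightarrow> (\<integral>x. 0 \<partial>M)"
  proof (rule integral_dominated_convergence[where w = Z])
    show "AE x in M. (\<lambda>N. indicator (B N) x * Z x) \<longlonglongrightarrow> 0"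
      using low
    proof eventually_elim
      case (elim x)
      then obtain n where n: "n \<ge> 1" "a n x \<le> real n * c" by blast
      have "\<forall>\<^sub>F N in sequentially. indicator (B N) x * Z x = 0"
        using eventually_ge_at_top[of n]
        by eventually_elim (use n in \<open>auto simp: B_def not_less indicator_def intro!: bexI[of _ n]\<close>)
      then show ?case by (rule tendsto_eventually)
    qed
    show "AE x in M. norm (indicator (B N) x * Z x) \<le> Z x" for N
      using Z_nonneg by (intro AE_I2) (auto simp: indicator_def)
  qed (use Z_int in auto)
  then have "\<forall>\<^sub>F N in sequentially. (\<integral>x. indicator (B N) x * Z x \<partial>M) < \<epsilon> / 2"
    using \<open>\<epsilon> > 0\<close> by (intro order_tendstoD(2)) auto
  then obtain N where N: "N \<ge> 1" "(\<integral>x. indicator (B N) x * Z x \<partial>M) < \<epsilon> / 2"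
    using eventually_conj[OF eventually_ge_at_top[of 1]] by (metis (no_types, lifting) eventually_sequentially order_refl)
  \<comment> \<open>The cost of position \<open>i\<close> in an orbit of length \<open>L\<close>: it is paid at points of \<open>B N\<close> and during the last \<open>N\<close> steps.\<close>
  define w where "w L i x = Z x * (indicator (B N) x + of_bool (L \<le> i + N))" for L i x
  have w_nonneg: "0 \<le> w L i x" if "x \<in> space M" for L i x
    using Z_nonneg[OF that] by (simp add: w_def)
  have cover: "a L x \<le> real L * c + (\<Sum>i<L. w L i ((T ^^ i) x))" if "x \<in> space M" for L x
    using that
  proof (induction L arbitrary: x rule: less_induct)
    case (less L)
    obtain s where s: "1 \<le> s" "s \<le> N" "a s x \<le> real s * c + indicator (B N) x * Z x"
    proof (cases "x \<in> B N")
      case True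
      have "a 1 x \<le> a 0 (T x) + Y x" using a_Suc[OF less.prems, of 0] by simp
      then have "a 1 x \<le> Y x" using a_0[OF T_in_space[OF less.prems]] by simp
      then have "a 1 x \<le> real 1 * c + indicator (B N) x * Z x" using True by (simp add: Z_def)
      with N(1) that[of 1] show ?thesis by simp
    next
      case False
      with less.prems obtain n where "n \<in> {1..N}" "a n x \<le> real n * c"
        by (auto simp: B_def not_less)
      with that[of n] False show ?thesis by simp
    qed
    show ?case
    proof (cases "s \<le> L")
      case True
      then obtain k where L: "L = s + k" using le_Suc_ex by blast
      have x': "(T ^^ s) x \<in> space M" using less.prems by (rule iterate_in_space)
      have "a L x \<le> a s x + a k ((T ^^ s) x)" unfolding L by (rule subadditive) fact
      also have "a k ((T ^^ s) x) \<le> real k * c + (\<Sum>i<k. w k i ((T ^^ i) ((T ^^ s) x)))"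
        by (rule less.IH) (use s L x' in auto)
      also have "(\<Sum>i<k. w k i ((T ^^ i) ((T ^^ s) x))) = (\<Sum>i<k. w L (s + i) ((T ^^ (s + i)) x))"
        by (intro sum.cong refl) (simp add: w_def L iterate_iterate add.assoc)
      finally have tail: "a L x \<le> a s x + (real k * c + (\<Sum>i<k. w L (s + i) ((T ^^ (s + i)) x)))" by simp
      have "indicator (B N) x * Z x \<le> (\<Sum>i<s. w L i ((T ^^ i) x))"
      proof -
        have "indicator (B N) x * Z x \<le> w L 0 ((T ^^ 0) x)"
          using Z_nonneg[OF less.prems] by (simp add: w_def algebra_simps)
        also have "\<dots> \<le> (\<Sum>i<s. w L i ((T ^^ i) x))"
          using s(1) less.prems by (intro member_le_sum w_nonneg iterate_in_space) auto
        finally show ?thesis .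
      qed
      then have "a L x \<le> (real s + real k) * c
          + ((\<Sum>i<s. w L i ((T ^^ i) x)) + (\<Sum>i<k. w L (s + i) ((T ^^ (s + i)) x)))"
        using tail s(3) by (simp add: distrib_right)
      then show ?thesis by (simp add: L sum_lessThan_add)
    next
      case False
      then have "L \<le> i + N" for i using s(2) by linarith
      then have "Z ((T ^^ i) x) \<le> w L i ((T ^^ i) x)" if "i < L" for i
        using Z_nonneg[OF iterate_in_space[OF less.prems], of i] \<open>L \<le> i + N\<close>
        by (simp add: w_def distrib_left)
      then have "(\<Sum>i<L. Z ((T ^^ i) x)) \<le> (\<Sum>i<L. w L i ((T ^^ i) x))"
        by (intro sum_mono) auto
      moreover have "(\<Sum>i<L. Z ((T ^^ i) x)) = (\<Sum>i<L. Y ((T ^^ i) x)) + real L * \<bar>c\<bar>"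
        by (simp add: Z_def sum.distrib)
      moreover have "0 \<le> real L * \<bar>c\<bar> + real L * c"
        by (simp add: distrib_left[symmetric])
      ultimately show ?thesis using abs_a_le[OF less.prems, of L] by linarith
    qed
  qed
  have w_int: "integrable M (w L i)" for L i
    unfolding w_def by (intro Bochner_Integration.integrable_bound[OF integrable_mult_right[OF Z_int, of 2]])
      (use Z_nonneg in \<open>auto simp: indicator_def abs_mult intro!: AE_I2\<close>)
  have w_integral: "(\<integral>x. w L i x \<partial>M) \<le> \<epsilon> / 2 + of_bool (L \<le> i + N) * (\<integral>x. Z x \<partial>M)" for L i
  proof -
    have "integrable M (\<lambda>x. indicator (B N) x * Z x)"
      using integrable_real_mult_indicator[OF B Z_int] by (simp add: mult.commute)
    then have "(\<integral>x. w L i x \<partial>M) = (\<integral>x. indicator (B N) x * Z x \<partial>M) + of_bool (L \<le> i + N) * (\<integral>x. Z x \<partial>M)"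
      unfolding w_def distrib_left using Z_int by (simp add: mult.commute)
    then show ?thesis using N(2) by simp
  qed
  define J where "J = (\<integral>x. Z x \<partial>M)"
  have J: "J \<ge> 0" unfolding J_def using Z_nonneg by (intro integral_nonneg_AE AE_I2)
  have tail_count: "(\<Sum>i<L. of_bool (L \<le> i + N)) \<le> real N" for L :: nat
  proof -
    have "(\<Sum>i<L. of_bool (L \<le> i + N)) = real (card ({..<L} \<inter> {i. L \<le> i + N}))"
      by (simp add: sum_of_bool_eq)
    also have "card ({..<L} \<inter> {i. L \<le> i + N}) \<le> card {L - N..<L}"
      by (intro card_mono) auto
    finally show ?thesis by simp
  qed
  have bound: "(\<integral>x. a L x \<partial>M) \<le> real L * (c + \<epsilon> / 2) + real N * J" for L
  proof -
    have int: "integrable M (\<lambda>x. \<Sum>i<L. w L i ((T ^^ i) x))"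
      by (rule Bochner_Integration.integrable_sum) (rule integrable_iterate[OF w_int])
    have "(\<integral>x. a L x \<partial>M) \<le> (\<integral>x. real L * c + (\<Sum>i<L. w L i ((T ^^ i) x)) \<partial>M)"
      by (rule integral_mono[OF a_integrable]) (simp_all add: int cover)
    also have "\<dots> = real L * c + (\<integral>x. (\<Sum>i<L. w L i ((T ^^ i) x)) \<partial>M)"
      by (subst Bochner_Integration.integral_add) (simp_all add: int prob_space)
    also have "(\<integral>x. (\<Sum>i<L. w L i ((T ^^ i) x)) \<partial>M) = (\<Sum>i<L. \<integral>x. w L i ((T ^^ i) x) \<partial>M)"
      by (rule Bochner_Integration.integral_sum) (rule integrable_iterate[OF w_int])
    also have "\<dots> = (\<Sum>i<L. \<integral>x. w L i x \<partial>M)"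
      by (intro sum.cong refl integral_iterate borel_measurable_integrable[OF w_int])
    also have "(\<Sum>i<L. \<integral>x. w L i x \<partial>M) \<le> (\<Sum>i<L. \<epsilon> / 2 + of_bool (L \<le> i + N) * J)"
      unfolding J_def by (intro sum_mono w_integral)
    also have "\<dots> = real L * (\<epsilon> / 2) + (\<Sum>i<L. of_bool (L \<le> i + N)) * J"
      by (simp add: sum.distrib sum_distrib_right)
    also have "\<dots> \<le> real L * (\<epsilon> / 2) + real N * J"
      using mult_right_mono[OF tail_count J] by simp
    finally show ?thesis by (simp add: algebra_simps)
  qed
  obtain L0 where "2 * real N * J / \<epsilon> < real L0" using reals_Archimedean2 by blast
  then have L: "2 * real N * J / \<epsilon> < real (Suc L0)" "1 \<le> Suc L0" by auto
  define L where "L = Suc L0"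
  note L = L[folded L_def]
  have "real L * time_constant \<le> real L * (c + \<epsilon> / 2) + real N * J"
    using time_constant_le[OF L(2)] bound[of L] by linarith
  also have "real N * J \<le> real L * (\<epsilon> / 2)"
    using L(1) \<open>\<epsilon> > 0\<close> by (simp add: field_simps)
  finally have "real L * time_constant \<le> real L * (c + \<epsilon>)" by (simp add: algebra_simps)
  then show "time_constant \<le> c + \<epsilon>" using L(2) by (simp add: mult_le_cancel_left)
qed

text \<open>
  Sequences that differ by a bounded error and an index shift have the same lower growth rate; the
  loss from \<open>c\<close> to \<open>c'\<close> absorbs the error.
\<close>

lemma frequently_low_transfer:
  fixes u v :: "nat \<Rightarrow> real"
  assumes uv: "\<And>n. \<bar>u (Suc n) - v n\<bar> \<le> y" and c: "c < c'"
  shows "\<exists>\<^sub>F n in sequentially. u n \<le> real n * c \<Longrightarrow> \<exists>\<^sub>F n in sequentially. v n \<le> real n * c'"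
    and "\<exists>\<^sub>F n in sequentially. v n \<le> real n * c \<Longrightarrow> \<exists>\<^sub>F n in sequentially. u n \<le> real n * c'"
proof -
  have large: "\<forall>\<^sub>F n in sequentially. \<bar>c\<bar> + \<bar>c'\<bar> + y \<le> real n * (c' - c)"
  proof -
    have "filterlim (\<lambda>n. (c' - c) * real n) at_top sequentially"
      using c by (intro filterlim_tendsto_pos_mult_at_top[OF tendsto_const _ filterlim_real_sequentially]) simp
    then show ?thesis by (simp add: filterlim_at_top mult.commute)
  qed
  show "\<exists>\<^sub>F n in sequentially. v n \<le> real n * c'" if "\<exists>\<^sub>F n in sequentially. u n \<le> real n * c"
  proof -
    have "\<exists>\<^sub>F n in sequentially. u (Suc n) \<le> real (Suc n) * c"
      using that unfolding frequently_def eventually_sequentially_Suc[of "\<lambda>n. \<not> u n \<le> real n * c"] .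
    then show ?thesis
      proof (rule frequently_elim1[OF frequently_eventually_frequently[OF _ large]])
      fix n assume "u (Suc n) \<le> real (Suc n) * c \<and> \<bar>c\<bar> + \<bar>c'\<bar> + y \<le> real n * (c' - c)"
      then show "v n \<le> real n * c'"
        using uv[of n] by (simp add: distrib_right right_diff_distrib) linarith
    qed
  qed
  show "\<exists>\<^sub>F n in sequentially. u n \<le> real n * c'" if "\<exists>\<^sub>F n in sequentially. v n \<le> real n * c"
  proof -
    have "\<exists>\<^sub>F n in sequentially. u (Suc n) \<le> real (Suc n) * c'"
      proof (rule frequently_elim1[OF frequently_eventually_frequently[OF that large]])
      fix n assume "v n \<le> real n * c \<and> \<bar>c\<bar> + \<bar>c'\<bar> + y \<le> real n * (c' - c)"
      then show "u (Suc n) \<le> real (Suc n) * c'"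
        using uv[of n] by (simp add: distrib_right right_diff_distrib) linarith
    qed
    then show ?thesis
      unfolding frequently_def eventually_sequentially_Suc[of "\<lambda>n. \<not> u n \<le> real n * c'"] .
  qed
qed

end

locale ergodic_system = measure_preserving_system +
  assumes ergodic: "\<And>A. A \<in> sets M \<Longrightarrow> T -` A \<inter> space M = A \<Longrightarrow> prob A = 0 \<or> prob A = 1"

locale ergodic_subadditive_process = subadditive_process + ergodic_system
begin

text \<open>
  The set where the lower growth rate is below \<open>c'\<close> is invariant. If it had full measure, then the
  covering argument would give \<open>time_constant \<le> c'\<close>; so by ergodicity it is null.
\<close>

lemma eventually_above:
  assumes "c < time_constant"
  shows "AE x in M. \<forall>\<^sub>F n in sequentially. real n * c < a n x"
proof -
  obtain c' where c': "c < c'" "c' < time_constant" using dense[OF assms] by blast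
  obtain k :: nat where "inverse (real (Suc k)) < c' - c"
    using reals_Archimedean[of "c' - c"] c' by auto
  then have k: "c \<le> c' - 1 / Suc k" by (simp add: inverse_eq_divide)
  \<comment> \<open>The gap \<open>1 / Suc k\<close> leaves room for the loss in \<open>frequently_low_transfer\<close>, which makes \<open>A\<close> exactly invariant.\<close>
  define A where "A = {x \<in> space M. \<exists>k::nat. \<exists>\<^sub>F n in sequentially. a n x \<le> real n * (c' - 1 / Suc k)}"
  have [measurable]: "A \<in> sets M" unfolding A_def frequently_def eventually_sequentially by measurable
  have step: "c' - 1 / real (Suc k) < c' - 1 / real (Suc (Suc k))" for k
    by (intro diff_strict_left_mono divide_strict_left_mono) simp_all
  have "T -` A \<inter> space M = A"
  proof (intro equalityI subsetI)
    fix x assume "x \<in> T -` A \<inter> space M"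
    then obtain k where x: "x \<in> space M" "\<exists>\<^sub>F n in sequentially. a n (T x) \<le> real n * (c' - 1 / Suc k)"
      by (auto simp: A_def)
    have "\<exists>\<^sub>F n in sequentially. a n x \<le> real n * (c' - 1 / Suc (Suc k))"
      by (rule frequently_low_transfer(2)[OF a_Suc[OF x(1)] step x(2)])
    with x show "x \<in> A" unfolding A_def by blast
  next
    fix x assume "x \<in> A"
    then obtain k where x: "x \<in> space M" "\<exists>\<^sub>F n in sequentially. a n x \<le> real n * (c' - 1 / Suc k)"
      by (auto simp: A_def)
    have "\<exists>\<^sub>F n in sequentially. a n (T x) \<le> real n * (c' - 1 / Suc (Suc k))"
      by (rule frequently_low_transfer(1)[OF a_Suc[OF x(1)] step x(2)])
    with x T_in_space[OF x(1)] show "x \<in> T -` A \<inter> space M" unfolding A_def by blast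
  qed
  then have "prob A = 0 \<or> prob A = 1" by (intro ergodic) auto
  moreover have "prob A \<noteq> 1"
  proof
    assume "prob A = 1"
    then have "AE x in M. x \<in> A" by (simp add: prob_eq_1)
    then have "AE x in M. \<exists>n\<ge>1. a n x \<le> real n * c'"
    proof eventually_elim
      case (elim x)
      then obtain k where "\<exists>\<^sub>F n in sequentially. a n x \<le> real n * (c' - 1 / Suc k)"
        by (auto simp: A_def)
      then obtain n where n: "n \<ge> 1" "a n x \<le> real n * (c' - 1 / Suc k)"
        unfolding frequently_sequentially by blast
      have "real n * (c' - 1 / Suc k) \<le> real n * c'" by (intro mult_left_mono) auto
      then have "a n x \<le> real n * c'" using n(2) by linarith
      then show ?case using n(1) by blast
    qed
    then show False using time_constant_le_if_low_somewhere c' by fastforce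
  qed
  ultimately have "AE x in M. x \<notin> A" by (simp add: prob_eq_0)
  then show ?thesis using AE_space
  proof eventually_elim
    case (elim x)
    then have "\<forall>\<^sub>F n in sequentially. real n * (c' - 1 / Suc k) < a n x"
      by (auto simp: A_def frequently_def not_le)
    then show ?case
    proof eventually_elim
      case (elim n)
      have "real n * c \<le> real n * (c' - 1 / Suc k)" using k by (rule mult_left_mono) simp
      with elim show ?case by linarith
    qed
  qed
qed

end

context ergodic_system
begin

lemma birkhoff_lower:
  fixes f :: "'a \<Rightarrow> real"
  assumes f: "integrable M f" and c: "c < (\<integral>x. f x \<partial>M)"
  shows "AE x in M. \<forall>\<^sub>F n in sequentially. real n * c < (\<Sum>i<n. f ((T ^^ i) x))"
proof -
  have [measurable]: "f \<in> borel_measurable M" using f by auto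
  interpret P: ergodic_subadditive_process M T "\<lambda>n x. \<Sum>i<n. f ((T ^^ i) x)" "\<lambda>x. \<bar>f x\<bar>"
  proof
    show "(\<Sum>i<m + n. f ((T ^^ i) x)) \<le> (\<Sum>i<m. f ((T ^^ i) x)) + (\<Sum>i<n. f ((T ^^ i) ((T ^^ m) x)))" for m n x
      by (simp add: sum_lessThan_add iterate_iterate)
    show "\<bar>(\<Sum>i<Suc n. f ((T ^^ i) x)) - (\<Sum>i<n. f ((T ^^ i) (T x)))\<bar> \<le> \<bar>f x\<bar>" for n x
      by (simp add: sum.lessThan_Suc_shift funpow_swap1 del: sum.lessThan_Suc)
  qed (use f in \<open>auto intro: ergodic\<close>)
  have "P.time_constant = (\<integral>x. f x \<partial>M)"
  proof -
    have "(\<integral>x. (\<Sum>i<n. f ((T ^^ i) x)) \<partial>M) / real n = (\<integral>x. f x \<partial>M)" if "n \<in> {1..}" for n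
      using that f by (simp add: Bochner_Integration.integral_sum integrable_iterate integral_iterate)
    then show ?thesis unfolding P.time_constant_def by (subst INF_cong[OF refl]) auto
  qed
  then show ?thesis using P.eventually_above c by simp
qed

text \<open>
  Sums along orbits are additive, so the lower bound for subadditive processes applies both to \<open>f\<close>
  and to \<open>- f\<close>.
\<close>

theorem birkhoff:
  fixes f :: "'a \<Rightarrow> real"
  assumes f: "integrable M f"
  shows "AE x in M. (\<lambda>n. (\<Sum>i<n. f ((T ^^ i) x)) / real n) \<longlonglongrightarrow> (\<integral>x. f x \<partial>M)"
proof -
  define I where "I = (\<integral>x. f x \<partial>M)"
  have "AE x in M. \<forall>k. \<forall>\<^sub>F n in sequentially. real n * (I - 1 / Suc k) < (\<Sum>i<n. f ((T ^^ i) x))"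
    unfolding AE_all_countable using f by (auto intro!: birkhoff_lower simp: I_def)
  moreover have "AE x in M. \<forall>k. \<forall>\<^sub>F n in sequentially. real n * (- I - 1 / Suc k) < (\<Sum>i<n. - f ((T ^^ i) x))"
    unfolding AE_all_countable using f
    by (intro allI birkhoff_lower) (auto simp: I_def)
  ultimately show ?thesis
  proof eventually_elim
    case (elim x)
    show ?case unfolding I_def[symmetric]
    proof (rule LIMSEQ_I)
      fix r :: real assume "r > 0"
      then obtain k where k: "1 / Suc k < r" using reals_Archimedean[of r] by (auto simp: inverse_eq_divide)
      have "\<forall>\<^sub>F n in sequentially. norm ((\<Sum>i<n. f ((T ^^ i) x)) / real n - I) < r"
        using elim(1)[rule_format, of k] elim(2)[rule_format, of k] eventually_gt_at_top[of 0]
      proof eventually_elim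
        case (elim n)
        have "I - 1 / Suc k < (\<Sum>i<n. f ((T ^^ i) x)) / real n"
          using elim by (simp add: pos_less_divide_eq mult.commute)
        moreover have "(\<Sum>i<n. f ((T ^^ i) x)) / real n < I + 1 / Suc k"
          using elim by (simp add: pos_divide_less_eq sum_negf algebra_simps)
        ultimately show ?case using k by (auto simp: abs_less_iff)
      qed
      then show "\<exists>no. \<forall>n\<ge>no. norm ((\<Sum>i<n. f ((T ^^ i) x)) / real n - I) < r"
        by (simp add: eventually_sequentially)
    qed
  qed
qed

end

text \<open>
  Ergodicity of the powers of \<open>T\<close> allows Birkhoff's theorem to be applied along blocks of fixed
  length.
\<close>

locale totally_ergodic_subadditive_process = ergodic_subadditive_process +
  assumes totally_ergodic: "\<And>m. m \<ge> 1 \<Longrightarrow> ergodic_system M (T ^^ m)"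
begin

text \<open>
  Cut the orbit into blocks of length \<open>m\<close>. Subadditivity bounds \<open>a n\<close> by the sum of \<open>a m\<close> over the
  blocks plus an error from the last, incomplete block, which is a difference of consecutive ergodic
  sums and hence sublinear.
\<close>

lemma eventually_below:
  assumes m: "m \<ge> 1" and c: "(\<integral>x. a m x \<partial>M) / real m < c"
  shows "AE x in M. \<forall>\<^sub>F n in sequentially. a n x / real n < c"
proof -
  interpret Tm: ergodic_system M "T ^^ m" using m by (rule totally_ergodic)
  define Z where "Z x = (\<Sum>i<m. Y ((T ^^ i) x))" for x
  have Z_int: "integrable M Z"
    unfolding Z_def by (intro Bochner_Integration.integrable_sum integrable_iterate Y_integrable)
  define Sa where "Sa q x = (\<Sum>j<q. a m (((T ^^ m) ^^ j) x))" for q x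
  define SZ where "SZ q x = (\<Sum>j<q. Z (((T ^^ m) ^^ j) x))" for q x
  have "AE x in M. (\<lambda>q. Sa q x / real q) \<longlonglongrightarrow> (\<integral>x. a m x \<partial>M)"
    unfolding Sa_def by (rule Tm.birkhoff[OF a_integrable])
  moreover have "AE x in M. (\<lambda>q. SZ q x / real q) \<longlonglongrightarrow> (\<integral>x. Z x \<partial>M)"
    unfolding SZ_def by (rule Tm.birkhoff[OF Z_int])
  ultimately show ?thesis using AE_space
  proof eventually_elim
    case (elim x)
    have SaZ: "a n x \<le> Sa (n div m) x + (SZ (Suc (n div m)) x - SZ (n div m) x)" for n
    proof -
      define q r where "q = n div m" and "r = n mod m"
      have n: "n = m * q + r" by (simp add: q_def r_def)
      have blocks: "a (m * q) x \<le> Sa q x" for q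
      proof (induction q)
        case (Suc q)
        have "a (m * q + m) x \<le> a (m * q) x + a m ((T ^^ (m * q)) x)"
          by (rule subadditive) fact
        then show ?case using Suc by (simp add: Sa_def funpow_mult add.commute)
      qed (simp add: Sa_def a_0 elim)
      have "a n x \<le> a (m * q) x + a r ((T ^^ (m * q)) x)"
        unfolding n by (rule subadditive) fact
      also have "a (m * q) x \<le> Sa q x" by (rule blocks)
      also have "a r ((T ^^ (m * q)) x) \<le> (\<Sum>i<r. Y ((T ^^ i) ((T ^^ (m * q)) x)))"
        using abs_a_le[OF iterate_in_space[OF elim(3)], of r "m * q"] by linarith
      also have "\<dots> \<le> Z ((T ^^ (m * q)) x)"
        unfolding Z_def r_def using m
        by (intro sum_mono2 Y_nonneg iterate_in_space elim) (auto intro: less_trans mod_less_divisor)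
      also have "\<dots> = SZ (Suc q) x - SZ q x" by (simp add: SZ_def funpow_mult)
      finally show ?thesis unfolding q_def by simp
    qed
    define U where "U q = Sa q x / real q + (SZ (Suc q) x / real (Suc q) * (real (Suc q) / real q) - SZ q x / real q)" for q
    have "(\<lambda>q. real (Suc q) / real q) \<longlonglongrightarrow> 1"
      using LIMSEQ_Suc_n_over_n by simp
    then have "U \<longlonglongrightarrow> (\<integral>x. a m x \<partial>M) + ((\<integral>x. Z x \<partial>M) * 1 - (\<integral>x. Z x \<partial>M))"
      unfolding U_def by (intro tendsto_intros elim LIMSEQ_Suc)
        (use LIMSEQ_Suc[OF elim(2)] in simp_all)
    then have U: "U \<longlonglongrightarrow> (\<integral>x. a m x \<partial>M)" by simp
    have divm: "filterlim (\<lambda>n. n div m) sequentially sequentially"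
      using m by (intro filterlim_at_top_div_const_nat) auto
    have ratio: "(\<lambda>n. real (n div m) / real n) \<longlonglongrightarrow> 1 / real m"
    proof (rule tendsto_sandwich)
      have "1 / real m - 1 / real n \<le> real (n div m) / real n" if "n \<ge> 1" for n
      proof -
        have "real n = real m * real (n div m) + real (n mod m)"
          by (metis mult_div_mod_eq of_nat_add of_nat_mult)
        moreover have "real (n mod m) \<le> real m" using m by (simp add: less_imp_le)
        ultimately have "real n / real m \<le> real (n div m) + 1" using m by (simp add: field_simps)
        then have "real n / real m / real n \<le> (real (n div m) + 1) / real n" by (rule divide_right_mono) simp
        then show ?thesis using that by (simp add: add_divide_distrib)
      qed
      then show "\<forall>\<^sub>F n in sequentially. 1 / real m - 1 / real n \<le> real (n div m) / real n"
        by (auto simp: eventually_sequentially)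
      have "real (n div m) / real n \<le> 1 / real m" for n
      proof -
        have "real m * real (n div m) \<le> real n"
          unfolding of_nat_mult[symmetric] of_nat_le_iff by (rule times_div_less_eq_dividend)
        then show ?thesis using m by (cases "n = 0") (simp_all add: field_simps)
      qed
      then show "\<forall>\<^sub>F n in sequentially. real (n div m) / real n \<le> 1 / real m" by simp
      show "(\<lambda>n. 1 / real m - 1 / real n) \<longlonglongrightarrow> 1 / real m"
        using tendsto_diff[OF tendsto_const[of "1 / real m"] lim_1_over_n] by simp
    qed simp
    have "(\<lambda>n. U (n div m) * (real (n div m) / real n)) \<longlonglongrightarrow> (\<integral>x. a m x \<partial>M) * (1 / real m)"
      by (intro tendsto_mult ratio filterlim_compose[OF U divm])
    then have "\<forall>\<^sub>F n in sequentially. U (n div m) * (real (n div m) / real n) < c"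
      using c by (intro order_tendstoD(2)) auto
    then show ?case using eventually_ge_at_top[of m]
    proof eventually_elim
      case (elim n)
      have q: "n div m \<ge> 1" using elim(2) m by (simp add: Suc_le_eq div_greater_zero_iff)
      have "a n x / real n \<le> (Sa (n div m) x + (SZ (Suc (n div m)) x - SZ (n div m) x)) / real n"
        by (intro divide_right_mono SaZ) simp
      also have "\<dots> = U (n div m) * (real (n div m) / real n)"
        unfolding times_divide_eq_right using q
        by (simp add: U_def distrib_right left_diff_distrib del: of_nat_Suc)
      finally show ?case using elim(1) by simp
    qed
  qed
qed

theorem kingman: "AE x in M. (\<lambda>n. a n x / real n) \<longlonglongrightarrow> time_constant"
proof -
  have "AE x in M. \<forall>k. \<forall>\<^sub>F n in sequentially. real n * (time_constant - 1 / Suc k) < a n x"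
    unfolding AE_all_countable by (auto intro!: eventually_above)
  moreover have "AE x in M. \<forall>k. \<forall>\<^sub>F n in sequentially. a n x / real n < time_constant + 1 / Suc k"
    unfolding AE_all_countable
  proof
    fix k :: nat
    obtain m where "m \<ge> 1" "(\<integral>x. a m x \<partial>M) / real m < time_constant + 1 / Suc k"
      using time_constant_approx[of "time_constant + 1 / Suc k"] by auto
    then show "AE x in M. \<forall>\<^sub>F n in sequentially. a n x / real n < time_constant + 1 / Suc k"
      by (rule eventually_below)
  qed
  ultimately show ?thesis
  proof eventually_elim
    case (elim x)
    have archim: "\<exists>k::nat. 1 / Suc k < r" if "r > 0" for r :: real
      using reals_Archimedean[OF that] by (auto simp: inverse_eq_divide)
    show ?case
    proof (rule order_tendstoI)
      fix c assume "c < time_constant"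
      then obtain k :: nat where k: "1 / Suc k < time_constant - c" using archim[of "time_constant - c"] by auto
      show "\<forall>\<^sub>F n in sequentially. c < a n x / real n"
        using elim(1)[rule_format, of k] eventually_gt_at_top[of 0]
      proof eventually_elim
        case (elim n)
        then have "time_constant - 1 / Suc k < a n x / real n"
          by (simp add: pos_less_divide_eq mult.commute)
        then show ?case using k by linarith
      qed
    next
      fix c assume "time_constant < c"
      then obtain k :: nat where k: "1 / Suc k < c - time_constant" using archim[of "c - time_constant"] by auto
      show "\<forall>\<^sub>F n in sequentially. a n x / real n < c"
        using elim(2)[rule_format, of k] by eventually_elim (use k in linarith)
    qed
  qed
qed

end

section \<open>Sequences of independent samples\<close>

definition shift :: "(nat \<Rightarrow> 'a) \<Rightarrow> nat \<Rightarrow> 'a" where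
  "shift \<omega> = (\<lambda>n. \<omega> (Suc n))"

lemma iterate_shift: "(shift ^^ m) \<omega> = (\<lambda>n. \<omega> (m + n))"
  by (induction m arbitrary: \<omega>) (simp_all add: shift_def)

lemma shift_case_nat [simp]: "shift (case_nat s \<omega>) = \<omega>"
  by (simp add: shift_def)

context sequence_space
begin

lemma prob_space_M: "prob_space M"
  by (rule M.prob_space_axioms)

lemma coordinate_in_space: "\<omega> \<in> space S \<Longrightarrow> \<omega> i \<in> space M"
  by (auto simp: space_PiM)

lemma measurable_case_nat_seq: "(\<lambda>(s, \<omega>). case_nat s \<omega>) \<in> measurable (M \<Otimes>\<^sub>M S) S"
  by measurable

text \<open>
  A sequence of independent samples is a first sample followed by an independent sequence with the
  same law.
\<close>

lemma nn_integral_seq: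
  assumes [measurable]: "f \<in> borel_measurable S"
  shows "(\<integral>\<^sup>+\<omega>. f \<omega> \<partial>S) = (\<integral>\<^sup>+s. \<integral>\<^sup>+\<omega>. f (case_nat s \<omega>) \<partial>S \<partial>M)"
proof -
  note measurable_case_nat_seq [measurable]
  have "(\<integral>\<^sup>+\<omega>. f \<omega> \<partial>S) = (\<integral>\<^sup>+z. f (case z of (s, \<omega>) \<Rightarrow> case_nat s \<omega>) \<partial>(M \<Otimes>\<^sub>M S))"
    by (subst PiM_iter[symmetric]) (simp add: nn_integral_distr)
  also have "\<dots> = (\<integral>\<^sup>+s. \<integral>\<^sup>+\<omega>. f (case_nat s \<omega>) \<partial>S \<partial>M)"
    by (subst P.nn_integral_fst[symmetric]) simp_all
  finally show ?thesis .
qed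

lemma
  fixes f :: "(nat \<Rightarrow> 'a) \<Rightarrow> real"
  assumes f: "integrable S f"
  shows integral_seq: "(\<integral>\<omega>. f \<omega> \<partial>S) = (\<integral>s. \<integral>\<omega>. f (case_nat s \<omega>) \<partial>S \<partial>M)"
    and integrable_seq: "integrable M (\<lambda>s. \<integral>\<omega>. f (case_nat s \<omega>) \<partial>S)"
proof -
  note measurable_case_nat_seq [measurable]
  interpret MS: pair_sigma_finite M S by unfold_locales
  have [measurable]: "f \<in> borel_measurable S" using f by auto
  have *: "integrable (M \<Otimes>\<^sub>M S) (\<lambda>z. f (case z of (s, \<omega>) \<Rightarrow> case_nat s \<omega>))"
    using f by (subst (asm) PiM_iter[symmetric]) (simp add: integrable_distr_eq)
  have "(\<integral>\<omega>. f \<omega> \<partial>S) = (\<integral>z. f (case z of (s, \<omega>) \<Rightarrow> case_nat s \<omega>) \<partial>(M \<Otimes>\<^sub>M S))"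
    by (subst PiM_iter[symmetric]) (simp add: integral_distr)
  also have "\<dots> = (\<integral>s. \<integral>\<omega>. f (case_nat s \<omega>) \<partial>S \<partial>M)"
    using MS.integral_fst'[OF *] by simp
  finally show "(\<integral>\<omega>. f \<omega> \<partial>S) = (\<integral>s. \<integral>\<omega>. f (case_nat s \<omega>) \<partial>S \<partial>M)" .
  show "integrable M (\<lambda>s. \<integral>\<omega>. f (case_nat s \<omega>) \<partial>S)"
    using MS.integrable_fst'[OF *] by simp
qed

lemma shift_measurable [measurable]: "shift \<in> measurable S S"
  unfolding shift_def[abs_def]
  by (rule measurable_PiM_single') (auto simp: coordinate_in_space PiE_iff)

lemma measure_preserving_shift: "measure_preserving_system S shift"
proof
  show "distr S S shift = S"
    using distr_PiM_reindex[of UNIV "\<lambda>_. M" Suc UNIV] prob_space_M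
    by (simp add: shift_def[abs_def] restrict_UNIV)
qed simp

lemma independent_coordinates: "P.indep_vars (\<lambda>_. M) (\<lambda>i \<omega>. \<omega> i) UNIV"
  using PiM_component by (subst P.indep_vars_iff_distr_eq_PiM) (simp_all add: restrict_UNIV distr_id)

text \<open>
  A set invariant under \<open>shift ^^ m\<close> can be described by the coordinates from \<open>m * n\<close> on, for every
  \<open>n\<close>. It is therefore a tail event, and Kolmogorov's zero-one law applies.
\<close>

lemma ergodic_iterate_shift:
  assumes m: "m \<ge> 1"
  shows "ergodic_system S (shift ^^ m)"
proof -
  interpret sh: measure_preserving_system S shift by (rule measure_preserving_shift)
  define C where "C i = sigma_sets (space S) {(\<lambda>\<omega>. \<omega> i) -` B \<inter> space S |B. B \<in> sets M}" for i :: nat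
  have ind: "P.indep_sets C UNIV"
    using independent_coordinates unfolding P.indep_vars_def C_def by simp
  have C_sub: "C i \<subseteq> Pow (space S)" for i
  proof
    fix X assume "X \<in> C i"
    then have "X \<subseteq> space S" unfolding C_def by (rule sigma_sets_into_sp[rotated]) auto
    then show "X \<in> Pow (space S)" by simp
  qed
  show ?thesis
  proof
    fix A assume A: "A \<in> sets S" "(shift ^^ m) -` A \<inter> space S = A"
    have inv: "(shift ^^ (m * k)) -` A \<inter> space S = A" for k
    proof (induction k)
      case (Suc k)
      have "(shift ^^ (m * Suc k)) -` A \<inter> space S = (shift ^^ (m * k)) -` ((shift ^^ m) -` A \<inter> space S) \<inter> space S"
        using sh.iterate_in_space by (auto simp: iterate_iterate add.commute)
      then show ?case using A(2) Suc by simp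
    qed (use sets.sets_into_space[OF A(1)] in auto)
    have "A \<in> sigma_sets (space S) (\<Union>(C ` {n..}))" for n
    proof -
      let ?G = "sigma (space S) (\<Union>(C ` {n..}))"
      have sub: "\<Union>(C ` {n..}) \<subseteq> Pow (space S)" using C_sub by auto
      have "(shift ^^ (m * n)) \<in> measurable ?G S"
      proof (rule measurable_PiM_single')
        fix i :: nat
        have "n \<le> m * n + i" using m by (simp add: trans_le_add1)
        then have "(\<lambda>\<omega>. \<omega> (m * n + i)) -` B \<inter> space S \<in> sigma_sets (space S) (\<Union>(C ` {n..}))" if "B \<in> sets M" for B
          using that by (intro sigma_sets.Basic UN_I[of "m * n + i"]) (auto simp: C_def intro!: sigma_sets.Basic)
        then show "(\<lambda>\<omega>. (shift ^^ (m * n)) \<omega> i) \<in> measurable ?G M"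
          using sub coordinate_in_space
          by (intro measurableI) (auto simp: iterate_shift space_measure_of_conv sets_measure_of_conv)
      qed (use sub coordinate_in_space in \<open>auto simp: space_measure_of_conv iterate_shift PiE_iff\<close>)
      then have "(shift ^^ (m * n)) -` A \<inter> space ?G \<in> sets ?G"
        using A(1) by (rule measurable_sets)
      then show ?thesis using sub inv[of n] by (simp add: space_measure_of_conv sets_measure_of_conv)
    qed
    then have "A \<in> P.tail_events C" by (auto simp: P.tail_events_def)
    then show "P.prob A = 0 \<or> P.prob A = 1"
      using C_sub by (intro P.kolmogorov_0_1_law[OF _ ind]) (auto simp: C_def intro!: sigma_algebra_sigma_sets)
  qed (simp_all add: sh.distr_iterate)
qed

end

section \<open>The top Lyapunov exponent of a quotient\<close>

abbreviation op_norm :: "'k::{real_normed_field, euclidean_space} ^ 'n ^ 'n \<Rightarrow> real" where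
  "op_norm g \<equiv> onorm ((*v) g)"

definition log_size :: "'k::{real_normed_field, euclidean_space} ^ 'n ^ 'n \<Rightarrow> real" where
  "log_size g = ln (max (op_norm g) (op_norm (matrix_inv g)))"

lemma continuous_on_matrix_vector_mult [continuous_intros]:
  fixes A :: "'a::topological_space \<Rightarrow> 'k::{real_normed_field, euclidean_space} ^ 'n ^ 'n"
  assumes "continuous_on S A" "continuous_on S v"
  shows "continuous_on S (\<lambda>x. A x *v v x)"
  unfolding matrix_vector_mult_def by (intro continuous_intros assms)

lemma continuous_on_matrix_mult [continuous_intros]:
  fixes A :: "'a::topological_space \<Rightarrow> 'k::{real_normed_field, euclidean_space} ^ 'n ^ 'n"
  assumes "continuous_on S A" "continuous_on S B"
  shows "continuous_on S (\<lambda>x. A x ** B x)"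
  unfolding matrix_matrix_mult_def by (intro continuous_intros assms)

lemma borel_measurable_matrix_vector_mult [measurable (raw)]:
  fixes A :: "'a \<Rightarrow> 'k::{real_normed_field, euclidean_space} ^ 'n ^ 'n"
  assumes "A \<in> borel_measurable M" "v \<in> borel_measurable M"
  shows "(\<lambda>x. A x *v v x) \<in> borel_measurable M"
  by (rule borel_measurable_continuous_Pair[OF assms]) (intro continuous_intros)

lemma borel_measurable_matrix_mult [measurable (raw)]:
  fixes A :: "'a \<Rightarrow> 'k::{real_normed_field, euclidean_space} ^ 'n ^ 'n"
  assumes "A \<in> borel_measurable M" "B \<in> borel_measurable M"
  shows "(\<lambda>x. A x ** B x) \<in> borel_measurable M"
  by (rule borel_measurable_continuous_Pair[OF assms]) (intro continuous_intros)

lemma norm_mult_vec_le: "norm (g *v v) \<le> op_norm g * norm v"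
  for g :: "'k::{real_normed_field, euclidean_space} ^ 'n ^ 'n"
  by (rule onorm) simp

lemma matrix_inv_GL:
  assumes "g \<in> GL"
  shows "matrix_inv g ** g = mat 1" "g ** matrix_inv g = mat 1" "matrix_inv g \<in> GL"
proof -
  have "\<exists>h. g ** h = mat 1 \<and> h ** g = mat 1" using assms by (auto simp: GL_def invertible_def)
  then have "g ** matrix_inv g = mat 1 \<and> matrix_inv g ** g = mat 1"
    unfolding matrix_inv_def by (rule someI_ex)
  then show "matrix_inv g ** g = mat 1" "g ** matrix_inv g = mat 1" "matrix_inv g \<in> GL"
    by (auto simp: GL_def invertible_def)
qed

lemma mult_inv_vec:
  assumes "g \<in> GL"
  shows "matrix_inv g *v (g *v v) = v" "g *v (matrix_inv g *v v) = v"
  using matrix_inv_GL[OF assms] by (simp_all add: matrix_vector_mul_assoc)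

lemma GL_mult_nonzero: "g \<in> GL \<Longrightarrow> v \<noteq> 0 \<Longrightarrow> g *v v \<noteq> 0"
  using mult_inv_vec(1)[of g v] by auto

lemma GL_mult: "g \<in> GL \<Longrightarrow> h \<in> GL \<Longrightarrow> g ** h \<in> GL"
  by (simp add: GL_def invertible_mult)

lemma mat_1_GL: "mat 1 \<in> GL"
  unfolding GL_def invertible_def by (auto intro!: exI[of _ "mat 1"])

lemma ex_nonzero_vec: "\<exists>v :: 'k::{real_normed_field, euclidean_space} ^ 'n. v \<noteq> 0"
  by (intro exI[of _ "1"]) simp

lemma op_norm_pos: "g \<in> GL \<Longrightarrow> op_norm g > 0"
  using ex_nonzero_vec GL_mult_nonzero by (subst onorm_pos_lt) auto

lemma op_norm_le_exp_log_size:
  assumes "g \<in> GL"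
  shows "op_norm g \<le> exp (log_size g)" "op_norm (matrix_inv g) \<le> exp (log_size g)"
proof -
  have "max (op_norm g) (op_norm (matrix_inv g)) > 0" using op_norm_pos[OF assms] by simp
  then show "op_norm g \<le> exp (log_size g)" "op_norm (matrix_inv g) \<le> exp (log_size g)"
    by (simp_all add: log_size_def)
qed

lemma abs_ln_norm_quot_le:
  assumes g: "g \<in> GL" and v: "v \<noteq> 0"
  shows "\<bar>ln (norm (g *v v)) - ln (norm v)\<bar> \<le> log_size g"
proof -
  have pos: "norm v > 0" "norm (g *v v) > 0" using assms GL_mult_nonzero by auto
  have "norm (g *v v) \<le> exp (log_size g) * norm v"
    using norm_mult_vec_le[of g v] mult_right_mono[OF op_norm_le_exp_log_size(1)[OF g], of "norm v"] by simp
  then have "ln (norm (g *v v)) \<le> ln (exp (log_size g) * norm v)" using pos by simp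
  moreover have "norm v \<le> exp (log_size g) * norm (g *v v)"
    using norm_mult_vec_le[of "matrix_inv g" "g *v v"] mult_inv_vec(1)[OF g, of v]
      mult_right_mono[OF op_norm_le_exp_log_size(2)[OF g], of "norm (g *v v)"] by simp
  then have "ln (norm v) \<le> ln (exp (log_size g) * norm (g *v v))" using pos by simp
  ultimately show ?thesis using pos by (simp add: ln_mult)
qed

lemma log_size_nonneg: "g \<in> GL \<Longrightarrow> 0 \<le> log_size g"
  using abs_ln_norm_quot_le ex_nonzero_vec by (metis abs_ge_zero order_trans)

lemma random_product_add:
  "random_product X (m + n) = random_product ((shift ^^ m) X) n ** random_product X m"
  by (induction n) (simp_all add: iterate_shift matrix_mul_assoc)

lemma random_product_Suc_shift: "random_product X (Suc n) = random_product (shift X) n ** X 0"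
  using random_product_add[of X 1 n] by simp

lemma random_product_GL: "(\<And>i. X i \<in> GL) \<Longrightarrow> random_product X n \<in> GL"
  by (induction n) (simp_all add: mat_1_GL GL_mult)

definition preserves :: "('k::{real_normed_field, euclidean_space} ^ 'n) set \<Rightarrow> 'k ^ 'n ^ 'n \<Rightarrow> bool" where
  "preserves W g \<longleftrightarrow> (\<forall>w\<in>W. g *v w \<in> W)"

lemma preserves_mult: "preserves W g \<Longrightarrow> preserves W h \<Longrightarrow> preserves W (g ** h)"
  by (simp add: preserves_def matrix_vector_mul_assoc[symmetric])

lemma preserves_mat_1: "preserves W (mat 1)"
  by (simp add: preserves_def)

lemma random_product_preserves: "(\<And>i. preserves W (X i)) \<Longrightarrow> preserves W (random_product X n)"
  by (induction n) (simp_all add: preserves_mat_1 preserves_mult)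

lemma inj_mult_vec: "g \<in> GL \<Longrightarrow> inj ((*v) g)"
  by (metis injI mult_inv_vec(1))

lemma preserves_image_eq:
  assumes g: "g \<in> GL" and W: "vec.subspace W" "preserves W g"
  shows "(*v) g ` W = W"
proof (rule vec.subspace_dim_equal)
  show "vec.subspace ((*v) g ` W)" by (rule vec.subspace_image[OF W(1)])
  show "(*v) g ` W \<subseteq> W" using W(2) by (auto simp: preserves_def)
  have "vec.dim ((*v) g ` W) = vec.dim W"
    by (rule vec.dim_image_eq) (use inj_mult_vec[OF g] in \<open>auto intro: inj_on_subset\<close>)
  then show "vec.dim W \<le> vec.dim ((*v) g ` W)" by simp
qed fact

lemma closed_preserves:
  fixes W :: "('k::{real_normed_field, euclidean_space} ^ 'n) set"
  assumes "closed W"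
  shows "closed {g. preserves W g}"
proof -
  have "{g. preserves W g} = (\<Inter>w\<in>W. (\<lambda>g. g *v w) -` W)" by (auto simp: preserves_def)
  moreover have "closed ((\<lambda>g :: 'k ^ 'n ^ 'n. g *v w) -` W)" for w :: "'k ^ 'n"
    using assms by (intro closed_vimage continuous_intros)
  ultimately show ?thesis by (auto intro: closed_INT)
qed

text \<open>
  The operator norm on \<open>V/W\<close>. The supremum is over the unit ball of \<open>V\<close>, so that the formula makes
  sense and is measurable for all matrices, including those that do not preserve \<open>W\<close>.
\<close>

definition quot_op_norm :: "('k::{real_normed_field, euclidean_space} ^ 'n) set \<Rightarrow> 'k ^ 'n ^ 'n \<Rightarrow> real" where
  "quot_op_norm W g = (SUP v\<in>cball 0 1. infdist (g *v v) W)"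

context
  fixes W :: "('k::{real_normed_field, euclidean_space} ^ 'n) set"
  assumes W: "vec.subspace W"
begin

lemma infdist_le_norm: "infdist v W \<le> norm v"
  using infdist_le[OF vec.subspace_0[OF W], of v] by simp

lemma infdist_smult_W: "infdist (c *s v) W = norm c * infdist v W"
proof (cases "c = 0")
  case False
  then show ?thesis by (intro infdist_smult) (auto intro: vec.subspace_scale[OF W])
qed (use vec.subspace_0[OF W] in simp)

lemma quot_op_norm_bdd: "bdd_above ((\<lambda>v. infdist (g *v v) W) ` cball 0 1)"
  for g :: "'k ^ 'n ^ 'n"
proof (rule bdd_aboveI2)
  fix v :: "'k ^ 'n" assume "v \<in> cball 0 1"
  then show "infdist (g *v v) W \<le> op_norm g"
    using infdist_le_norm[of "g *v v"] norm_mult_vec_le[of g v]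
      mult_left_mono[of "norm v" 1 "op_norm g"] onorm_pos_le[of "(*v) g"] by simp
qed

lemma infdist_mult_le_norm: "infdist (g *v v) W \<le> quot_op_norm W g * norm v"
proof (cases "v = 0")
  case False
  define c :: 'k where "c = of_real (norm v)"
  have c: "norm c = norm v" "c \<noteq> 0" using False by (simp_all add: c_def)
  have "infdist (g *v (inverse c *s v)) W \<le> quot_op_norm W g"
    unfolding quot_op_norm_def
    by (intro cSUP_upper quot_op_norm_bdd) (use c False in \<open>simp add: norm_smult norm_inverse\<close>)
  moreover have "infdist (g *v (inverse c *s v)) W = infdist (g *v v) W / norm v"
    using c by (simp add: vec.scale infdist_smult_W norm_inverse divide_inverse)
  ultimately have "infdist (g *v v) W / norm v \<le> quot_op_norm W g" by simp
  then show ?thesis using False by (simp add: pos_divide_le_eq)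
qed (use vec.subspace_0[OF W] in simp)

lemma quot_op_norm_nonneg: "0 \<le> quot_op_norm W g"
  using infdist_mult_le_norm[of g 1] infdist_nonneg[of "g *v 1" W] zero_le_mult_iff[of "quot_op_norm W g" "norm (1 :: 'k ^ 'n)"]
  by auto

lemma infdist_mult_le:
  assumes g: "preserves W g"
  shows "infdist (g *v v) W \<le> quot_op_norm W g * infdist v W"
proof (cases "quot_op_norm W g = 0")
  case True
  then show ?thesis using infdist_mult_le_norm[of g v] by simp
next
  case False
  then have pos: "quot_op_norm W g > 0" using quot_op_norm_nonneg[of g] by simp
  have "infdist (g *v v) W / quot_op_norm W g \<le> dist v w" if "w \<in> W" for w
  proof -
    have "infdist (g *v v) W \<le> infdist (g *v (v - w)) W"
    proof -
      have "infdist (g *v v) W \<le> dist (g *v (v - w)) u" if "u \<in> W" for u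
      proof -
        have "g *v w + u \<in> W" using g \<open>w \<in> W\<close> that vec.subspace_add[OF W] by (auto simp: preserves_def)
        then have "infdist (g *v v) W \<le> dist (g *v v) (g *v w + u)" by (rule infdist_le)
        then show ?thesis by (simp add: dist_norm vec.diff algebra_simps)
      qed
      then show ?thesis
        using vec.subspace_0[OF W] unfolding infdist_def[of "g *v (v - w)"] by (auto intro!: cINF_greatest)
    qed
    also have "\<dots> \<le> quot_op_norm W g * norm (v - w)" by (rule infdist_mult_le_norm)
    finally show ?thesis using pos by (simp add: field_simps dist_norm)
  qed
  then have "infdist (g *v v) W / quot_op_norm W g \<le> infdist v W"
    using vec.subspace_0[OF W] unfolding infdist_def[of v] by (auto intro!: cINF_greatest)
  then show ?thesis using pos by (simp add: field_simps)
qed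

lemma quot_op_norm_least:
  assumes "\<And>v. norm v \<le> 1 \<Longrightarrow> infdist (g *v v) W \<le> c"
  shows "quot_op_norm W g \<le> c"
  unfolding quot_op_norm_def using assms by (intro cSUP_least) auto

lemma quot_op_norm_mult_le:
  assumes "preserves W g"
  shows "quot_op_norm W (g ** h) \<le> quot_op_norm W g * quot_op_norm W h"
proof (rule quot_op_norm_least)
  fix v :: "'k ^ 'n" assume v: "norm v \<le> 1"
  have "infdist ((g ** h) *v v) W \<le> quot_op_norm W g * infdist (h *v v) W"
    using infdist_mult_le[OF assms, of "h *v v"] by (simp add: matrix_vector_mul_assoc)
  also have "\<dots> \<le> quot_op_norm W g * (quot_op_norm W h * 1)"
  proof (rule mult_left_mono[OF _ quot_op_norm_nonneg])
    show "infdist (h *v v) W \<le> quot_op_norm W h * 1"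
      using infdist_mult_le_norm[of h v] mult_left_mono[OF v quot_op_norm_nonneg[of h]] by simp
  qed
  finally show "infdist ((g ** h) *v v) W \<le> quot_op_norm W g * quot_op_norm W h" by simp
qed

lemma quot_op_norm_le: "quot_op_norm W g \<le> op_norm g"
proof (rule quot_op_norm_least)
  fix v :: "'k ^ 'n" assume v: "norm v \<le> 1"
  show "infdist (g *v v) W \<le> op_norm g"
    using infdist_le_norm[of "g *v v"] norm_mult_vec_le[of g v]
      mult_left_mono[OF v, of "op_norm g"] onorm_pos_le[of "(*v) g"] by simp
qed

lemma quot_op_norm_mat_1:
  assumes "W \<noteq> UNIV"
  shows "quot_op_norm W (mat 1) = 1"
proof (rule antisym)
  show "quot_op_norm W (mat 1) \<le> 1"
    by (rule quot_op_norm_least) (use infdist_le_norm order_trans in auto)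
  obtain v where v: "v \<notin> W" using assms by auto
  then have "infdist v W > 0"
    using in_closed_iff_infdist_zero[OF closed_vec_subspace[OF W], of v] vec.subspace_0[OF W] infdist_nonneg[of v W]
    by (auto simp: less_le)
  then show "1 \<le> quot_op_norm W (mat 1)"
    using infdist_mult_le[OF preserves_mat_1[of W], of v] by simp
qed

lemma quot_op_norm_measurable: "quot_op_norm W \<in> borel_measurable borel"
proof (subst borel_measurable_iff_le, rule allI)
  fix c :: real
  have "{g. quot_op_norm W g \<le> c} = (\<Inter>v\<in>cball 0 1. {g. infdist (g *v v) W \<le> c})"
  proof (intro equalityI subsetI INT_I CollectI)
    fix g :: "'k ^ 'n ^ 'n" and v :: "'k ^ 'n"
    assume "g \<in> {g. quot_op_norm W g \<le> c}" "v \<in> cball 0 1"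
    then show "infdist (g *v v) W \<le> c"
      using cSUP_upper[OF _ quot_op_norm_bdd, of v g] by (auto simp: quot_op_norm_def)
  next
    fix g :: "'k ^ 'n ^ 'n"
    assume "g \<in> (\<Inter>v\<in>cball 0 1. {g. infdist (g *v v) W \<le> c})"
    then show "quot_op_norm W g \<le> c" by (intro quot_op_norm_least) auto
  qed
  moreover have "closed {g :: 'k ^ 'n ^ 'n. infdist (g *v v) W \<le> c}" for v :: "'k ^ 'n"
    by (intro closed_Collect_le continuous_intros)
  ultimately have "closed {g. quot_op_norm W g \<le> c}" by (auto intro: closed_INT)
  then show "{g \<in> space borel. quot_op_norm W g \<le> c} \<in> sets borel" by simp
qed

lemma quot_norm_coset: "quot_norm ((+) v ` W) = infdist v W"
proof -
  have "(\<lambda>w. norm (v + w)) ` W = (\<lambda>w. dist v w) ` W"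
  proof (intro equalityI subsetI)
    fix x assume "x \<in> (\<lambda>w. norm (v + w)) ` W"
    then obtain w where "w \<in> W" "x = norm (v + w)" by auto
    then show "x \<in> (\<lambda>w. dist v w) ` W"
      using vec.subspace_neg[OF W] by (intro image_eqI[of _ _ "- w"]) (auto simp: dist_norm)
  next
    fix x assume "x \<in> (\<lambda>w. dist v w) ` W"
    then obtain w where "w \<in> W" "x = dist v w" by auto
    then show "x \<in> (\<lambda>w. norm (v + w)) ` W"
      using vec.subspace_neg[OF W] by (intro image_eqI[of _ _ "- w"]) (auto simp: dist_norm)
  qed
  then show ?thesis using vec.subspace_0[OF W] by (auto simp: quot_norm_def infdist_def image_image)
qed

text \<open>
  The norm of the coset of \<open>v\<close> is the distance of \<open>v\<close> to \<open>W\<close>; replacing the unit ball of \<open>V\<close> by that of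
  \<open>V/W\<close> does not change the supremum because of \<open>infdist_mult_le\<close>.
\<close>

lemma quot_onorm_eq:
  assumes g: "g \<in> GL" "preserves W g"
  shows "quot_onorm W (quot_map g) = quot_op_norm W g"
proof -
  have map: "quot_map g ((+) v ` W) = (+) (g *v v) ` W" for v
  proof -
    have "quot_map g ((+) v ` W) = (+) (g *v v) ` ((*v) g ` W)"
      by (simp add: quot_map_def image_image vec.add)
    then show ?thesis using preserves_image_eq[OF g(1) W g(2)] by simp
  qed
  let ?S = "{v. infdist v W \<le> 1}"
  have "{C \<in> quot_space W. quot_norm C \<le> 1} = (\<lambda>v. (+) v ` W) ` ?S"
    by (auto simp: quot_space_def quot_norm_coset)
  then have eq: "quot_onorm W (quot_map g) = (SUP v\<in>?S. infdist (g *v v) W)"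
    by (simp add: quot_onorm_def image_image map quot_norm_coset)
  have le: "infdist (g *v v) W \<le> quot_op_norm W g" if "v \<in> ?S" for v
    using infdist_mult_le[OF g(2), of v] mult_left_mono[of "infdist v W" 1, OF _ quot_op_norm_nonneg[of g]] that
    by simp
  have zero: "0 \<in> ?S" using vec.subspace_0[OF W] by simp
  show ?thesis unfolding eq
  proof (rule antisym)
    show "(SUP v\<in>?S. infdist (g *v v) W) \<le> quot_op_norm W g"
      using zero le by (intro cSUP_least) auto
    have bdd: "bdd_above ((\<lambda>v. infdist (g *v v) W) ` ?S)" using le by (intro bdd_aboveI2) auto
    show "quot_op_norm W g \<le> (SUP v\<in>?S. infdist (g *v v) W)"
    proof (rule quot_op_norm_least)
      fix v :: "'k ^ 'n" assume "norm v \<le> 1"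
      then have "v \<in> ?S" using infdist_le_norm[of v] by simp
      then show "infdist (g *v v) W \<le> (SUP v\<in>?S. infdist (g *v v) W)" by (rule cSUP_upper[OF _ bdd])
    qed
  qed
qed

lemma quot_op_norm_pos:
  assumes "W \<noteq> UNIV" "g \<in> GL" "preserves W g"
  shows "quot_op_norm W g > 0"
proof -
  have "1 \<le> quot_op_norm W g * quot_op_norm W (matrix_inv g)"
    using quot_op_norm_mult_le[OF assms(3), of "matrix_inv g"] matrix_inv_GL(2)[OF assms(2)]
      quot_op_norm_mat_1[OF assms(1)] by simp
  then show ?thesis using quot_op_norm_nonneg[of g] by (cases "quot_op_norm W g = 0") auto
qed

lemma abs_ln_quot_op_norm_diff_le:
  assumes "W \<noteq> UNIV" and g: "g \<in> GL" "preserves W g" and h: "h \<in> GL" "preserves W h"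
  shows "\<bar>ln (quot_op_norm W (g ** h)) - ln (quot_op_norm W g)\<bar> \<le> log_size h"
proof -
  note pos = quot_op_norm_pos[OF assms(1)]
  have pos': "quot_op_norm W g > 0" "quot_op_norm W (g ** h) > 0"
    using g h by (auto intro!: pos GL_mult preserves_mult)
  have "quot_op_norm W (g ** h) \<le> quot_op_norm W g * exp (log_size h)"
    using quot_op_norm_mult_le[OF g(2), of h]
      mult_left_mono[OF order_trans[OF quot_op_norm_le op_norm_le_exp_log_size(1)[OF h(1)]] quot_op_norm_nonneg[of g]]
    by linarith
  then have "ln (quot_op_norm W (g ** h)) \<le> ln (quot_op_norm W g * exp (log_size h))" using pos' by simp
  moreover have "quot_op_norm W g \<le> quot_op_norm W (g ** h) * exp (log_size h)"
  proof -
    have "(g ** h) ** matrix_inv h = g"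
      using matrix_inv_GL(2)[OF h(1)] by (simp add: matrix_mul_assoc[symmetric])
    then have "quot_op_norm W g \<le> quot_op_norm W (g ** h) * quot_op_norm W (matrix_inv h)"
      using quot_op_norm_mult_le[OF preserves_mult[OF g(2) h(2)], of "matrix_inv h"] by simp
    then show ?thesis
      using mult_left_mono[OF order_trans[OF quot_op_norm_le op_norm_le_exp_log_size(2)[OF h(1)]] quot_op_norm_nonneg[of "g ** h"]]
      by linarith
  qed
  then have "ln (quot_op_norm W g) \<le> ln (quot_op_norm W (g ** h) * exp (log_size h))" using pos' by simp
  ultimately show ?thesis using pos' by (simp add: ln_mult)
qed

end

locale matrix_walk =
  fixes \<mu> :: "('k::{real_normed_field, euclidean_space} ^ 'n ^ 'n) measure"
  assumes prob_space_\<mu>: "prob_space \<mu>"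
    and sets_\<mu>: "sets \<mu> = sets GL_borel"
    and moment: "finite_first_moment \<mu>"

sublocale matrix_walk \<subseteq> sequence_space \<mu>
  by (intro sequence_space.intro product_prob_spaceI prob_space_\<mu>)

context matrix_walk
begin

lemma space_\<mu>: "space \<mu> = GL"
  using sets_eq_imp_space_eq[OF sets_\<mu>] by (simp add: GL_borel_def space_restrict_space)

lemma measurable_\<mu>:
  assumes "f \<in> measurable borel N"
  shows "f \<in> measurable \<mu> N"
proof -
  have "f \<in> measurable GL_borel N"
    unfolding GL_borel_def by (rule measurable_restrict_space1[OF assms])
  then show ?thesis by (subst measurable_cong_sets[OF sets_\<mu> refl])
qed

lemma id_measurable_\<mu> [measurable]: "(\<lambda>g. g) \<in> borel_measurable \<mu>"
  by (rule measurable_\<mu>) simp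

lemma log_size_integrable: "integrable \<mu> log_size"
  using moment unfolding finite_first_moment_def log_size_def[abs_def] .

lemma log_size_measurable [measurable]: "log_size \<in> borel_measurable \<mu>"
  using log_size_integrable by auto

lemma coordinate_GL: "\<omega> \<in> space S \<Longrightarrow> \<omega> i \<in> GL"
  using coordinate_in_space space_\<mu> by auto

lemma product_GL: "\<omega> \<in> space S \<Longrightarrow> random_product \<omega> n \<in> GL"
  by (intro random_product_GL coordinate_GL)

lemma coordinate_measurable [measurable]: "(\<lambda>\<omega>. \<omega> i) \<in> borel_measurable S"
  by (rule measurable_compose[OF _ id_measurable_\<mu>, of "\<lambda>\<omega>. \<omega> i"]) simp

lemma random_product_measurable [measurable]: "(\<lambda>\<omega>. random_product \<omega> n) \<in> borel_measurable S"
  by (induction n) simp_all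

text \<open>
  The logarithm of the norm on \<open>V/W\<close> is a subadditive process over the shift, so the limit that
  defines the top Lyapunov exponent exists by Kingman's theorem and is the time constant.
\<close>

theorem quotient_lyapunov_exponent:
  assumes W: "vec.subspace W" "W \<noteq> UNIV" and inv: "AE g in \<mu>. preserves W g"
  obtains \<gamma> where "top_lyapunov_quot \<mu> W = ereal \<gamma>"
    "AE \<omega> in S. (\<lambda>n. ln (quot_op_norm W (random_product \<omega> n)) / real n) \<longlonglongrightarrow> \<gamma>"
proof -
  \<comment> \<open>Almost every matrix preserves \<open>W\<close>; replacing the others by the identity makes the process subadditive everywhere.\<close>
  define h where "h g = (if preserves W g then g else mat 1)" for g :: "'k ^ 'n ^ 'n"
  have [measurable]: "Measurable.pred borel (preserves W)"
    using borel_closed[OF closed_preserves[OF closed_vec_subspace[OF W(1)]]] by (simp add: pred_def)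
  have h_borel [measurable]: "h \<in> borel_measurable borel" unfolding h_def by measurable
  have h: "h g \<in> GL" "preserves W (h g)" "log_size (h g) \<le> log_size g" if "g \<in> GL" for g
  proof -
    have "log_size (mat 1 :: 'k ^ 'n ^ 'n) \<le> 0"
    proof -
      have "matrix_inv (mat 1) = (mat 1 :: 'k ^ 'n ^ 'n)"
        using matrix_inv_GL(1)[OF mat_1_GL] by simp
      moreover have "(*v) (mat 1 :: 'k ^ 'n ^ 'n) = (\<lambda>v. v)" by (simp add: fun_eq_iff)
      ultimately show ?thesis by (simp add: log_size_def onorm_id)
    qed
    then show "h g \<in> GL" "preserves W (h g)" "log_size (h g) \<le> log_size g"
      using that log_size_nonneg[OF that] by (auto simp: h_def mat_1_GL preserves_mat_1)
  qed
  define p where "p \<omega> n = random_product (\<lambda>i. h (\<omega> i)) n" for \<omega> n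
  have p: "p \<omega> n \<in> GL" "preserves W (p \<omega> n)" if "\<omega> \<in> space S" for \<omega> n
    unfolding p_def using h coordinate_GL[OF that] by (auto intro!: random_product_GL random_product_preserves)
  have shift_h: "(shift ^^ m) (\<lambda>i. h (\<omega> i)) = (\<lambda>i. h ((shift ^^ m) \<omega> i))" for m \<omega>
    by (simp add: iterate_shift)
  have p_add: "p \<omega> (m + n) = p ((shift ^^ m) \<omega>) n ** p \<omega> m" for \<omega> m n
    unfolding p_def random_product_add shift_h ..
  define a where "a n \<omega> = ln (quot_op_norm W (p \<omega> n))" for n \<omega>
  interpret sh: ergodic_system S shift using ergodic_iterate_shift[of 1] by simp
  interpret K0: ergodic_subadditive_process S shift a "\<lambda>\<omega>. log_size (\<omega> 0)"
  proof unfold_locales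
    note quot_op_norm_measurable[OF W(1), measurable]
    have "(\<lambda>\<omega>. p \<omega> n) \<in> borel_measurable S" for n
      unfolding p_def by (induction n) simp_all
    then show "a n \<in> borel_measurable S" for n unfolding a_def by measurable
    show "integrable S (\<lambda>\<omega>. log_size (\<omega> 0))"
      using log_size_integrable integrable_distr_eq[of "\<lambda>\<omega>. \<omega> 0" S \<mu> log_size] PiM_component[of 0] by simp
    show "a 0 \<omega> = 0" for \<omega> by (simp add: a_def p_def quot_op_norm_mat_1[OF W])
    show "a (m + n) \<omega> \<le> a m \<omega> + a n ((shift ^^ m) \<omega>)" if "\<omega> \<in> space S" for m n \<omega>
    proof -
      note \<omega>' = sh.iterate_in_space[OF that, of m]
      have "quot_op_norm W (p \<omega> (m + n)) \<le> quot_op_norm W (p ((shift ^^ m) \<omega>) n) * quot_op_norm W (p \<omega> m)"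
        unfolding p_add by (rule quot_op_norm_mult_le[OF W(1) p(2)[OF \<omega>']])
      moreover have pos: "quot_op_norm W (p \<omega>' j) > 0" if "\<omega>' \<in> space S" for \<omega>' j
        by (rule quot_op_norm_pos[OF W p(1)[OF that] p(2)[OF that]])
      ultimately have "a (m + n) \<omega> \<le> ln (quot_op_norm W (p ((shift ^^ m) \<omega>) n) * quot_op_norm W (p \<omega> m))"
        unfolding a_def using that \<omega>' by (subst ln_le_cancel_iff) auto
      also have "\<dots> = a m \<omega> + a n ((shift ^^ m) \<omega>)"
        unfolding a_def using pos[OF that, of m] pos[OF \<omega>', of n] by (subst ln_mult) auto
      finally show ?thesis .
    qed
    show "\<bar>a (Suc n) \<omega> - a n (shift \<omega>)\<bar> \<le> log_size (\<omega> 0)" if "\<omega> \<in> space S" for n \<omega>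
    proof -
      have "p \<omega> (Suc n) = p (shift \<omega>) n ** h (\<omega> 0)" using p_add[of \<omega> 1 n] by (simp add: p_def)
      then have "\<bar>a (Suc n) \<omega> - a n (shift \<omega>)\<bar> \<le> log_size (h (\<omega> 0))"
        using p[OF sh.T_in_space[OF that], of n] h[OF coordinate_GL[OF that]] W
        unfolding a_def by (auto intro!: abs_ln_quot_op_norm_diff_le)
      also have "\<dots> \<le> log_size (\<omega> 0)" by (rule h(3)[OF coordinate_GL[OF that]])
      finally show ?thesis .
    qed
  qed
  interpret K: totally_ergodic_subadditive_process S shift a "\<lambda>\<omega>. log_size (\<omega> 0)"
    by (intro totally_ergodic_subadditive_process.intro totally_ergodic_subadditive_process_axioms.intro
        K0.ergodic_subadditive_process_axioms ergodic_iterate_shift)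
  have "AE \<omega> in S. \<forall>i. preserves W (\<omega> i)"
    unfolding AE_all_countable using AE_PiM_component[of UNIV "\<lambda>_. \<mu>"] prob_space_\<mu> inv by auto
  with K.kingman AE_space
  have main: "AE \<omega> in S. (\<lambda>n. ln (quot_op_norm W (random_product \<omega> n)) / real n) \<longlonglongrightarrow> K0.time_constant
      \<and> (\<lambda>n. elog (quot_onorm W (quot_map (random_product \<omega> n))) / ereal (real n)) \<longlonglongrightarrow> ereal K0.time_constant"
  proof eventually_elim
    case (elim \<omega>)
    have "p \<omega> n = random_product \<omega> n" for n using elim(3) by (simp add: p_def h_def)
    then have lim: "(\<lambda>n. ln (quot_op_norm W (random_product \<omega> n)) / real n) \<longlonglongrightarrow> K0.time_constant"
      using elim(1) by (simp add: a_def)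
    have "elog (quot_onorm W (quot_map (random_product \<omega> n))) = ereal (ln (quot_op_norm W (random_product \<omega> n)))" for n
    proof -
      have "preserves W (random_product \<omega> n)" using elim(3) by (auto intro: random_product_preserves)
      then show ?thesis
        using quot_onorm_eq[OF W(1) product_GL[OF elim(2)], of n] quot_op_norm_pos[OF W product_GL[OF elim(2)], of n]
        by (simp add: elog_def)
    qed
    then have "\<forall>\<^sub>F n in sequentially. ereal (ln (quot_op_norm W (random_product \<omega> n)) / real n)
        = elog (quot_onorm W (quot_map (random_product \<omega> n))) / ereal (real n)"
      by (intro eventually_mono[OF eventually_gt_at_top[of 0]]) simp
    moreover have "(\<lambda>n. ereal (ln (quot_op_norm W (random_product \<omega> n)) / real n)) \<longlonglongrightarrow> ereal K0.time_constant"
      using lim by simp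
    ultimately show ?case using lim by (auto intro: Lim_transform_eventually)
  qed
  have "top_lyapunov_quot \<mu> W = ereal K0.time_constant"
    unfolding top_lyapunov_quot_def
  proof (rule the_equality)
    show "AE \<omega> in S. (\<lambda>n. elog (quot_onorm W (quot_map (random_product \<omega> n))) / ereal (real n)) \<longlonglongrightarrow> ereal K0.time_constant"
      using main by eventually_elim simp
    fix l assume "AE \<omega> in S. (\<lambda>n. elog (quot_onorm W (quot_map (random_product \<omega> n))) / ereal (real n)) \<longlonglongrightarrow> l"
    with main have "AE \<omega> in S. l = ereal K0.time_constant"
      by eventually_elim (blast intro: LIMSEQ_unique)
    then show "l = ereal K0.time_constant" by simp
  qed
  moreover have "AE \<omega> in S. (\<lambda>n. ln (quot_op_norm W (random_product \<omega> n)) / real n) \<longlonglongrightarrow> K0.time_constant"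
    using main by eventually_elim simp
  ultimately show ?thesis using that by blast
qed

end

section \<open>Stationary measures and the minimal exponent\<close>

lemma nn_integral_mixture:
  assumes sets1 [measurable_cong]: "sets M1 = sets M" and sets2 [measurable_cong]: "sets M2 = sets M"
    and em: "\<And>B. B \<in> sets M \<Longrightarrow> emeasure M B = p * emeasure M1 B + q * emeasure M2 B"
    and u: "u \<in> borel_measurable M"
  shows "(\<integral>\<^sup>+x. u x \<partial>M) = p * (\<integral>\<^sup>+x. u x \<partial>M1) + q * (\<integral>\<^sup>+x. u x \<partial>M2)"
  using u
proof (induction rule: borel_measurable_induct)
  case (cong f g)
  have sp: "space M1 = space M" "space M2 = space M" using sets1 sets2 by (auto dest: sets_eq_imp_space_eq)
  have "(\<integral>\<^sup>+x. f x \<partial>N) = (\<integral>\<^sup>+x. g x \<partial>N)" if "space N = space M" for N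
    using cong(3) that by (intro nn_integral_cong) auto
  then show ?case using cong(4) sp by simp
next
  case (set A)
  then show ?case using em sets1 sets2 by simp
next
  case (mult u c)
  then show ?case by (simp add: nn_integral_cmult distrib_left mult_ac)
next
  case (add u v)
  then show ?case by (simp add: nn_integral_add distrib_left add_ac)
next
  case (seq U)
  have SUP: "(\<integral>\<^sup>+x. (SUP i. U i) x \<partial>N) = (SUP i. \<integral>\<^sup>+x. U i x \<partial>N)" if "sets N = sets M" for N
    unfolding SUP_apply using seq that
    by (intro nn_integral_monotone_convergence_SUP) (auto simp: measurable_cong_sets[OF that refl])
  have inc: "incseq (\<lambda>i. r * (\<integral>\<^sup>+x. U i x \<partial>N))" for r N
    using \<open>incseq U\<close> by (auto simp: incseq_def le_fun_def intro!: mult_left_mono nn_integral_mono)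
  have "(SUP i. \<integral>\<^sup>+x. U i x \<partial>M) = (SUP i. p * (\<integral>\<^sup>+x. U i x \<partial>M1) + q * (\<integral>\<^sup>+x. U i x \<partial>M2))"
    using seq.IH by simp
  then show ?case
    unfolding SUP[OF refl] SUP[OF sets1] SUP[OF sets2]
    by (simp add: SUP_mult_left_ennreal ennreal_SUP_add inc)
qed

text \<open>
  The additive constant \<open>b\<close> makes the function nonnegative and reduces the claim to \<open>nn_integral_mixture\<close>.
\<close>

lemma integral_mixture:
  fixes f :: "'a \<Rightarrow> real"
  assumes M: "prob_space M" "prob_space M1" "prob_space M2" and sets: "sets M1 = sets M" "sets M2 = sets M"
    and t: "0 \<le> t" "t \<le> 1"
    and mix: "\<And>B. B \<in> sets M \<Longrightarrow> measure M B = t * measure M1 B + (1 - t) * measure M2 B"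
    and f: "f \<in> borel_measurable M" "\<And>x. x \<in> space M \<Longrightarrow> \<bar>f x\<bar> \<le> b"
  shows "(\<integral>x. f x \<partial>M) = t * (\<integral>x. f x \<partial>M1) + (1 - t) * (\<integral>x. f x \<partial>M2)"
proof -
  interpret M: prob_space M by fact
  interpret M1: prob_space M1 by fact
  interpret M2: prob_space M2 by fact
  have space: "space M1 = space M" "space M2 = space M" using sets by (auto dest: sets_eq_imp_space_eq)
  have meas: "f \<in> borel_measurable M1" "f \<in> borel_measurable M2"
    using f(1) measurable_cong_sets[OF sets(1) refl] measurable_cong_sets[OF sets(2) refl] by blast+
  have int: "integrable M f" "integrable M1 f" "integrable M2 f"
    using f meas space by (auto intro!: M.integrable_const_bound[where B = b]
        M1.integrable_const_bound[where B = b] M2.integrable_const_bound[where B = b] AE_I2)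
  have nn: "(\<integral>\<^sup>+x. ennreal (f x + b) \<partial>N) = ennreal ((\<integral>x. f x \<partial>N) + b)"
    if "prob_space N" "integrable N f" "space N = space M" for N
  proof -
    interpret prob_space N by fact
    have "(\<integral>\<^sup>+x. ennreal (f x + b) \<partial>N) = ennreal (\<integral>x. f x + b \<partial>N)"
      using that f(2) by (intro nn_integral_eq_integral AE_I2) (auto simp: abs_le_iff, force)
    then show ?thesis using that prob_space by simp
  qed
  have nonneg: "0 \<le> (\<integral>x. f x \<partial>N) + b" if "prob_space N" "integrable N f" "space N = space M" for N
  proof -
    interpret prob_space N by fact
    have "- b \<le> (\<integral>x. f x \<partial>N)"
      using that f(2) by (intro integral_ge_const AE_I2) (auto simp: abs_le_iff, force)
    then show ?thesis by simp
  qed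
  have em: "emeasure M B = ennreal t * emeasure M1 B + ennreal (1 - t) * emeasure M2 B" if "B \<in> sets M" for B
    using mix[OF that] t
    by (simp add: M.emeasure_eq_measure M1.emeasure_eq_measure M2.emeasure_eq_measure
        ennreal_mult'[symmetric] ennreal_plus[symmetric] del: ennreal_plus)
  have "ennreal ((\<integral>x. f x \<partial>M) + b)
      = ennreal t * ennreal ((\<integral>x. f x \<partial>M1) + b) + ennreal (1 - t) * ennreal ((\<integral>x. f x \<partial>M2) + b)"
    using nn_integral_mixture[OF sets em, of "\<lambda>x. ennreal (f x + b)"] nn[OF M(1) int(1)] nn[OF M(2) int(2)]
      nn[OF M(3) int(3)] space f(1) by simp
  also have "\<dots> = ennreal (t * ((\<integral>x. f x \<partial>M1) + b) + (1 - t) * ((\<integral>x. f x \<partial>M2) + b))"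
    using t nonneg[OF M(2) int(2)] nonneg[OF M(3) int(3)] space
    by (simp add: ennreal_mult'[symmetric] ennreal_plus[symmetric] del: ennreal_plus)
  finally have "(\<integral>x. f x \<partial>M) + b = t * ((\<integral>x. f x \<partial>M1) + b) + (1 - t) * ((\<integral>x. f x \<partial>M2) + b)"
    using t nonneg[OF M(1) int(1)] nonneg[OF M(2) int(2)] nonneg[OF M(3) int(3)] space
    by (subst (asm) ennreal_inj) auto
  then show ?thesis by (simp add: algebra_simps)
qed

lemma act_eq_line: "L \<in> proj UNIV \<Longrightarrow> (*v) g ` L = line (g *v rep L)"
  using mult_image_line[of g "rep L"] line_rep[of L] by simp

lemma act_in_proj: "g \<in> GL \<Longrightarrow> L \<in> proj UNIV \<Longrightarrow> (*v) g ` L \<in> proj UNIV"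
  by (simp add: act_eq_line line_in_proj GL_mult_nonzero rep_nonzero)

lemma act_measurable:
  fixes A :: "'a \<Rightarrow> 'k::{real_normed_field, euclidean_space} ^ 'n ^ 'n"
  assumes A: "A \<in> borel_measurable M" "\<And>x. x \<in> space M \<Longrightarrow> A x \<in> GL"
    and L: "L \<in> measurable M proj_borel"
  shows "(\<lambda>x. (*v) (A x) ` L x) \<in> measurable M proj_borel"
proof (subst measurable_cong)
  have L_proj: "L x \<in> proj UNIV" if "x \<in> space M" for x
    using measurable_space[OF L that] by simp
  show "(*v) (A x) ` L x = line (A x *v rep (L x))" if "x \<in> space M" for x
    by (rule act_eq_line[OF L_proj[OF that]])
  have "(\<lambda>x. rep (L x)) \<in> borel_measurable M"
    by (rule measurable_compose[OF L rep_measurable])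
  then show "(\<lambda>x. line (A x *v rep (L x))) \<in> measurable M proj_borel"
    using A(1) GL_mult_nonzero[OF A(2) rep_nonzero[OF L_proj]]
    by (intro measurable_line_compose borel_measurable_matrix_vector_mult)
qed

lemma log_cocycle_line:
  assumes g: "g \<in> GL" and v: "v \<noteq> 0"
  shows "log_cocycle g (line v) = ln (norm (g *v v)) - ln (norm v)"
proof -
  define w where "w = (SOME w. w \<in> line v \<and> w \<noteq> 0)"
  have w: "w \<in> line v \<and> w \<noteq> 0"
    unfolding w_def by (rule someI[of _ v]) (use v line_self[of v] in blast)
  then obtain c where c: "w = c *s v" using mem_line_iff by blast
  with w have "norm c \<noteq> 0" by auto
  moreover have "g *v w = c *s (g *v v)" unfolding c by (rule vec.scale)
  ultimately have "norm (g *v w) / norm w = norm (g *v v) / norm v" unfolding c by (simp add: norm_smult)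
  moreover have "ln (norm (g *v v) / norm v) = ln (norm (g *v v)) - ln (norm v)"
    using GL_mult_nonzero[OF g v] v by (simp add: ln_div)
  ultimately show ?thesis
    unfolding log_cocycle_def Let_def w_def[symmetric] by simp
qed

lemma emeasure_proj_eq_1_iff:
  assumes W: "vec.subspace W" and \<nu>: "proj_prob \<nu>"
  shows "emeasure \<nu> (proj W) = 1 \<longleftrightarrow> (\<integral>L. infdist (rep L) W \<partial>\<nu>) = 0"
proof -
  interpret prob_space \<nu> using \<nu> by (rule proj_probD)
  have "proj W \<in> events" using proj_measurable[OF W] proj_probD(2)[OF \<nu>] by simp
  then have "emeasure \<nu> (proj W) = 1 \<longleftrightarrow> (AE L in \<nu>. L \<in> proj W)"
    by (simp add: emeasure_eq_measure prob_eq_1)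
  also have "\<dots> \<longleftrightarrow> (AE L in \<nu>. infdist (rep L) W = 0)"
  proof (rule AE_cong)
    fix L assume "L \<in> space \<nu>"
    then have L: "L \<in> proj UNIV" using proj_probD(3)[OF \<nu>] by simp
    have "L \<in> proj W \<longleftrightarrow> rep L \<in> W" using line_in_proj_iff[OF W rep_nonzero[OF L]] line_rep[OF L] by simp
    then show "L \<in> proj W \<longleftrightarrow> infdist (rep L) W = 0"
      using in_closed_iff_infdist_zero[OF closed_vec_subspace[OF W]] vec.subspace_0[OF W] by auto
  qed
  also have "\<dots> \<longleftrightarrow> (\<integral>L. infdist (rep L) W \<partial>\<nu>) = 0"
    using proj_continuous_integrable[OF proj_continuous_infdist_rep \<nu>, of W] vec.subspace_scale[OF W]
    by (subst integral_nonneg_eq_0_iff_AE) (auto simp: infdist_nonneg)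
  finally show ?thesis .
qed

context matrix_walk
begin

text \<open>
  Continuity under the integral sign, by dominated convergence.
\<close>

lemma proj_continuous_integral:
  assumes meas: "\<And>L. L \<in> proj UNIV \<Longrightarrow> (\<lambda>g. F g L) \<in> borel_measurable \<mu>"
    and cont: "\<And>g. g \<in> GL \<Longrightarrow> proj_continuous (F g)"
    and bound: "\<And>g L. g \<in> GL \<Longrightarrow> L \<in> proj UNIV \<Longrightarrow> \<bar>F g L\<bar> \<le> b g" and b: "integrable \<mu> b"
  shows "proj_continuous (\<lambda>L :: ('k ^ 'n) set. \<integral>g. F g L \<partial>\<mu>)"
  unfolding proj_continuous_def continuous_on_sequentially
proof (intro allI ballI impI, elim conjE)
  fix x :: "nat \<Rightarrow> 'k ^ 'n" and v assume v: "v \<in> - {0}" and x: "\<forall>n. x n \<in> - {0}" "x \<longlonglongrightarrow> v"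
  have "(\<lambda>n. \<integral>g. F g (line (x n)) \<partial>\<mu>) \<longlonglongrightarrow> (\<integral>g. F g (line v) \<partial>\<mu>)"
  proof (rule integral_dominated_convergence[where w = b])
    show "(\<lambda>g. F g (line v)) \<in> borel_measurable \<mu>" using v by (intro meas line_in_proj) auto
    show "(\<lambda>g. F g (line (x n))) \<in> borel_measurable \<mu>" for n using x by (intro meas line_in_proj) auto
    show "AE g in \<mu>. (\<lambda>n. F g (line (x n))) \<longlonglongrightarrow> F g (line v)"
    proof (rule AE_I2)
      fix g assume "g \<in> space \<mu>"
      then have "continuous_on (- {0}) (\<lambda>v. F g (line v))"
        using cont by (simp add: space_\<mu> proj_continuous_def)
      then show "(\<lambda>n. F g (line (x n))) \<longlonglongrightarrow> F g (line v)"
        using v x unfolding continuous_on_sequentially by (auto simp: comp_def)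
    qed
    show "AE g in \<mu>. norm (F g (line (x n))) \<le> b g" for n
      using x bound by (intro AE_I2) (auto simp: space_\<mu> line_in_proj)
  qed fact
  then show "((\<lambda>v. \<integral>g. F g (line v) \<partial>\<mu>) \<circ> x) \<longlonglongrightarrow> (\<integral>g. F g (line v) \<partial>\<mu>)" by (simp add: comp_def)
qed

definition average :: "(('k ^ 'n) set \<Rightarrow> real) \<Rightarrow> ('k ^ 'n) set \<Rightarrow> real" where
  "average f L = (\<integral>g. f ((*v) g ` L) \<partial>\<mu>)"

definition mean_log :: "('k ^ 'n) set \<Rightarrow> real" where
  "mean_log L = (\<integral>g. log_cocycle g L \<partial>\<mu>)"

lemma average_line: "average f (line v) = (\<integral>g. f (line (g *v v)) \<partial>\<mu>)"
  by (simp add: average_def mult_image_line)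

lemma act_measurable_\<mu>: "L \<in> proj UNIV \<Longrightarrow> (\<lambda>g. (*v) g ` L) \<in> measurable \<mu> proj_borel"
  by (rule act_measurable[OF id_measurable_\<mu> _ measurable_const]) (simp_all add: space_\<mu>)

lemma proj_continuous_average:
  assumes f: "proj_continuous f"
  shows "proj_continuous (average f)"
proof -
  obtain b where b: "\<And>L. L \<in> proj UNIV \<Longrightarrow> \<bar>f L\<bar> \<le> b" using proj_continuous_bounded[OF f] by blast
  have "proj_continuous (\<lambda>L. \<integral>g. f ((*v) g ` L) \<partial>\<mu>)"
  proof (rule proj_continuous_integral[where b = "\<lambda>_. b"])
    show "(\<lambda>g. f ((*v) g ` L)) \<in> borel_measurable \<mu>" if "L \<in> proj UNIV" for L
      by (rule measurable_compose[OF act_measurable_\<mu>[OF that] proj_continuous_measurable[OF f]])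
    show "proj_continuous (\<lambda>L. f ((*v) g ` L))" if "g \<in> GL" for g
    proof -
      have "continuous_on (- {0}) (\<lambda>v. f (line (g *v v)))"
      proof (rule continuous_on_compose2[OF f[unfolded proj_continuous_def]])
        show "continuous_on (- {0}) ((*v) g)" by (intro linear_continuous_on) simp
        show "(*v) g ` (- {0}) \<subseteq> - {0}"
        proof (rule image_subsetI)
          fix v :: "'k ^ 'n" assume "v \<in> - {0}"
          then show "g *v v \<in> - {0}" using GL_mult_nonzero[OF that, of v] by simp
        qed
      qed
      then show ?thesis by (simp add: proj_continuous_def mult_image_line)
    qed
    show "\<bar>f ((*v) g ` L)\<bar> \<le> b" if "g \<in> GL" "L \<in> proj UNIV" for g L
      using that by (intro b act_in_proj)
    interpret prob_space \<mu> by (rule prob_space_\<mu>)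
    show "integrable \<mu> (\<lambda>_. b)" by simp
  qed
  then show ?thesis by (simp add: average_def[abs_def])
qed

lemma log_cocycle_bound: "g \<in> GL \<Longrightarrow> L \<in> proj UNIV \<Longrightarrow> \<bar>log_cocycle g L\<bar> \<le> log_size g"
  using log_cocycle_line[of g "rep L"] abs_ln_norm_quot_le[of g "rep L"] rep_nonzero[of L] line_rep[of L] by simp

lemma log_cocycle_measurable:
  assumes "L \<in> proj UNIV"
  shows "(\<lambda>g. log_cocycle g L) \<in> borel_measurable \<mu>"
proof (subst measurable_cong)
  show "log_cocycle g L = ln (norm (g *v rep L)) - ln (norm (rep L))" if "g \<in> space \<mu>" for g
    using log_cocycle_line[of g "rep L"] that rep_nonzero[OF assms] line_rep[OF assms] by (simp add: space_\<mu>)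
  show "(\<lambda>g. ln (norm (g *v rep L)) - ln (norm (rep L))) \<in> borel_measurable \<mu>" by measurable
qed

lemma proj_continuous_mean_log: "proj_continuous mean_log"
  unfolding mean_log_def[abs_def]
proof (rule proj_continuous_integral[OF log_cocycle_measurable _ log_cocycle_bound log_size_integrable])
  fix g :: "'k ^ 'n ^ 'n" assume g: "g \<in> GL"
  have "continuous_on (- {0}) (\<lambda>v. ln (norm (g *v v)) - ln (norm v))"
    using GL_mult_nonzero[OF g] by (intro continuous_intros) auto
  then show "proj_continuous (log_cocycle g)"
    unfolding proj_continuous_def by (rule continuous_on_eq) (simp add: log_cocycle_line[OF g])
qed

lemma cocycle_average_eq: "cocycle_average \<mu> \<eta> = (\<integral>L. mean_log L \<partial>\<eta>)"
  by (simp add: cocycle_average_def mean_log_def)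

lemma
  assumes \<nu>: "proj_prob \<nu>"
  shows act_pair_measurable: "(\<lambda>(g, L). (*v) g ` L) \<in> measurable (\<mu> \<Otimes>\<^sub>M \<nu>) proj_borel"
    and proj_prob_convolve: "proj_prob (convolve \<mu> \<nu>)"
    and integral_convolve: "proj_continuous f \<Longrightarrow> (\<integral>L. f L \<partial>convolve \<mu> \<nu>) = (\<integral>L. average f L \<partial>\<nu>)"
proof -
  interpret \<nu>: prob_space \<nu> using \<nu> by (rule proj_probD)
  interpret \<mu>: prob_space \<mu> by (rule prob_space_\<mu>)
  interpret MN: pair_prob_space \<mu> \<nu> ..
  show act: "(\<lambda>(g, L). (*v) g ` L) \<in> measurable (\<mu> \<Otimes>\<^sub>M \<nu>) proj_borel"
    unfolding case_prod_beta
  proof (rule act_measurable)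
    show "snd \<in> measurable (\<mu> \<Otimes>\<^sub>M \<nu>) proj_borel"
      using measurable_snd[of \<mu> \<nu>] measurable_cong_sets[OF refl proj_probD(2)[OF \<nu>]] by blast
  qed (auto simp: space_pair_measure space_\<mu>)
  show "proj_prob (convolve \<mu> \<nu>)"
    unfolding proj_prob_def convolve_def using MN.P.prob_space_distr[OF act] by simp
  show "(\<integral>L. f L \<partial>convolve \<mu> \<nu>) = (\<integral>L. average f L \<partial>\<nu>)" if f: "proj_continuous f"
  proof -
    obtain b where b: "\<And>L. L \<in> proj UNIV \<Longrightarrow> \<bar>f L\<bar> \<le> b" using proj_continuous_bounded[OF f] by blast
    have int: "integrable (\<mu> \<Otimes>\<^sub>M \<nu>) (\<lambda>(g, L). f ((*v) g ` L))"
    proof (rule MN.P.integrable_const_bound[where B = b])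
      show "(\<lambda>(g, L). f ((*v) g ` L)) \<in> borel_measurable (\<mu> \<Otimes>\<^sub>M \<nu>)"
        using measurable_compose[OF act proj_continuous_measurable[OF f]] by (simp add: case_prod_beta)
      show "AE z in \<mu> \<Otimes>\<^sub>M \<nu>. norm (case z of (g, L) \<Rightarrow> f ((*v) g ` L)) \<le> b"
        using b act_in_proj proj_probD(3)[OF \<nu>] by (intro AE_I2) (auto simp: space_pair_measure space_\<mu>)
    qed
    have "(\<integral>L. f L \<partial>convolve \<mu> \<nu>) = (\<integral>(g, L). f ((*v) g ` L) \<partial>(\<mu> \<Otimes>\<^sub>M \<nu>))"
      unfolding convolve_def by (subst integral_distr[OF act proj_continuous_measurable[OF f]]) (simp add: case_prod_unfold)
    also have "\<dots> = (\<integral>L. average f L \<partial>\<nu>)"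
      using MN.integral_snd[OF int] by (simp add: average_def)
    finally show ?thesis .
  qed
qed

text \<open>
  Stationarity and the support condition are expressed by integrals of continuous functions, so
  that they survive weak limits.
\<close>

lemma stationary_on_iff:
  fixes W :: "('k ^ 'n) set"
  assumes W: "vec.subspace W"
  shows "stationary_on \<mu> (proj W) \<nu> \<longleftrightarrow> proj_prob \<nu> \<and> (\<integral>L. infdist (rep L) W \<partial>\<nu>) = 0
    \<and> (\<forall>f. proj_continuous f \<longrightarrow> (\<integral>L. average f L \<partial>\<nu>) = (\<integral>L. f L \<partial>\<nu>))"
proof (cases "proj_prob \<nu>")
  case True
  have "convolve \<mu> \<nu> = \<nu> \<longleftrightarrow> (\<forall>f. proj_continuous f \<longrightarrow> (\<integral>L. average f L \<partial>\<nu>) = (\<integral>L. f L \<partial>\<nu>))"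
  proof
    assume "convolve \<mu> \<nu> = \<nu>"
    then show "\<forall>f. proj_continuous f \<longrightarrow> (\<integral>L. average f L \<partial>\<nu>) = (\<integral>L. f L \<partial>\<nu>)"
      using integral_convolve[OF True] by metis
  next
    assume *: "\<forall>f. proj_continuous f \<longrightarrow> (\<integral>L. average f L \<partial>\<nu>) = (\<integral>L. f L \<partial>\<nu>)"
    obtain F :: "nat \<Rightarrow> ('k ^ 'n) set \<Rightarrow> real" where F: "\<And>i. proj_continuous (F i)"
      "\<And>\<nu> \<eta>. proj_prob \<nu> \<Longrightarrow> proj_prob \<eta> \<Longrightarrow> (\<And>i. (\<integral>L. F i L \<partial>\<nu>) = (\<integral>L. F i L \<partial>\<eta>)) \<Longrightarrow> \<nu> = \<eta>"
      using ex_determining_sequence by metis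
    show "convolve \<mu> \<nu> = \<nu>"
      using * F(1) integral_convolve[OF True] by (intro F(2) proj_prob_convolve True) simp
  qed
  then show ?thesis
    using True emeasure_proj_eq_1_iff[OF W True] by (auto simp: stationary_on_def proj_prob_def)
qed (auto simp: stationary_on_def proj_prob_def)

text \<open>
  The measures need to be stationary only asymptotically; this covers both limits of stationary
  measures and averages along orbits.
\<close>

lemma stationary_limit:
  fixes W :: "('k ^ 'n) set"
  assumes W: "vec.subspace W" and \<nu>: "\<And>n. proj_prob (\<nu> n)" and \<eta>: "proj_prob \<eta>" "proj_weak_conv \<nu> \<eta>"
    and supp: "\<And>n. (\<integral>L. infdist (rep L) W \<partial>\<nu> n) = 0"
    and inv: "\<And>f. proj_continuous f \<Longrightarrow> (\<lambda>n. (\<integral>L. average f L \<partial>\<nu> n) - (\<integral>L. f L \<partial>\<nu> n)) \<longlonglongrightarrow> 0"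
  shows "stationary_on \<mu> (proj W) \<eta>"
  unfolding stationary_on_iff[OF W]
proof (intro conjI allI impI)
  have lim: "(\<lambda>n. \<integral>L. f L \<partial>\<nu> n) \<longlonglongrightarrow> (\<integral>L. f L \<partial>\<eta>)" if "proj_continuous f" for f
    using \<eta>(2) that by (simp add: proj_weak_conv_def)
  have "proj_continuous (\<lambda>L. infdist (rep L) W)"
    using vec.subspace_scale[OF W] by (intro proj_continuous_infdist_rep)
  from lim[OF this] show "(\<integral>L. infdist (rep L) W \<partial>\<eta>) = 0" by (simp add: supp LIMSEQ_const_iff)
  fix f :: "('k ^ 'n) set \<Rightarrow> real" assume f: "proj_continuous f"
  have "(\<lambda>n. (\<integral>L. average f L \<partial>\<nu> n) - (\<integral>L. f L \<partial>\<nu> n)) \<longlonglongrightarrow> (\<integral>L. average f L \<partial>\<eta>) - (\<integral>L. f L \<partial>\<eta>)"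
    by (intro tendsto_diff lim proj_continuous_average f)
  from LIMSEQ_unique[OF this inv[OF f]] show "(\<integral>L. average f L \<partial>\<eta>) = (\<integral>L. f L \<partial>\<eta>)" by simp
qed fact

lemma stationary_weakly_compact:
  fixes W :: "('k ^ 'n) set" and \<nu> :: "nat \<Rightarrow> ('k ^ 'n) set measure"
  assumes W: "vec.subspace W" and \<nu>: "\<And>n. stationary_on \<mu> (proj W) (\<nu> n)"
  obtains r \<eta> where "strict_mono r" "stationary_on \<mu> (proj W) \<eta>" "proj_prob \<eta>" "proj_weak_conv (\<lambda>n. \<nu> (r n)) \<eta>"
proof -
  note \<nu>' = \<nu>[unfolded stationary_on_iff[OF W]]
  obtain r \<eta> where r: "strict_mono r" "proj_prob \<eta>" "proj_weak_conv (\<lambda>n. \<nu> (r n)) \<eta>"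
    using proj_prob_weakly_compact[of \<nu>] \<nu>' by blast
  moreover have "stationary_on \<mu> (proj W) \<eta>"
    by (rule stationary_limit[OF W _ r(2,3)]) (use \<nu>' in auto)
  ultimately show ?thesis using that by blast
qed

end

lemma attains_minimum:
  fixes \<Psi> :: "('k::{real_normed_field, euclidean_space} ^ 'n) set measure \<Rightarrow> real"
  assumes "T \<noteq> {}"
    and compact: "\<And>\<nu> :: nat \<Rightarrow> _. (\<And>n. \<nu> n \<in> T) \<Longrightarrow> \<exists>r \<eta>. strict_mono r \<and> \<eta> \<in> T \<and> proj_weak_conv (\<lambda>n. \<nu> (r n)) \<eta>"
    and cont: "\<And>(\<nu> :: nat \<Rightarrow> _) \<eta>. (\<And>n. \<nu> n \<in> T) \<Longrightarrow> \<eta> \<in> T \<Longrightarrow> proj_weak_conv \<nu> \<eta> \<Longrightarrow> (\<lambda>n. \<Psi> (\<nu> n)) \<longlonglongrightarrow> \<Psi> \<eta>"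
    and bdd: "\<And>\<eta>. \<eta> \<in> T \<Longrightarrow> b \<le> \<Psi> \<eta>"
  shows "\<exists>\<eta>\<in>T. \<forall>\<nu>\<in>T. \<Psi> \<eta> \<le> \<Psi> \<nu>"
proof -
  define m where "m = Inf (\<Psi> ` T)"
  have bdd': "bdd_below (\<Psi> ` T)" using bdd by (intro bdd_belowI2)
  have m_le: "m \<le> \<Psi> \<nu>" if "\<nu> \<in> T" for \<nu> unfolding m_def using that bdd' by (intro cINF_lower)
  have "\<exists>\<nu>\<in>T. \<Psi> \<nu> < m + 1 / Suc n" for n :: nat
    using cInf_lessD[of "\<Psi> ` T" "m + 1 / Suc n"] \<open>T \<noteq> {}\<close> by (auto simp: m_def)
  then obtain \<nu> where \<nu>: "\<And>n. \<nu> n \<in> T" "\<And>n. \<Psi> (\<nu> n) < m + 1 / Suc n" by metis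
  obtain r \<eta> where r: "strict_mono r" "\<eta> \<in> T" "proj_weak_conv (\<lambda>n. \<nu> (r n)) \<eta>" using compact[of \<nu>, OF \<nu>(1)] by blast
  have "(\<lambda>n. \<Psi> (\<nu> (r n))) \<longlonglongrightarrow> \<Psi> \<eta>" using \<nu> r by (intro cont) auto
  moreover have "(\<lambda>n. \<Psi> (\<nu> n)) \<longlonglongrightarrow> m"
  proof (rule tendsto_sandwich)
    show "\<forall>\<^sub>F n in sequentially. m \<le> \<Psi> (\<nu> n)" using m_le \<nu>(1) by simp
    show "\<forall>\<^sub>F n in sequentially. \<Psi> (\<nu> n) \<le> m + 1 / Suc n" using \<nu>(2) by (simp add: less_imp_le)
    show "(\<lambda>n. m + 1 / Suc n) \<longlonglongrightarrow> m"
      using tendsto_add[OF tendsto_const[of m] LIMSEQ_inverse_real_of_nat] by (simp add: inverse_eq_divide)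
  qed simp
  then have "(\<lambda>n. \<Psi> (\<nu> (r n))) \<longlonglongrightarrow> m" using LIMSEQ_subseq_LIMSEQ[OF _ r(1)] by (fastforce simp: comp_def)
  ultimately have "\<Psi> \<eta> = m" by (rule LIMSEQ_unique)
  then show ?thesis using m_le r(2) by auto
qed

context matrix_walk
begin

lemma stationary_proj_prob: "stationary_on \<mu> A \<nu> \<Longrightarrow> proj_prob \<nu>"
  by (simp add: stationary_on_def proj_prob_def)

text \<open>
  Among the stationary measures on \<open>P(W)\<close>, those that minimise the cocycle average form a compact
  convex face. A strictly convex continuous functional attains its maximum on this face, and it does
  so only at extreme points, which are extreme among all stationary measures. The functional is a
  weighted sum of squares of the integrals of a determining sequence.
\<close>

lemma ex_ergodic_le:
  fixes W :: "('k ^ 'n) set"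
  assumes W: "vec.subspace W" and \<nu>: "stationary_on \<mu> (proj W) \<nu>"
  shows "\<exists>\<eta>. ergodic_on \<mu> (proj W) \<eta> \<and> cocycle_average \<mu> \<eta> \<le> cocycle_average \<mu> \<nu>"
proof -
  let ?T = "{\<eta>. stationary_on \<mu> (proj W) \<eta>}"
  obtain b where b: "\<And>L. L \<in> proj UNIV \<Longrightarrow> \<bar>mean_log L\<bar> \<le> b" using proj_continuous_bounded[OF proj_continuous_mean_log] by blast
  have lower: "- b \<le> cocycle_average \<mu> \<eta>" if "proj_prob \<eta>" for \<eta>
  proof -
    interpret prob_space \<eta> using that by (rule proj_probD)
    show ?thesis unfolding cocycle_average_eq
      using b proj_probD(3)[OF that]
      by (intro integral_ge_const proj_continuous_integrable[OF proj_continuous_mean_log that] AE_I2)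
        (auto simp: abs_le_iff minus_le_iff)
  qed
  have cont: "(\<lambda>n. cocycle_average \<mu> (\<nu> n)) \<longlonglongrightarrow> cocycle_average \<mu> \<eta>" if "proj_weak_conv \<nu> \<eta>" for \<nu> \<eta>
    using that proj_continuous_mean_log by (simp add: cocycle_average_eq proj_weak_conv_def)
  have "\<exists>\<eta>\<in>?T. \<forall>\<nu>\<in>?T. cocycle_average \<mu> \<eta> \<le> cocycle_average \<mu> \<nu>"
  proof (rule attains_minimum[where b = "- b"])
    show "\<exists>r \<eta>. strict_mono r \<and> \<eta> \<in> ?T \<and> proj_weak_conv (\<lambda>n. \<nu> (r n)) \<eta>" if "\<And>n. \<nu> n \<in> ?T"
      for \<nu> :: "nat \<Rightarrow> ('k ^ 'n) set measure"
      using stationary_weakly_compact[OF W, of \<nu>] that by blast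
  qed (use \<nu> cont lower stationary_proj_prob in auto)
  then obtain \<eta>0 where \<eta>0: "stationary_on \<mu> (proj W) \<eta>0"
    "\<And>\<nu>. stationary_on \<mu> (proj W) \<nu> \<Longrightarrow> cocycle_average \<mu> \<eta>0 \<le> cocycle_average \<mu> \<nu>" by auto
  let ?T0 = "{\<eta>. stationary_on \<mu> (proj W) \<eta> \<and> cocycle_average \<mu> \<eta> \<le> cocycle_average \<mu> \<eta>0}"
  obtain F :: "nat \<Rightarrow> ('k ^ 'n) set \<Rightarrow> real" where F: "\<And>i. proj_continuous (F i)" "\<And>i L. \<bar>F i L\<bar> \<le> 1"
    "\<And>\<nu> \<eta>. proj_prob \<nu> \<Longrightarrow> proj_prob \<eta> \<Longrightarrow> (\<And>i. (\<integral>L. F i L \<partial>\<nu>) = (\<integral>L. F i L \<partial>\<eta>)) \<Longrightarrow> \<nu> = \<eta>"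
    using ex_determining_sequence by metis
  define c where "c \<eta> i = (\<integral>L. F i L \<partial>\<eta>)" for \<eta> i
  have c_le: "(c \<eta> i)\<^sup>2 \<le> 1" if "proj_prob \<eta>" for \<eta> i
  proof -
    interpret prob_space \<eta> using that by (rule proj_probD)
    have int: "integrable \<eta> (F i)" by (rule proj_continuous_integrable[OF F(1) that])
    have "c \<eta> i \<le> 1" unfolding c_def
      using F(2) by (intro integral_le_const int AE_I2) (simp add: abs_le_iff)
    moreover have "-1 \<le> c \<eta> i" unfolding c_def
      using F(2) by (intro integral_ge_const int AE_I2) (simp add: abs_le_iff minus_le_iff)
    ultimately show ?thesis by (simp add: abs_square_le_1 abs_le_iff)
  qed
  define energy where "energy \<eta> = (\<Sum>i. (1 / 2) ^ i * (c \<eta> i)\<^sup>2)" for \<eta>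
  have geo: "summable (\<lambda>i. (1 / 2) ^ i :: real)" by (rule summable_geometric) simp
  have summ: "summable (\<lambda>i. (1 / 2) ^ i * (c \<eta> i)\<^sup>2)" if "proj_prob \<eta>" for \<eta>
    by (rule summable_comparison_test'[OF geo, of 0]) (use c_le[OF that] in \<open>simp add: abs_mult mult_left_le\<close>)
  have energy_le: "energy \<eta> \<le> 2" if "proj_prob \<eta>" for \<eta>
  proof -
    have "energy \<eta> \<le> (\<Sum>i. (1 / 2) ^ i :: real)"
      unfolding energy_def by (intro suminf_le summ that geo) (use c_le[OF that] in \<open>simp add: mult_left_le\<close>)
    then show ?thesis by (simp add: suminf_geometric)
  qed
  have energy_cont: "(\<lambda>n. energy (\<nu> n)) \<longlonglongrightarrow> energy \<eta>"
    if "\<And>n. proj_prob (\<nu> n)" "proj_weak_conv \<nu> \<eta>" for \<nu> \<eta>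
  proof -
    have "\<forall>\<^sub>F (i, n) in at_top \<times>\<^sub>F sequentially. norm ((1 / 2) ^ i * (c (\<nu> n) i)\<^sup>2) \<le> (1 / 2) ^ i"
      using c_le[OF that(1)] by (intro always_eventually) (simp add: abs_mult mult_left_le)
    moreover have "(\<lambda>n. (1 / 2) ^ i * (c (\<nu> n) i)\<^sup>2) \<longlonglongrightarrow> (1 / 2) ^ i * (c \<eta> i)\<^sup>2" for i
      using that(2) F(1)[of i] unfolding c_def proj_weak_conv_def by (intro tendsto_intros) auto
    ultimately show ?thesis unfolding energy_def using tannerys_theorem[OF _ _ geo] by fastforce
  qed
  have "\<exists>\<eta>\<in>?T0. \<forall>\<nu>\<in>?T0. - energy \<eta> \<le> - energy \<nu>"
  proof (rule attains_minimum[where b = "-2"])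
    show "\<exists>r \<eta>. strict_mono r \<and> \<eta> \<in> ?T0 \<and> proj_weak_conv (\<lambda>n. \<nu> (r n)) \<eta>" if \<nu>: "\<And>n. \<nu> n \<in> ?T0"
      for \<nu> :: "nat \<Rightarrow> ('k ^ 'n) set measure"
    proof -
      obtain r \<eta> where r: "strict_mono r" "stationary_on \<mu> (proj W) \<eta>" "proj_weak_conv (\<lambda>n. \<nu> (r n)) \<eta>"
        using stationary_weakly_compact[OF W, of \<nu>] \<nu> by blast
      have "cocycle_average \<mu> \<eta> \<le> cocycle_average \<mu> \<eta>0"
        using \<nu> by (intro LIMSEQ_le_const2[OF cont[OF r(3)]]) auto
      then show ?thesis using r by blast
    qed
    show "(\<lambda>n. - energy (\<nu> n)) \<longlonglongrightarrow> - energy \<eta>"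
      if "\<And>n. \<nu> n \<in> ?T0" "proj_weak_conv \<nu> \<eta>" for \<nu> \<eta>
      by (intro tendsto_minus energy_cont that(2)) (use that(1) stationary_proj_prob in blast)
  qed (use \<eta>0 energy_le stationary_proj_prob in auto)
  then obtain \<eta> where \<eta>: "stationary_on \<mu> (proj W) \<eta>" "cocycle_average \<mu> \<eta> \<le> cocycle_average \<mu> \<eta>0"
    "\<And>\<nu>. \<nu> \<in> ?T0 \<Longrightarrow> energy \<nu> \<le> energy \<eta>" by auto
  have "ergodic_on \<mu> (proj W) \<eta>"
    unfolding ergodic_on_def
  proof (intro conjI[OF \<eta>(1)] allI ballI impI)
    fix \<nu>1 \<nu>2 :: "('k ^ 'n) set measure" and t :: real
    assume t: "t \<in> {0<..<1}" and "stationary_on \<mu> (proj W) \<nu>1 \<and> stationary_on \<mu> (proj W) \<nu>2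
      \<and> (\<forall>B\<in>sets proj_borel. measure \<eta> B = t * measure \<nu>1 B + (1 - t) * measure \<nu>2 B)"
    then have st: "stationary_on \<mu> (proj W) \<nu>1" "stationary_on \<mu> (proj W) \<nu>2"
      and mix: "\<forall>B\<in>sets proj_borel. measure \<eta> B = t * measure \<nu>1 B + (1 - t) * measure \<nu>2 B"
      by blast+
    note pp = stationary_proj_prob[OF \<eta>(1)] stationary_proj_prob[OF st(1)] stationary_proj_prob[OF st(2)]
    have int_mix: "(\<integral>L. f L \<partial>\<eta>) = t * (\<integral>L. f L \<partial>\<nu>1) + (1 - t) * (\<integral>L. f L \<partial>\<nu>2)" if f: "proj_continuous f" for f
    proof -
      obtain B where B: "\<And>L. L \<in> proj UNIV \<Longrightarrow> \<bar>f L\<bar> \<le> B" using proj_continuous_bounded[OF f] by blast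
      show ?thesis
      proof (rule integral_mixture)
        show "prob_space \<eta>" "prob_space \<nu>1" "prob_space \<nu>2" by (rule pp[THEN proj_probD(1)])+
        show "sets \<nu>1 = sets \<eta>" "sets \<nu>2 = sets \<eta>" using pp[THEN proj_probD(2)] by simp_all
        show "measure \<eta> B = t * measure \<nu>1 B + (1 - t) * measure \<nu>2 B" if "B \<in> sets \<eta>" for B
          using mix that pp[THEN proj_probD(2)] by simp
        show "f \<in> borel_measurable \<eta>" by (rule proj_prob_measurable[OF pp(1) proj_continuous_measurable[OF f]])
        show "\<bar>f L\<bar> \<le> B" if "L \<in> space \<eta>" for L using B that proj_probD(3)[OF pp(1)] by simp
      qed (use t in auto)
    qed
    let ?\<alpha> = "cocycle_average \<mu>"
    have "?\<alpha> \<eta> = t * ?\<alpha> \<nu>1 + (1 - t) * ?\<alpha> \<nu>2"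
      unfolding cocycle_average_eq by (rule int_mix[OF proj_continuous_mean_log])
    then have le: "t * (?\<alpha> \<nu>1 - ?\<alpha> \<eta>0) + (1 - t) * (?\<alpha> \<nu>2 - ?\<alpha> \<eta>0) \<le> 0"
      using \<eta>(2) by (simp add: algebra_simps)
    have ge: "0 \<le> t * (?\<alpha> \<nu>1 - ?\<alpha> \<eta>0)" "0 \<le> (1 - t) * (?\<alpha> \<nu>2 - ?\<alpha> \<eta>0)"
      using t \<eta>0(2)[OF st(1)] \<eta>0(2)[OF st(2)] by auto
    then have "t * (?\<alpha> \<nu>1 - ?\<alpha> \<eta>0) \<le> 0" "(1 - t) * (?\<alpha> \<nu>2 - ?\<alpha> \<eta>0) \<le> 0" using le by auto
    then have "\<nu>1 \<in> ?T0" "\<nu>2 \<in> ?T0" using t st by (auto simp: mult_le_0_iff)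
    then have E: "energy \<nu>1 \<le> energy \<eta>" "energy \<nu>2 \<le> energy \<eta>" by (auto intro: \<eta>(3))
    have c_mix: "c \<eta> i = t * c \<nu>1 i + (1 - t) * c \<nu>2 i" for i unfolding c_def by (rule int_mix[OF F(1)])
    \<comment> \<open>The defect of convexity of the \<open>i\<close>-th square.\<close>
    define d where "d i = t * (1 - t) * ((1 / 2) ^ i * (c \<nu>1 i - c \<nu>2 i)\<^sup>2)" for i
    have d_eq: "d i = t * ((1 / 2) ^ i * (c \<nu>1 i)\<^sup>2) + (1 - t) * ((1 / 2) ^ i * (c \<nu>2 i)\<^sup>2) - (1 / 2) ^ i * (c \<eta> i)\<^sup>2" for i
      unfolding d_def c_mix by (simp add: power2_eq_square algebra_simps)
    have "d sums (t * energy \<nu>1 + (1 - t) * energy \<nu>2 - energy \<eta>)"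
      unfolding d_eq[abs_def] energy_def by (intro sums_diff sums_add sums_mult summable_sums summ pp)
    moreover have "t * energy \<nu>1 + (1 - t) * energy \<nu>2 \<le> t * energy \<eta> + (1 - t) * energy \<eta>"
      using E t by (intro add_mono mult_left_mono) auto
    ultimately have d: "summable d" "suminf d \<le> 0" by (auto simp: sums_iff algebra_simps)
    have d_nonneg: "0 \<le> d i" for i using t by (simp add: d_def)
    then have "suminf d = 0" using d suminf_nonneg[OF d(1)] by force
    then have "d i = 0" for i using suminf_eq_zero_iff[OF d(1)] d_nonneg by auto
    then have "c \<nu>1 i = c \<nu>2 i" for i using t by (simp add: d_def)
    moreover from this have "c \<eta> i = c \<nu>2 i" for i unfolding c_mix by (simp add: algebra_simps)
    ultimately show "\<nu>1 = \<eta> \<and> \<nu>2 = \<eta>" using F(3) pp by (auto simp: c_def)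
  qed
  moreover have "cocycle_average \<mu> \<eta> \<le> cocycle_average \<mu> \<nu>" using \<eta>(2) \<eta>0(2)[OF \<nu>] by linarith
  ultimately show ?thesis by blast
qed

text \<open>
  The infimum in \<open>beta_min\<close> ranges over ergodic measures only, but it bounds all stationary ones.
\<close>

theorem beta_min_le_cocycle_average:
  assumes "vec.subspace W" "stationary_on \<mu> (proj W) \<nu>"
  shows "beta_min \<mu> W \<le> ereal (cocycle_average \<mu> \<nu>)"
proof -
  obtain \<eta> where "ergodic_on \<mu> (proj W) \<eta>" "cocycle_average \<mu> \<eta> \<le> cocycle_average \<mu> \<nu>"
    using ex_ergodic_le[OF assms] by blast
  then show ?thesis unfolding beta_min_def by (intro INF_lower2) auto
qed


section \<open>Random walks on projective space\<close>

lemma open_Int_GL_measurable: "open U \<Longrightarrow> U \<inter> GL \<in> sets \<mu>"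
  using borel_open[of U] sets_\<mu> by (auto simp: GL_borel_def sets_restrict_space)

text \<open>
  The complement of the support is covered by countably many null sets of a basis.
\<close>

lemma AE_support: "AE g in \<mu>. g \<in> measure_support \<mu>"
proof -
  obtain B :: "('k ^ 'n ^ 'n) set set" where B: "countable B" "topological_basis B" using ex_countable_basis by blast
  define B0 where "B0 = {b \<in> B. emeasure \<mu> (b \<inter> GL) = 0}"
  note sets = open_Int_GL_measurable
  have "AE g in \<mu>. \<forall>b\<in>B0. g \<notin> b \<inter> GL"
  proof (rule AE_ball_countable')
    show "countable B0" using B(1) unfolding B0_def by (rule countable_subset[rotated]) auto
    fix b assume "b \<in> B0"
    then have "b \<inter> GL \<in> null_sets \<mu>"
      using sets topological_basis_open[OF B(2)] by (auto simp: B0_def null_sets_def)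
    then show "AE g in \<mu>. g \<notin> b \<inter> GL" by (rule AE_not_in)
  qed
  with AE_space show ?thesis
  proof eventually_elim
    case (elim g)
    have "emeasure \<mu> (U \<inter> GL) > 0" if U: "open U" "g \<in> U" for U
    proof (rule ccontr)
      assume "\<not> emeasure \<mu> (U \<inter> GL) > 0"
      then have null: "emeasure \<mu> (U \<inter> GL) = 0" by simp
      obtain b where b: "b \<in> B" "g \<in> b" "b \<subseteq> U" using topological_basisE[OF B(2) U] by metis
      have "emeasure \<mu> (b \<inter> GL) \<le> emeasure \<mu> (U \<inter> GL)" using b U by (intro emeasure_mono sets) auto
      then have "b \<in> B0" using b null by (simp add: B0_def)
      then show False using elim b by (auto simp: space_\<mu>)
    qed
    then show ?case using elim by (simp add: measure_support_def space_\<mu>)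
  qed
qed

text \<open>
  The matrices that preserve \<open>W\<close> form a closed semigroup, so it contains the support as soon as it
  has full measure.
\<close>

lemma invariant_subspace_iff_AE:
  fixes W :: "('k ^ 'n) set"
  shows "invariant_subspace \<mu> W \<longleftrightarrow> vec.subspace W \<and> (AE g in \<mu>. preserves W g)"
proof (intro iffI conjI; (elim conjE)?)
  assume W: "invariant_subspace \<mu> W"
  then show "vec.subspace W" by (simp add: invariant_subspace_def)
  show "AE g in \<mu>. preserves W g"
    using AE_support
    by eventually_elim (use W in \<open>auto simp: invariant_subspace_def preserves_def dest: semigroup_of.supp\<close>)
next
  assume W: "vec.subspace W" "AE g in \<mu>. preserves W g"
  have supp: "preserves W g" if g: "g \<in> measure_support \<mu>" for g
  proof (rule ccontr)
    assume "\<not> preserves W g"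
    let ?U = "- {h. preserves W h}"
    have open_U: "open ?U" using closed_preserves[OF closed_vec_subspace[OF W(1)]] by (simp add: closed_def)
    then have sets: "?U \<inter> GL \<in> sets \<mu>" by (rule open_Int_GL_measurable)
    have "AE h in \<mu>. h \<notin> ?U \<inter> GL" using W(2) by eventually_elim simp
    then have "?U \<inter> GL \<in> null_sets \<mu>" using AE_iff_null_sets[OF sets] by simp
    then have "emeasure \<mu> (?U \<inter> GL) = 0" by (rule null_setsD1)
    moreover have "emeasure \<mu> (?U \<inter> GL) > 0"
      using g open_U \<open>\<not> preserves W g\<close> by (auto simp: measure_support_def)
    ultimately show False by simp
  qed
  have "preserves W g" if "g \<in> semigroup_of \<mu>" for g
    using that by induction (auto intro: supp preserves_mult)
  then show "invariant_subspace \<mu> W" using W(1) by (auto simp: invariant_subspace_def preserves_def)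
qed

lemma AE_preserves_product:
  assumes "AE g in \<mu>. preserves W g"
  shows "AE \<omega> in S. \<forall>n. preserves W (random_product \<omega> n)"
proof -
  have "AE \<omega> in S. \<forall>i. preserves W (\<omega> i)"
    unfolding AE_all_countable using AE_PiM_component[of UNIV "\<lambda>_. \<mu>"] prob_space_\<mu> assms by auto
  then show ?thesis by eventually_elim (auto intro: random_product_preserves)
qed

lemma product_nonzero: "\<omega> \<in> space S \<Longrightarrow> v \<noteq> 0 \<Longrightarrow> random_product \<omega> n *v v \<noteq> 0"
  by (rule GL_mult_nonzero[OF product_GL])

lemma orbit_measurable: "v \<noteq> 0 \<Longrightarrow> (\<lambda>\<omega>. line (random_product \<omega> n *v v)) \<in> measurable S proj_borel"
  by (rule measurable_line_compose[OF _ product_nonzero]) measurable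

lemma random_product_case_nat: "random_product (case_nat s \<omega>) (Suc n) = random_product \<omega> n ** s"
  using random_product_Suc_shift[of "case_nat s \<omega>" n] by simp

text \<open>
  The first matrix of the sequence acts first. Splitting it off restarts the walk at its image of the
  starting point, which is the Markov property of the walk.
\<close>

lemma orbit_case_nat: "random_product (case_nat s \<omega>) (Suc n) *v v = random_product \<omega> n *v (s *v v)"
  unfolding random_product_case_nat by (simp only: matrix_vector_mul_assoc)

definition orbit_mean :: "(('k ^ 'n) set \<Rightarrow> real) \<Rightarrow> 'k ^ 'n \<Rightarrow> nat \<Rightarrow> real" where
  "orbit_mean f v n = (\<integral>\<omega>. f (line (random_product \<omega> n *v v)) \<partial>S)"

lemma orbit_integrable:
  assumes f: "proj_continuous f" and v: "v \<noteq> 0"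
  shows "integrable S (\<lambda>\<omega>. f (line (random_product \<omega> n *v v)))"
proof -
  obtain b where b: "\<And>L. L \<in> proj UNIV \<Longrightarrow> \<bar>f L\<bar> \<le> b" using proj_continuous_bounded[OF f] by blast
  show ?thesis
  proof (rule P.integrable_const_bound[where B = b])
    show "(\<lambda>\<omega>. f (line (random_product \<omega> n *v v))) \<in> borel_measurable S"
      by (rule measurable_compose[OF orbit_measurable[OF v] proj_continuous_measurable[OF f]])
    show "AE \<omega> in S. norm (f (line (random_product \<omega> n *v v))) \<le> b"
    proof (rule AE_I2)
      fix \<omega> assume "\<omega> \<in> space S"
      then show "norm (f (line (random_product \<omega> n *v v))) \<le> b"
        using b[OF line_in_proj[OF product_nonzero[OF _ v]]] by simp
    qed
  qed
qed

lemma orbit_mean_bound: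
  assumes f: "proj_continuous f" and v: "v \<noteq> 0" and b: "\<And>L. L \<in> proj UNIV \<Longrightarrow> \<bar>f L\<bar> \<le> b"
  shows "\<bar>orbit_mean f v n\<bar> \<le> b"
proof -
  have le: "\<bar>f (line (random_product \<omega> n *v v))\<bar> \<le> b" if "\<omega> \<in> space S" for \<omega>
    by (rule b[OF line_in_proj[OF product_nonzero[OF that v]]]) simp
  have "orbit_mean f v n \<le> b" "- b \<le> orbit_mean f v n"
    unfolding orbit_mean_def
    by (intro P.integral_le_const P.integral_ge_const orbit_integrable[OF f v] AE_I2;
        use le in \<open>fastforce simp: abs_le_iff\<close>)+
  then show ?thesis by simp
qed

lemma orbit_mean_0: "orbit_mean f v 0 = f (line v)"
  by (simp add: orbit_mean_def P.prob_space)

lemma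
  assumes f: "proj_continuous f" and v: "v \<noteq> 0"
  shows orbit_mean_Suc: "orbit_mean f v (Suc n) = (\<integral>s. orbit_mean f (s *v v) n \<partial>\<mu>)"
    and orbit_mean_integrable: "integrable \<mu> (\<lambda>s. orbit_mean f (s *v v) n)"
  using integral_seq[OF orbit_integrable[OF f v, of "Suc n"]] integrable_seq[OF orbit_integrable[OF f v, of "Suc n"]]
  unfolding orbit_mean_def orbit_case_nat by simp_all

text \<open>
  The operator \<open>average\<close> can be applied after the walk as well as before it, because it commutes with
  its own powers; \<open>orbit_mean_Suc\<close> applies it before.
\<close>

lemma orbit_mean_average:
  assumes f: "proj_continuous f" and v: "v \<noteq> 0"
  shows "orbit_mean (average f) v n = orbit_mean f v (Suc n)"
  using v
proof (induction n arbitrary: v)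
  case 0
  show ?case unfolding orbit_mean_Suc[OF f 0] orbit_mean_0 by (simp add: average_line)
next
  case (Suc n)
  have "orbit_mean (average f) v (Suc n) = (\<integral>s. orbit_mean (average f) (s *v v) n \<partial>\<mu>)"
    by (rule orbit_mean_Suc[OF proj_continuous_average[OF f] Suc.prems])
  also have "\<dots> = (\<integral>s. orbit_mean f (s *v v) (Suc n) \<partial>\<mu>)"
    by (intro Bochner_Integration.integral_cong refl Suc.IH GL_mult_nonzero Suc.prems) (simp add: space_\<mu>)
  also have "\<dots> = orbit_mean f v (Suc (Suc n))" by (rule orbit_mean_Suc[OF f Suc.prems, symmetric])
  finally show ?case .
qed

lemma log_orbit_bound:
  assumes \<omega>: "\<omega> \<in> space S" and v: "v \<noteq> 0"
  shows "\<bar>ln (norm (random_product \<omega> n *v v)) - ln (norm v)\<bar> \<le> (\<Sum>i<n. log_size (\<omega> i))"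
proof (induction n)
  case (Suc n)
  have "random_product \<omega> (Suc n) *v v = \<omega> n *v (random_product \<omega> n *v v)"
    by (simp add: matrix_vector_mul_assoc)
  then have "\<bar>ln (norm (random_product \<omega> (Suc n) *v v)) - ln (norm (random_product \<omega> n *v v))\<bar> \<le> log_size (\<omega> n)"
    using abs_ln_norm_quot_le[OF coordinate_GL[OF \<omega>] product_nonzero[OF \<omega> v]] by metis
  with Suc show ?case by simp
qed simp

lemma
  fixes f :: "'k ^ 'n ^ 'n \<Rightarrow> real"
  assumes [measurable]: "f \<in> borel_measurable \<mu>"
  shows integral_coordinate: "(\<integral>\<omega>. f (\<omega> i) \<partial>S) = (\<integral>g. f g \<partial>\<mu>)"
    and integrable_coordinate_iff: "integrable S (\<lambda>\<omega>. f (\<omega> i)) \<longleftrightarrow> integrable \<mu> f"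
proof -
  have comp: "distr S \<mu> (\<lambda>\<omega>. \<omega> i) = \<mu>" by (rule PiM_component) simp
  show "(\<integral>\<omega>. f (\<omega> i) \<partial>S) = (\<integral>g. f g \<partial>\<mu>)"
    using integral_distr[of "\<lambda>\<omega>. \<omega> i" S \<mu> f] by (simp add: comp)
  show "integrable S (\<lambda>\<omega>. f (\<omega> i)) \<longleftrightarrow> integrable \<mu> f"
    using integrable_distr_eq[of "\<lambda>\<omega>. \<omega> i" S \<mu> f] by (simp add: comp)
qed

lemma log_orbit_integrable:
  assumes v: "v \<noteq> 0"
  shows "integrable S (\<lambda>\<omega>. ln (norm (random_product \<omega> n *v v)))"
proof (rule Bochner_Integration.integrable_bound)
  show "integrable S (\<lambda>\<omega>. \<bar>ln (norm v)\<bar> + (\<Sum>i<n. log_size (\<omega> i)))"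
    using log_size_integrable
    by (intro Bochner_Integration.integrable_add Bochner_Integration.integrable_sum) (simp_all add: integrable_coordinate_iff)
  show "(\<lambda>\<omega>. ln (norm (random_product \<omega> n *v v))) \<in> borel_measurable S" by measurable
  show "AE \<omega> in S. norm (ln (norm (random_product \<omega> n *v v))) \<le> norm (\<bar>ln (norm v)\<bar> + (\<Sum>i<n. log_size (\<omega> i)))"
  proof (rule AE_I2)
    fix \<omega> assume "\<omega> \<in> space S"
    from log_orbit_bound[OF this v, of n]
    show "norm (ln (norm (random_product \<omega> n *v v))) \<le> norm (\<bar>ln (norm v)\<bar> + (\<Sum>i<n. log_size (\<omega> i)))"
      unfolding real_norm_def by linarith
  qed
qed

text \<open>
  The logarithm of the norm is a sum of increments along the orbit, and each increment has mean
  \<open>mean_log\<close> at the current line.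
\<close>

lemma expected_log_orbit:
  assumes "v \<noteq> 0"
  shows "(\<integral>\<omega>. ln (norm (random_product \<omega> n *v v)) \<partial>S) = ln (norm v) + (\<Sum>k<n. orbit_mean mean_log v k)"
  using assms
proof (induction n arbitrary: v)
  case 0
  then show ?case by (simp add: P.prob_space)
next
  case (Suc n)
  note pc = proj_continuous_mean_log
  have coc: "integrable \<mu> (\<lambda>g. log_cocycle g (line v))"
  proof (rule Bochner_Integration.integrable_bound[OF log_size_integrable])
    have L: "line v \<in> proj UNIV" using Suc.prems by (intro line_in_proj) auto
    show "(\<lambda>g. log_cocycle g (line v)) \<in> borel_measurable \<mu>" by (rule log_cocycle_measurable[OF L])
    show "AE g in \<mu>. norm (log_cocycle g (line v)) \<le> norm (log_size g)"
      using order_trans[OF log_cocycle_bound[OF _ L] abs_ge_self] by (intro AE_I2) (simp add: space_\<mu>)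
  qed
  have "(\<integral>\<omega>. ln (norm (random_product \<omega> (Suc n) *v v)) \<partial>S)
      = (\<integral>s. \<integral>\<omega>. ln (norm (random_product \<omega> n *v (s *v v))) \<partial>S \<partial>\<mu>)"
    using integral_seq[OF log_orbit_integrable[OF Suc.prems, of "Suc n"]] unfolding orbit_case_nat .
  also have "\<dots> = (\<integral>s. ln (norm v) + log_cocycle s (line v) + (\<Sum>k<n. orbit_mean mean_log (s *v v) k) \<partial>\<mu>)"
  proof (intro Bochner_Integration.integral_cong refl)
    fix s assume "s \<in> space \<mu>"
    then have s: "s \<in> GL" by (simp add: space_\<mu>)
    show "(\<integral>\<omega>. ln (norm (random_product \<omega> n *v (s *v v))) \<partial>S)
        = ln (norm v) + log_cocycle s (line v) + (\<Sum>k<n. orbit_mean mean_log (s *v v) k)"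
      using Suc.IH[OF GL_mult_nonzero[OF s Suc.prems]] log_cocycle_line[OF s Suc.prems] by simp
  qed
  also have "\<dots> = ln (norm v) + mean_log (line v) + (\<Sum>k<n. \<integral>s. orbit_mean mean_log (s *v v) k \<partial>\<mu>)"
    using coc orbit_mean_integrable[OF pc Suc.prems]
    by (simp add: Bochner_Integration.integral_add Bochner_Integration.integral_sum mean_log_def M.prob_space)
  also have "\<dots> = ln (norm v) + (\<Sum>k<Suc n. orbit_mean mean_log v k)"
    by (simp add: sum.lessThan_Suc_shift orbit_mean_0 orbit_mean_Suc[OF pc Suc.prems] del: sum.lessThan_Suc)
  finally show ?case .
qed

text \<open>
  The law of the line at a uniformly chosen time before \<open>n\<close>.
\<close>

definition cesaro :: "'k ^ 'n \<Rightarrow> nat \<Rightarrow> ('k ^ 'n) set measure" where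
  "cesaro v n = distr (measure_pmf (pmf_of_set {..<n}) \<Otimes>\<^sub>M S) proj_borel
    (\<lambda>(k, \<omega>). line (random_product \<omega> k *v v))"

lemma
  assumes v: "v \<noteq> 0"
  shows proj_prob_cesaro: "proj_prob (cesaro v n)"
    and integral_cesaro: "proj_continuous f \<Longrightarrow> n \<ge> 1 \<Longrightarrow> (\<integral>L. f L \<partial>cesaro v n) = (\<Sum>k<n. orbit_mean f v k) / real n"
proof -
  let ?p = "measure_pmf (pmf_of_set {..<n})"
  interpret p: prob_space ?p by (rule measure_pmf.prob_space_axioms)
  interpret pS: pair_prob_space ?p S ..
  have meas: "(\<lambda>(k, \<omega>). line (random_product \<omega> k *v v)) \<in> measurable (?p \<Otimes>\<^sub>M S) proj_borel"
  proof -
    have "(\<lambda>(k, \<omega>). line (random_product \<omega> k *v v)) \<in> measurable (count_space UNIV \<Otimes>\<^sub>M S) proj_borel"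
      by (rule measurable_pair_measure_countable1) (simp_all add: orbit_measurable[OF v])
    moreover have "sets (?p \<Otimes>\<^sub>M S) = sets (count_space UNIV \<Otimes>\<^sub>M S)" by (rule sets_pair_measure_cong) simp_all
    ultimately show ?thesis using measurable_cong_sets by blast
  qed
  show "proj_prob (cesaro v n)" unfolding proj_prob_def cesaro_def using pS.P.prob_space_distr[OF meas] by simp
  show "(\<integral>L. f L \<partial>cesaro v n) = (\<Sum>k<n. orbit_mean f v k) / real n" if f: "proj_continuous f" and n: "n \<ge> 1"
  proof -
    obtain b where b: "\<And>L. L \<in> proj UNIV \<Longrightarrow> \<bar>f L\<bar> \<le> b" using proj_continuous_bounded[OF f] by blast
    have int: "integrable (?p \<Otimes>\<^sub>M S) (\<lambda>z. f (case z of (k, \<omega>) \<Rightarrow> line (random_product \<omega> k *v v)))"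
    proof (rule pS.P.integrable_const_bound[where B = b])
      show "(\<lambda>z. f (case z of (k, \<omega>) \<Rightarrow> line (random_product \<omega> k *v v))) \<in> borel_measurable (?p \<Otimes>\<^sub>M S)"
        by (rule measurable_compose[OF meas proj_continuous_measurable[OF f]])
      show "AE z in ?p \<Otimes>\<^sub>M S. norm (f (case z of (k, \<omega>) \<Rightarrow> line (random_product \<omega> k *v v))) \<le> b"
      proof (rule AE_I2)
        fix z assume "z \<in> space (?p \<Otimes>\<^sub>M S)"
        then obtain k \<omega> where z: "z = (k, \<omega>)" "\<omega> \<in> space S" by (auto simp: space_pair_measure)
        show "norm (f (case z of (k, \<omega>) \<Rightarrow> line (random_product \<omega> k *v v))) \<le> b"
          using b[OF line_in_proj[OF product_nonzero[OF z(2) v]]] by (simp add: z)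
      qed
    qed
    have "(\<integral>L. f L \<partial>cesaro v n) = (\<integral>z. f (case z of (k, \<omega>) \<Rightarrow> line (random_product \<omega> k *v v)) \<partial>(?p \<Otimes>\<^sub>M S))"
      unfolding cesaro_def by (rule integral_distr[OF meas proj_continuous_measurable[OF f]])
    also have "\<dots> = (\<integral>k. orbit_mean f v k \<partial>?p)"
      using pS.integral_fst'[OF int] by (simp add: orbit_mean_def)
    also have "\<dots> = (\<Sum>k<n. orbit_mean f v k) / real n"
      using n by (subst integral_pmf_of_set) (auto simp: lessThan_empty_iff)
    finally show ?thesis .
  qed
qed

text \<open>
  Averages along an orbit are stationary up to a telescoping error of order \<open>1/n\<close>, so their weak
  limits are stationary. Since \<open>mean_log\<close> is continuous, its integral passes to the limit, where it is
  the cocycle average.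
\<close>

theorem krylov_bogoliubov:
  assumes W: "vec.subspace W" "AE g in \<mu>. preserves W g" and w: "w \<in> W" "w \<noteq> 0"
    and r: "\<And>n. 1 \<le> r n" "filterlim r at_top sequentially"
  obtains s \<eta> where "strict_mono s" "stationary_on \<mu> (proj W) \<eta>"
    "(\<lambda>n. (\<integral>\<omega>. ln (norm (random_product \<omega> (r (s n)) *v w)) \<partial>S) / real (r (s n))) \<longlonglongrightarrow> cocycle_average \<mu> \<eta>"
proof -
  obtain s \<eta> where s: "strict_mono s" and \<eta>: "proj_prob \<eta>" "proj_weak_conv (\<lambda>n. cesaro w (r (s n))) \<eta>"
    using proj_prob_weakly_compact[of "\<lambda>n. cesaro w (r n)"] proj_prob_cesaro[OF w(2)] by blast
  have rs: "filterlim (\<lambda>n. r (s n)) at_top sequentially"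
    by (rule filterlim_compose[OF r(2) filterlim_subseq[OF s]])
  have over: "(\<lambda>n. c / real (r (s n))) \<longlonglongrightarrow> 0" for c
    by (rule tendsto_divide_0[OF tendsto_const filterlim_at_top_imp_at_infinity[OF filterlim_compose[OF filterlim_real_sequentially rs]]])
  have "stationary_on \<mu> (proj W) \<eta>"
  proof (rule stationary_limit[OF W(1) proj_prob_cesaro[OF w(2)] \<eta>])
    fix n
    have pc: "proj_continuous (\<lambda>L. infdist (rep L) W)"
      using vec.subspace_scale[OF W(1)] by (intro proj_continuous_infdist_rep)
    have "orbit_mean (\<lambda>L. infdist (rep L) W) w k = 0" for k
    proof -
      have "orbit_mean (\<lambda>L. infdist (rep L) W) w k = (\<integral>\<omega>. 0 \<partial>S)"
        unfolding orbit_mean_def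
      proof (rule integral_cong_AE)
        show "(\<lambda>\<omega>. infdist (rep (line (random_product \<omega> k *v w))) W) \<in> borel_measurable S"
          using orbit_integrable[OF pc w(2)] by (rule borel_measurable_integrable)
        show "AE \<omega> in S. infdist (rep (line (random_product \<omega> k *v w))) W = 0"
          using AE_preserves_product[OF W(2)] AE_space
        proof eventually_elim
          case (elim \<omega>)
          then have "random_product \<omega> k *v w \<in> W" using w(1) by (simp add: preserves_def)
          then have "infdist (random_product \<omega> k *v w) W = 0" by simp
          then show ?case
            using infdist_rep_line[OF _ product_nonzero[OF elim(2) w(2)], of W k] vec.subspace_scale[OF W(1)] by simp
        qed
      qed simp
      then show ?thesis by simp
    qed
    then show "(\<integral>L. infdist (rep L) W \<partial>cesaro w (r (s n))) = 0"
      using integral_cesaro[OF w(2) pc r(1)] by simp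
  next
    fix f :: "('k ^ 'n) set \<Rightarrow> real" assume f: "proj_continuous f"
    obtain b where b: "\<And>L. L \<in> proj UNIV \<Longrightarrow> \<bar>f L\<bar> \<le> b" using proj_continuous_bounded[OF f] by blast
    have eq: "(\<integral>L. average f L \<partial>cesaro w n) - (\<integral>L. f L \<partial>cesaro w n) = (orbit_mean f w n - orbit_mean f w 0) / real n" if "1 \<le> n" for n
      using integral_cesaro[OF w(2) proj_continuous_average[OF f] that] integral_cesaro[OF w(2) f that]
        orbit_mean_average[OF f w(2)] sum_lessThan_telescope[of "orbit_mean f w" n]
      by (simp add: diff_divide_distrib[symmetric] sum_subtractf)
    show "(\<lambda>n. (\<integral>L. average f L \<partial>cesaro w (r (s n))) - (\<integral>L. f L \<partial>cesaro w (r (s n)))) \<longlonglongrightarrow> 0"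
    proof (rule Lim_null_comparison[OF always_eventually over[of "2 * b"]], rule allI)
      fix n
      have "\<bar>orbit_mean f w (r (s n)) - orbit_mean f w 0\<bar> \<le> 2 * b"
        using orbit_mean_bound[OF f w(2) b, of "r (s n)"] orbit_mean_bound[OF f w(2) b, of 0] by linarith
      then show "norm ((\<integral>L. average f L \<partial>cesaro w (r (s n))) - (\<integral>L. f L \<partial>cesaro w (r (s n)))) \<le> 2 * b / real (r (s n))"
        unfolding eq[OF r(1)] by (simp add: divide_right_mono)
    qed
  qed
  moreover have "(\<lambda>n. (\<integral>\<omega>. ln (norm (random_product \<omega> (r (s n)) *v w)) \<partial>S) / real (r (s n))) \<longlonglongrightarrow> cocycle_average \<mu> \<eta>"
  proof -
    have "(\<lambda>n. ln (norm w) / real (r (s n)) + (\<integral>L. mean_log L \<partial>cesaro w (r (s n)))) \<longlonglongrightarrow> 0 + (\<integral>L. mean_log L \<partial>\<eta>)"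
      using \<eta>(2) proj_continuous_mean_log by (intro tendsto_add over) (simp add: proj_weak_conv_def)
    then show ?thesis
      by (simp add: expected_log_orbit[OF w(2)] integral_cesaro[OF w(2) proj_continuous_mean_log r(1)]
          add_divide_distrib cocycle_average_eq)
  qed
  ultimately show ?thesis using s that by blast
qed


text \<open>
  A vector of \<open>W\<close> that grows in probability at rate at most \<open>\<rho>\<close> also does so in mean, because the
  increments are uniformly integrable: on the exceptional event the logarithm is bounded by a sum of
  \<open>log_size\<close>, whose part below \<open>K\<close> is controlled by the probability of the event and whose part above
  \<open>K\<close> has small integral. The averages along the orbit then produce a stationary measure on \<open>P(W)\<close> with
  cocycle average at most \<open>\<rho>\<close>.
\<close>

theorem beta_min_le_growth:
  assumes W: "vec.subspace W" "AE g in \<mu>. preserves W g" and w: "w \<in> W" "w \<noteq> 0"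
    and r: "\<And>n. 1 \<le> r n" "filterlim r at_top sequentially" and C: "C > 0"
    and slow: "(\<lambda>n. measure S {\<omega> \<in> space S. C * exp (real (r n) * \<rho>) < norm (random_product \<omega> (r n) *v w)}) \<longlonglongrightarrow> 0"
  shows "beta_min \<mu> W \<le> ereal \<rho>"
proof -
  obtain s \<eta> where s: "strict_mono s" and \<eta>: "stationary_on \<mu> (proj W) \<eta>"
    and lim: "(\<lambda>n. (\<integral>\<omega>. ln (norm (random_product \<omega> (r (s n)) *v w)) \<partial>S) / real (r (s n))) \<longlonglongrightarrow> cocycle_average \<mu> \<eta>"
    by (rule krylov_bogoliubov[OF W w r])
  define bad where "bad n = {\<omega> \<in> space S. C * exp (real n * \<rho>) < norm (random_product \<omega> n *v w)}" for n
  have bad [measurable]: "bad n \<in> sets S" for n unfolding bad_def by measurable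
  define D where "D = \<bar>ln (norm w)\<bar> + \<bar>ln C\<bar>"
  define big where "big K g = (if K < log_size g then log_size g else 0)" for K :: real and g :: "'k ^ 'n ^ 'n"
  have big_meas [measurable]: "big K \<in> borel_measurable \<mu>" for K unfolding big_def by measurable
  have big_int: "integrable \<mu> (big K)" for K
    by (rule Bochner_Integration.integrable_bound[OF log_size_integrable]) (auto simp: big_def)
  define tail where "tail K = (\<integral>g. big K g \<partial>\<mu>)" for K
  have tail_0: "(\<lambda>K. tail (real K)) \<longlonglongrightarrow> 0"
  proof -
    have "(\<lambda>K. \<integral>g. big (real K) g \<partial>\<mu>) \<longlonglongrightarrow> (\<integral>g. 0 \<partial>\<mu>)"
    proof (rule integral_dominated_convergence[where w = log_size])
      show "AE g in \<mu>. (\<lambda>K. big (real K) g) \<longlonglongrightarrow> 0"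
      proof (rule AE_I2)
        fix g :: "'k ^ 'n ^ 'n"
        obtain K0 :: nat where "log_size g < real K0" using reals_Archimedean2 by blast
        then have "\<forall>\<^sub>F K in sequentially. big (real K) g = 0"
          by (intro eventually_sequentiallyI[of K0]) (auto simp: big_def)
        then show "(\<lambda>K. big (real K) g) \<longlonglongrightarrow> 0" by (rule tendsto_eventually)
      qed
      show "AE g in \<mu>. norm (big (real K) g) \<le> log_size g" for K
        using log_size_nonneg by (intro AE_I2) (auto simp: big_def space_\<mu>)
    qed (simp_all add: log_size_integrable)
    then show ?thesis by (simp add: tail_def)
  qed
  have bound: "(\<integral>\<omega>. ln (norm (random_product \<omega> n *v w)) \<partial>S)
      \<le> ln C + real n * \<rho> + measure S (bad n) * (D + real n * (\<bar>\<rho>\<bar> + K)) + real n * tail K" if K: "K \<ge> 0" for n K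
  proof -
    let ?R = "\<lambda>\<omega>. ln C + real n * \<rho> + indicator (bad n) \<omega> * (D + real n * (\<bar>\<rho>\<bar> + K)) + (\<Sum>i<n. big K (\<omega> i))"
    have int_ind: "integrable S (\<lambda>\<omega>. indicator (bad n) \<omega> * (D + real n * (\<bar>\<rho>\<bar> + K)))"
      by (intro integrable_mult_left integrable_real_indicator bad) (simp add: P.emeasure_eq_measure)
    have int_sum: "integrable S (\<lambda>\<omega>. \<Sum>i<n. big K (\<omega> i))"
      using big_int by (intro Bochner_Integration.integrable_sum) (simp add: integrable_coordinate_iff)
    have "(\<integral>\<omega>. ln (norm (random_product \<omega> n *v w)) \<partial>S) \<le> (\<integral>\<omega>. ?R \<omega> \<partial>S)"
    proof (rule integral_mono[OF log_orbit_integrable[OF w(2)]])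
      show "integrable S ?R" using int_ind int_sum by simp
      fix \<omega> assume \<omega>: "\<omega> \<in> space S"
      have pos: "norm (random_product \<omega> n *v w) > 0" using product_nonzero[OF \<omega> w(2)] by simp
      have big_nonneg: "0 \<le> big K (\<omega> i)" for i
        using log_size_nonneg[OF coordinate_GL[OF \<omega>]] by (simp add: big_def)
      show "ln (norm (random_product \<omega> n *v w)) \<le> ?R \<omega>"
      proof (cases "\<omega> \<in> bad n")
        case False
        then have "norm (random_product \<omega> n *v w) \<le> C * exp (real n * \<rho>)" using \<omega> by (simp add: bad_def)
        then have "ln (norm (random_product \<omega> n *v w)) \<le> ln (C * exp (real n * \<rho>))"
          using pos C by (subst ln_le_cancel_iff) auto
        also have "\<dots> = ln C + real n * \<rho>" using C by (simp add: ln_mult)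
        finally show ?thesis using False sum_nonneg[of "{..<n}" "\<lambda>i. big K (\<omega> i)"] big_nonneg by simp
      next
        case True
        have "log_size (\<omega> i) \<le> K + big K (\<omega> i)" for i using K by (simp add: big_def)
        then have "(\<Sum>i<n. log_size (\<omega> i)) \<le> (\<Sum>i<n. K + big K (\<omega> i))" by (intro sum_mono)
        then have "(\<Sum>i<n. log_size (\<omega> i)) \<le> real n * K + (\<Sum>i<n. big K (\<omega> i))" by (simp add: sum.distrib)
        moreover have "0 \<le> real n * \<rho> + real n * \<bar>\<rho>\<bar>" by (simp add: distrib_left[symmetric])
        ultimately have "ln (norm (random_product \<omega> n *v w)) \<le> ln C + real n * \<rho> + (D + (real n * \<bar>\<rho>\<bar> + real n * K)) + (\<Sum>i<n. big K (\<omega> i))"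
          using log_orbit_bound[OF \<omega> w(2), of n] unfolding D_def by linarith
        then show ?thesis using True by (simp add: distrib_left)
      qed
    qed
    also have "\<dots> = ln C + real n * \<rho> + measure S (bad n) * (D + real n * (\<bar>\<rho>\<bar> + K)) + (\<Sum>i<n. \<integral>\<omega>. big K (\<omega> i) \<partial>S)"
      using int_ind int_sum big_int
      by (simp add: Bochner_Integration.integral_add Bochner_Integration.integral_sum integrable_coordinate_iff P.prob_space)
    also have "(\<Sum>i<n. \<integral>\<omega>. big K (\<omega> i) \<partial>S) = real n * tail K"
      by (simp add: integral_coordinate tail_def)
    finally show ?thesis .
  qed
  have "cocycle_average \<mu> \<eta> \<le> \<rho> + tail (real K)" for K :: nat
  proof (rule LIMSEQ_le[OF lim])
    have rs: "filterlim (\<lambda>n. r (s n)) at_top sequentially"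
      by (rule filterlim_compose[OF r(2) filterlim_subseq[OF s]])
    have over: "(\<lambda>n. c / real (r (s n))) \<longlonglongrightarrow> 0" for c
      by (rule tendsto_divide_0[OF tendsto_const filterlim_at_top_imp_at_infinity[OF filterlim_compose[OF filterlim_real_sequentially rs]]])
    have p: "(\<lambda>n. measure S (bad (r (s n)))) \<longlonglongrightarrow> 0"
      using LIMSEQ_subseq_LIMSEQ[OF slow s] by (simp add: bad_def comp_def)
    have "(\<lambda>n. ln C / real (r (s n)) + \<rho> + measure S (bad (r (s n))) * (D / real (r (s n)) + (\<bar>\<rho>\<bar> + real K)) + tail (real K))
        \<longlonglongrightarrow> 0 + \<rho> + 0 * (0 + (\<bar>\<rho>\<bar> + real K)) + tail (real K)"
      by (intro tendsto_add tendsto_mult tendsto_const over p)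
    then show "(\<lambda>n. ln C / real (r (s n)) + \<rho> + measure S (bad (r (s n))) * (D / real (r (s n)) + (\<bar>\<rho>\<bar> + real K)) + tail (real K))
        \<longlonglongrightarrow> \<rho> + tail (real K)" by simp
    have "(\<integral>\<omega>. ln (norm (random_product \<omega> (r (s n)) *v w)) \<partial>S) / real (r (s n))
        \<le> ln C / real (r (s n)) + \<rho> + measure S (bad (r (s n))) * (D / real (r (s n)) + (\<bar>\<rho>\<bar> + real K)) + tail (real K)" for n
    proof -
      have N: "real (r (s n)) > 0" using r(1)[of "s n"] by simp
      have "(\<integral>\<omega>. ln (norm (random_product \<omega> (r (s n)) *v w)) \<partial>S) / real (r (s n))
          \<le> (ln C + real (r (s n)) * \<rho> + measure S (bad (r (s n))) * (D + real (r (s n)) * (\<bar>\<rho>\<bar> + real K)) + real (r (s n)) * tail (real K)) / real (r (s n))"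
        using N bound[of "real K" "r (s n)"] by (intro divide_right_mono) auto
      also have "\<dots> = ln C / real (r (s n)) + \<rho> + measure S (bad (r (s n))) * (D / real (r (s n)) + (\<bar>\<rho>\<bar> + real K)) + tail (real K)"
        using N by (simp add: field_simps)
      finally show ?thesis .
    qed
    then show "\<exists>N. \<forall>n\<ge>N. (\<integral>\<omega>. ln (norm (random_product \<omega> (r (s n)) *v w)) \<partial>S) / real (r (s n))
        \<le> ln C / real (r (s n)) + \<rho> + measure S (bad (r (s n))) * (D / real (r (s n)) + (\<bar>\<rho>\<bar> + real K)) + tail (real K)"
      by blast
  qed
  moreover have "(\<lambda>K. \<rho> + tail (real K)) \<longlonglongrightarrow> \<rho> + 0" by (intro tendsto_add tendsto_const tail_0)
  ultimately have "cocycle_average \<mu> \<eta> \<le> \<rho> + 0" by (intro LIMSEQ_le_const) auto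
  then show ?thesis using beta_min_le_cocycle_average[OF W(1) \<eta>] by (simp add: order_trans)
qed

section \<open>Invariant complements\<close>

lemma orbit_pair_measurable:
  assumes \<nu>: "proj_prob \<nu>"
  shows "(\<lambda>(L, \<omega>). line (random_product \<omega> n *v rep L)) \<in> measurable (\<nu> \<Otimes>\<^sub>M S) proj_borel"
proof -
  have [measurable]: "rep \<in> borel_measurable \<nu>" by (rule proj_prob_measurable[OF \<nu> rep_measurable])
  have "(\<lambda>z. line (random_product (snd z) n *v rep (fst z))) \<in> measurable (\<nu> \<Otimes>\<^sub>M S) proj_borel"
  proof (rule measurable_line_compose)
    show "(\<lambda>z. random_product (snd z) n *v rep (fst z)) \<in> borel_measurable (\<nu> \<Otimes>\<^sub>M S)" by measurable
    fix z assume "z \<in> space (\<nu> \<Otimes>\<^sub>M S)"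
    then have "fst z \<in> space \<nu>" "snd z \<in> space S" by (simp_all add: space_pair_measure mem_Times_iff)
    then show "random_product (snd z) n *v rep (fst z) \<noteq> 0"
      using product_nonzero[OF _ rep_nonzero] proj_probD(3)[OF \<nu>] by simp
  qed
  then show ?thesis by (simp add: case_prod_unfold)
qed

lemma line_mult_rep: "g \<in> GL \<Longrightarrow> v \<noteq> 0 \<Longrightarrow> line (g *v rep (line v)) = line (g *v v)"
  using line_rep[OF line_in_proj[of v UNIV]] by (simp add: mult_image_line[symmetric])

text \<open>
  A line with stationary law, independent of the walk, keeps its law along the walk.
\<close>

lemma stationary_orbit:
  assumes st: "stationary_on \<mu> A \<nu>" and u: "u \<in> borel_measurable proj_borel"
  shows "(\<integral>\<^sup>+L. \<integral>\<^sup>+\<omega>. u (line (random_product \<omega> n *v rep L)) \<partial>S \<partial>\<nu>) = (\<integral>\<^sup>+L. u L \<partial>\<nu>)"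
proof -
  have \<nu>: "proj_prob \<nu>" by (rule stationary_proj_prob[OF st])
  interpret \<nu>: prob_space \<nu> using \<nu> by (rule proj_probD)
  interpret MN: pair_prob_space \<mu> \<nu> ..
  note sp = proj_probD(3)[OF \<nu>]
  show ?thesis
  proof (induction n)
    case 0
    have "(\<integral>\<^sup>+\<omega>. u (line (random_product \<omega> 0 *v rep L)) \<partial>S) = u L" if "L \<in> space \<nu>" for L
      using that line_rep[of L] sp by (simp add: P.emeasure_space_1)
    then show ?case by (rule nn_integral_cong)
  next
    case (Suc n)
    define h where "h L = (\<integral>\<^sup>+\<omega>. u (line (random_product \<omega> n *v rep L)) \<partial>S)" for L
    have "h \<in> borel_measurable \<nu>"
    proof -
      have "(\<lambda>(L, \<omega>). u (line (random_product \<omega> n *v rep L))) \<in> borel_measurable (\<nu> \<Otimes>\<^sub>M S)"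
        using measurable_compose[OF orbit_pair_measurable[OF \<nu>] u] by (simp add: case_prod_unfold)
      then show ?thesis unfolding h_def by (rule P.borel_measurable_nn_integral)
    qed
    then have h: "h \<in> borel_measurable proj_borel"
      using measurable_cong_sets[OF proj_probD(2)[OF \<nu>] refl] by blast
    have "(\<integral>\<^sup>+\<omega>. u (line (random_product \<omega> (Suc n) *v rep L)) \<partial>S) = (\<integral>\<^sup>+s. h ((*v) s ` L) \<partial>\<mu>)"
      if "L \<in> space \<nu>" for L
    proof -
      have L: "L \<in> proj UNIV" using that sp by simp
      have "(\<lambda>\<omega>. u (line (random_product \<omega> (Suc n) *v rep L))) \<in> borel_measurable S"
        by (rule measurable_compose[OF orbit_measurable[OF rep_nonzero[OF L]] u])
      from nn_integral_seq[OF this]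
      have "(\<integral>\<^sup>+\<omega>. u (line (random_product \<omega> (Suc n) *v rep L)) \<partial>S)
          = (\<integral>\<^sup>+s. \<integral>\<^sup>+\<omega>. u (line (random_product \<omega> n *v (s *v rep L))) \<partial>S \<partial>\<mu>)"
        unfolding orbit_case_nat .
      also have "\<dots> = (\<integral>\<^sup>+s. h ((*v) s ` L) \<partial>\<mu>)"
      proof (rule nn_integral_cong)
        fix s assume "s \<in> space \<mu>"
        then have s: "s *v rep L \<noteq> 0" using GL_mult_nonzero rep_nonzero[OF L] by (simp add: space_\<mu>)
        have "u (line (random_product \<omega> n *v (s *v rep L))) = u (line (random_product \<omega> n *v rep ((*v) s ` L)))"
          if "\<omega> \<in> space S" for \<omega>
          using line_mult_rep[OF product_GL[OF that] s, of n] by (simp add: act_eq_line[OF L])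
        then show "(\<integral>\<^sup>+\<omega>. u (line (random_product \<omega> n *v (s *v rep L))) \<partial>S) = h ((*v) s ` L)"
          unfolding h_def by (rule nn_integral_cong)
      qed
      finally show ?thesis .
    qed
    then have "(\<integral>\<^sup>+L. \<integral>\<^sup>+\<omega>. u (line (random_product \<omega> (Suc n) *v rep L)) \<partial>S \<partial>\<nu>)
        = (\<integral>\<^sup>+L. \<integral>\<^sup>+s. h ((*v) s ` L) \<partial>\<mu> \<partial>\<nu>)" by (rule nn_integral_cong)
    also have "\<dots> = (\<integral>\<^sup>+z. h (case z of (s, L) \<Rightarrow> (*v) s ` L) \<partial>(\<mu> \<Otimes>\<^sub>M \<nu>))"
      using MN.nn_integral_snd[OF measurable_compose[OF act_pair_measurable[OF \<nu>] h]] by simp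
    also have "\<dots> = (\<integral>\<^sup>+L. h L \<partial>convolve \<mu> \<nu>)"
      unfolding convolve_def using h by (subst nn_integral_distr[OF act_pair_measurable[OF \<nu>]]) simp_all
    also have "\<dots> = (\<integral>\<^sup>+L. u L \<partial>\<nu>)" using st Suc by (simp add: stationary_on_def h_def)
    finally show ?case .
  qed
qed

lemma product_norm_le:
  assumes W: "vec.subspace W" and g: "g \<in> GL" and L: "L \<in> proj UNIV"
  shows "norm (g *v rep L) * infdist (rep (line (g *v rep L))) W \<le> quot_op_norm W g"
proof -
  have nz: "g *v rep L \<noteq> 0" using GL_mult_nonzero[OF g rep_nonzero[OF L]] .
  have "norm (g *v rep L) * infdist (rep (line (g *v rep L))) W = infdist (g *v rep L) W"
    using infdist_rep_line[OF _ nz, of W] vec.subspace_scale[OF W] nz by simp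
  also have "\<dots> \<le> quot_op_norm W g" using infdist_mult_le_norm[OF W, of g "rep L"] norm_rep[OF L] by simp
  finally show ?thesis .
qed

text \<open>
  The norm of a vector exceeds its norm in \<open>V/W\<close> by the factor \<open>1 / infdist (rep L) W\<close>, where \<open>L\<close> is its
  line. At time \<open>n\<close> the line still has law \<open>\<nu>\<close>, so this factor is exponentially large only with the
  \<open>\<nu>\<close>-probability of an exponentially small neighbourhood of \<open>P(W)\<close>, which tends to 0. Hence vectors grow
  no faster than their images in \<open>V/W\<close>, up to subexponential factors and in probability.
\<close>

theorem slow_growth_off_subspace:
  assumes W: "vec.subspace W" and st: "stationary_on \<mu> (proj UNIV - proj W) \<nu>"
    and \<gamma>: "AE \<omega> in S. (\<lambda>n. ln (quot_op_norm W (random_product \<omega> n)) / real n) \<longlonglongrightarrow> \<gamma>" "\<gamma> < \<rho>"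
    and pos: "AE \<omega> in S. \<forall>n. quot_op_norm W (random_product \<omega> n) > 0"
  shows "(\<lambda>n. \<integral>L. measure S {\<omega> \<in> space S. exp (real n * \<rho>) < norm (random_product \<omega> n *v rep L)} \<partial>\<nu>) \<longlonglongrightarrow> 0"
    and "\<And>n. integrable \<nu> (\<lambda>L. measure S {\<omega> \<in> space S. exp (real n * \<rho>) < norm (random_product \<omega> n *v rep L)})"
proof -
  have \<nu>: "proj_prob \<nu>" by (rule stationary_proj_prob[OF st])
  interpret \<nu>: prob_space \<nu> using \<nu> by (rule proj_probD)
  note sp = proj_probD(3)[OF \<nu>]
  have rep_\<nu> [measurable]: "rep \<in> borel_measurable \<nu>" by (rule proj_prob_measurable[OF \<nu> rep_measurable])
  have [measurable]: "(\<lambda>\<omega>. quot_op_norm W (random_product \<omega> n)) \<in> borel_measurable S" for n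
    by (rule measurable_compose[OF random_product_measurable quot_op_norm_measurable[OF W]])
  let ?E = "\<lambda>n L. {\<omega> \<in> space S. exp (real n * \<rho>) < norm (random_product \<omega> n *v rep L)}"
  define p where "p n L = measure S (?E n L)" for n L
  have p_meas: "p n \<in> borel_measurable \<nu>" for n
  proof -
    have "(\<lambda>L. emeasure S {\<omega> \<in> space S. exp (real n * \<rho>) < norm (random_product \<omega> n *v rep L)}) \<in> borel_measurable \<nu>"
      by measurable
    then show ?thesis unfolding p_def[abs_def] measure_def by measurable
  qed
  have p_int: "integrable \<nu> (p n)" for n
    by (rule \<nu>.integrable_const_bound[where B = 1]) (use p_meas in \<open>auto simp: p_def\<close>)
  show "integrable \<nu> (\<lambda>L. measure S (?E n L))" for n
    using p_int[of n] by (simp add: p_def[abs_def])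
  \<comment> \<open>The rate \<open>\<rho>\<close> is shared out: \<open>\<rho>'\<close> for the growth in \<open>V/W\<close>, and \<open>\<rho> - \<rho>'\<close> for the approach to \<open>P(W)\<close>.\<close>
  obtain \<rho>' where \<rho>': "\<gamma> < \<rho>'" "\<rho>' < \<rho>" using dense[OF \<gamma>(2)] by blast
  define Q where "Q n = {\<omega> \<in> space S. exp (real n * \<rho>') < quot_op_norm W (random_product \<omega> n)}" for n
  have Q [measurable]: "Q n \<in> sets S" for n unfolding Q_def by measurable
  define D where "D n = {L \<in> proj UNIV. infdist (rep L) W < exp (- real n * (\<rho> - \<rho>'))}" for n :: nat
  have D: "D n \<in> sets proj_borel" for n
  proof -
    have "{L \<in> space (proj_borel :: ('k ^ 'n) set measure). infdist (rep L) W < exp (- real n * (\<rho> - \<rho>'))} \<in> sets proj_borel"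
      using proj_continuous_measurable[OF proj_continuous_infdist_rep, of W] vec.subspace_scale[OF W] by measurable
    then show ?thesis by (simp add: D_def)
  qed
  have D_\<nu> [measurable]: "D n \<in> sets \<nu>" for n using D proj_probD(2)[OF \<nu>] by simp
  have p_le: "(\<integral>L. p n L \<partial>\<nu>) \<le> measure S (Q n) + measure \<nu> (D n)" for n
  proof -
    have "ennreal (p n L) \<le> ennreal (measure S (Q n)) + (\<integral>\<^sup>+\<omega>. indicator (D n) (line (random_product \<omega> n *v rep L)) \<partial>S)"
      if "L \<in> space \<nu>" for L
    proof -
      have L: "L \<in> proj UNIV" using that sp by simp
      let ?D = "{\<omega> \<in> space S. line (random_product \<omega> n *v rep L) \<in> D n}"
      have D_S [measurable]: "?D \<in> sets S"
        using measurable_sets[OF orbit_measurable[OF rep_nonzero[OF L], of n] D[of n]]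
        by (simp add: vimage_def Int_def conj_commute)
      have "?E n L \<subseteq> Q n \<union> ?D"
      proof
        fix \<omega> assume \<omega>: "\<omega> \<in> ?E n L"
        show "\<omega> \<in> Q n \<union> ?D"
        proof (rule ccontr)
          assume neg: "\<omega> \<notin> Q n \<union> ?D"
          let ?G = "random_product \<omega> n"
          have \<omega>S: "\<omega> \<in> space S" using \<omega> by simp
          have q: "quot_op_norm W ?G \<le> exp (real n * \<rho>')" using neg \<omega>S by (simp add: Q_def)
          have "line (?G *v rep L) \<in> proj UNIV"
            using product_nonzero[OF \<omega>S rep_nonzero[OF L]] by (intro line_in_proj) auto
          then have d: "exp (- real n * (\<rho> - \<rho>')) \<le> infdist (rep (line (?G *v rep L))) W"
            using neg \<omega>S by (simp add: D_def)
          have "exp (real n * \<rho>) * exp (- real n * (\<rho> - \<rho>')) < norm (?G *v rep L) * exp (- real n * (\<rho> - \<rho>'))"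
            using \<omega> by (intro mult_strict_right_mono) auto
          also have "\<dots> \<le> norm (?G *v rep L) * infdist (rep (line (?G *v rep L))) W"
            by (rule mult_left_mono[OF d]) simp
          also have "\<dots> \<le> exp (real n * \<rho>')"
            using product_norm_le[OF W product_GL[OF \<omega>S] L] q by (rule order_trans)
          also have "exp (real n * \<rho>') = exp (real n * \<rho>) * exp (- real n * (\<rho> - \<rho>'))"
            by (simp add: exp_add[symmetric] algebra_simps)
          finally show False by simp
        qed
      qed
      then have "emeasure S (?E n L) \<le> emeasure S (Q n) + emeasure S ?D"
        by (intro order_trans[OF emeasure_mono emeasure_subadditive]) auto
      also have "emeasure S ?D = (\<integral>\<^sup>+\<omega>. indicator (D n) (line (random_product \<omega> n *v rep L)) \<partial>S)"
        unfolding nn_integral_indicator[OF D_S, symmetric]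
        by (rule nn_integral_cong) (simp add: indicator_def)
      finally show ?thesis by (simp add: p_def P.emeasure_eq_measure)
    qed
    then have "(\<integral>\<^sup>+L. ennreal (p n L) \<partial>\<nu>)
        \<le> (\<integral>\<^sup>+L. ennreal (measure S (Q n)) + (\<integral>\<^sup>+\<omega>. indicator (D n) (line (random_product \<omega> n *v rep L)) \<partial>S) \<partial>\<nu>)"
      by (rule nn_integral_mono)
    also have "\<dots> = ennreal (measure S (Q n)) + (\<integral>\<^sup>+L. \<integral>\<^sup>+\<omega>. indicator (D n) (line (random_product \<omega> n *v rep L)) \<partial>S \<partial>\<nu>)"
    proof (subst nn_integral_add)
      have "(\<lambda>(L, \<omega>). indicator (D n) (line (random_product \<omega> n *v rep L)) :: ennreal) \<in> borel_measurable (\<nu> \<Otimes>\<^sub>M S)"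
        using measurable_compose[OF orbit_pair_measurable[OF \<nu>, of n] borel_measurable_indicator[OF D]]
        by (simp add: case_prod_unfold)
      then show "(\<lambda>L. \<integral>\<^sup>+\<omega>. indicator (D n) (line (random_product \<omega> n *v rep L)) \<partial>S) \<in> borel_measurable \<nu>"
        by (rule P.borel_measurable_nn_integral)
    qed (simp_all add: \<nu>.emeasure_space_1)
    also have "(\<integral>\<^sup>+L. \<integral>\<^sup>+\<omega>. indicator (D n) (line (random_product \<omega> n *v rep L)) \<partial>S \<partial>\<nu>) = ennreal (measure \<nu> (D n))"
      using stationary_orbit[OF st borel_measurable_indicator[OF D]] by (simp add: \<nu>.emeasure_eq_measure)
    finally have "(\<integral>\<^sup>+L. ennreal (p n L) \<partial>\<nu>) \<le> ennreal (measure S (Q n) + measure \<nu> (D n))" by (simp add: ennreal_plus)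
    moreover have "(\<integral>\<^sup>+L. ennreal (p n L) \<partial>\<nu>) = ennreal (\<integral>L. p n L \<partial>\<nu>)"
      by (rule nn_integral_eq_integral[OF p_int]) (simp add: p_def)
    ultimately have "ennreal (\<integral>L. p n L \<partial>\<nu>) \<le> ennreal (measure S (Q n) + measure \<nu> (D n))"
      by (simp only:)
    then show ?thesis by (subst (asm) ennreal_le_iff) auto
  qed
  have "(\<lambda>n. measure S (Q n)) \<longlonglongrightarrow> 0"
  proof -
    have "(\<lambda>n. \<integral>\<omega>. indicator (Q n) \<omega> \<partial>S) \<longlonglongrightarrow> (\<integral>\<omega>. (0 :: real) \<partial>S)"
    proof (rule integral_dominated_convergence[where w = "\<lambda>_. 1"])
      show "AE \<omega> in S. (\<lambda>n. indicator (Q n) \<omega> :: real) \<longlonglongrightarrow> 0"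
        using \<gamma>(1) pos
      proof eventually_elim
        case (elim \<omega>)
        have "\<forall>\<^sub>F n in sequentially. ln (quot_op_norm W (random_product \<omega> n)) / real n < \<rho>'"
          using elim(1) \<rho>'(1) by (rule order_tendstoD(2))
        then have "\<forall>\<^sub>F n in sequentially. indicator (Q n) \<omega> = (0 :: real)"
          using eventually_gt_at_top[of 0]
        proof eventually_elim
          case (elim n)
          then have "ln (quot_op_norm W (random_product \<omega> n)) < real n * \<rho>'"
            by (simp add: pos_divide_less_eq mult.commute)
          then have "exp (ln (quot_op_norm W (random_product \<omega> n))) < exp (real n * \<rho>')" by simp
          moreover have "quot_op_norm W (random_product \<omega> n) > 0" using \<open>\<forall>n. quot_op_norm W (random_product \<omega> n) > 0\<close> by blast
          ultimately show ?case by (simp add: Q_def)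
        qed
        then show ?case by (rule tendsto_eventually)
      qed
    qed auto
    then show ?thesis by simp
  qed
  moreover have "(\<lambda>n. measure \<nu> (D n)) \<longlonglongrightarrow> 0"
  proof -
    have off: "AE L in \<nu>. L \<in> proj UNIV - proj W"
    proof -
      have "proj UNIV - proj W \<in> sets \<nu>"
        using sets.Diff[OF sets.top proj_measurable[OF W]] proj_probD(2)[OF \<nu>] by simp
      moreover have "\<nu>.prob (proj UNIV - proj W) = 1"
        using st by (simp add: stationary_on_def measure_def)
      ultimately show ?thesis by (simp add: \<nu>.prob_eq_1)
    qed
    have "(\<lambda>n. \<integral>L. indicator (D n) L \<partial>\<nu>) \<longlonglongrightarrow> (\<integral>L. (0 :: real) \<partial>\<nu>)"
    proof (rule integral_dominated_convergence[where w = "\<lambda>_. 1"])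
      show "AE L in \<nu>. (\<lambda>n. indicator (D n) L :: real) \<longlonglongrightarrow> 0"
        using off
      proof eventually_elim
        case (elim L)
        then have L: "L \<in> proj UNIV" "rep L \<notin> W"
          using line_rep[of L] rep_nonzero[of L] line_in_proj[of "rep L" W] by auto
        then have "infdist (rep L) W \<noteq> 0"
          using in_closed_iff_infdist_zero[OF closed_vec_subspace[OF W], of "rep L"] vec.subspace_0[OF W] by auto
        then have "infdist (rep L) W > 0" using infdist_nonneg[of "rep L" W] by linarith
        moreover have "(\<lambda>n. exp (- real n * (\<rho> - \<rho>'))) \<longlonglongrightarrow> 0"
        proof -
          have "(\<lambda>n. exp (- (\<rho> - \<rho>')) ^ n) \<longlonglongrightarrow> 0" using \<rho>' by (intro LIMSEQ_realpow_zero) auto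
          then show ?thesis by (simp add: exp_of_nat_mult[symmetric] mult.commute algebra_simps)
        qed
        ultimately have "\<forall>\<^sub>F n in sequentially. exp (- real n * (\<rho> - \<rho>')) < infdist (rep L) W"
          by (intro order_tendstoD(2))
        then have "\<forall>\<^sub>F n in sequentially. indicator (D n) L = (0 :: real)"
          by eventually_elim (simp add: D_def)
        then show ?case by (rule tendsto_eventually)
      qed
    qed auto
    then show ?thesis by simp
  qed
  ultimately have "(\<lambda>n. measure S (Q n) + measure \<nu> (D n)) \<longlonglongrightarrow> 0 + 0" by (rule tendsto_add)
  then have lim: "(\<lambda>n. measure S (Q n) + measure \<nu> (D n)) \<longlonglongrightarrow> 0" by simp
  have "(\<lambda>n. \<integral>L. p n L \<partial>\<nu>) \<longlonglongrightarrow> 0"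
  proof (rule tendsto_sandwich[OF _ _ tendsto_const lim])
    show "\<forall>\<^sub>F n in sequentially. 0 \<le> (\<integral>L. p n L \<partial>\<nu>)"
      by (intro always_eventually allI integral_nonneg_AE AE_I2) (simp add: p_def)
    show "\<forall>\<^sub>F n in sequentially. (\<integral>L. p n L \<partial>\<nu>) \<le> measure S (Q n) + measure \<nu> (D n)"
      using p_le by (intro always_eventually allI)
  qed
  then show "(\<lambda>n. \<integral>L. measure S (?E n L) \<partial>\<nu>) \<longlonglongrightarrow> 0" by (simp add: p_def)
qed

text \<open>
  The constant \<open>C\<close> may depend on the vector, which makes the condition stable under sums and scalar
  multiples.
\<close>

lemma subspace_slow_growth:
  "vec.subspace {v. \<exists>C>0. (\<lambda>n. measure S {\<omega> \<in> space S. C * b n < norm (random_product \<omega> (r n) *v v)}) \<longlonglongrightarrow> 0}"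
    (is "vec.subspace ?F") if b: "\<And>n. b n \<ge> (0 :: real)"
proof (rule vec.subspaceI)
  have eq: "{\<omega> \<in> space S. 1 * b n < norm (random_product \<omega> (r n) *v 0)} = {}" for n
    using b[of n] by auto
  have "(\<lambda>n. measure S {\<omega> \<in> space S. 1 * b n < norm (random_product \<omega> (r n) *v 0)}) \<longlonglongrightarrow> 0"
    unfolding eq by simp
  then show "0 \<in> ?F" using zero_less_one by blast
next
  fix v v' assume "v \<in> ?F" "v' \<in> ?F"
  then obtain C C' where C: "C > 0" "C' > 0"
    and lim: "(\<lambda>n. measure S {\<omega> \<in> space S. C * b n < norm (random_product \<omega> (r n) *v v)}) \<longlonglongrightarrow> 0"
      "(\<lambda>n. measure S {\<omega> \<in> space S. C' * b n < norm (random_product \<omega> (r n) *v v')}) \<longlonglongrightarrow> 0" by auto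
  have "(\<lambda>n. measure S {\<omega> \<in> space S. (C + C') * b n < norm (random_product \<omega> (r n) *v (v + v'))}) \<longlonglongrightarrow> 0"
  proof (rule Lim_null_comparison[OF always_eventually tendsto_add_zero[OF lim]], rule allI)
    fix n
    let ?A = "{\<omega> \<in> space S. C * b n < norm (random_product \<omega> (r n) *v v)}"
    let ?A' = "{\<omega> \<in> space S. C' * b n < norm (random_product \<omega> (r n) *v v')}"
    let ?B = "{\<omega> \<in> space S. (C + C') * b n < norm (random_product \<omega> (r n) *v (v + v'))}"
    have [measurable]: "?A \<in> sets S" "?A' \<in> sets S" "?B \<in> sets S" by measurable
    have "?B \<subseteq> ?A \<union> ?A'"
    proof
      fix \<omega> assume \<omega>: "\<omega> \<in> ?B"
      have "norm (random_product \<omega> (r n) *v (v + v')) \<le> norm (random_product \<omega> (r n) *v v) + norm (random_product \<omega> (r n) *v v')"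
        by (simp add: vec.add norm_triangle_ineq)
      with \<omega> show "\<omega> \<in> ?A \<union> ?A'" by (auto simp: distrib_right)
    qed
    then have "measure S ?B \<le> measure S (?A \<union> ?A')" by (intro P.finite_measure_mono) auto
    also have "\<dots> \<le> measure S ?A + measure S ?A'" by (intro measure_Un_le) auto
    finally show "norm (measure S ?B) \<le> measure S ?A + measure S ?A'" by simp
  qed
  then show "v + v' \<in> ?F" using C by (intro CollectI exI[of _ "C + C'"]) auto
next
  fix c v assume "v \<in> ?F"
  then obtain C where C: "C > 0"
    and lim: "(\<lambda>n. measure S {\<omega> \<in> space S. C * b n < norm (random_product \<omega> (r n) *v v)}) \<longlonglongrightarrow> 0" by auto
  have "(\<lambda>n. measure S {\<omega> \<in> space S. (C * (norm c + 1)) * b n < norm (random_product \<omega> (r n) *v (c *s v))}) \<longlonglongrightarrow> 0"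
  proof (rule Lim_null_comparison[OF always_eventually lim], rule allI)
    fix n
    let ?A = "{\<omega> \<in> space S. C * b n < norm (random_product \<omega> (r n) *v v)}"
    let ?B = "{\<omega> \<in> space S. (C * (norm c + 1)) * b n < norm (random_product \<omega> (r n) *v (c *s v))}"
    have [measurable]: "?A \<in> sets S" by measurable
    have "?B \<subseteq> ?A"
    proof
      fix \<omega> assume \<omega>: "\<omega> \<in> ?B"
      show "\<omega> \<in> ?A"
      proof (rule ccontr)
        assume "\<omega> \<notin> ?A"
        then have "norm (random_product \<omega> (r n) *v v) \<le> C * b n" using \<omega> by simp
        then have "norm c * norm (random_product \<omega> (r n) *v v) \<le> (norm c + 1) * (C * b n)"
          using C b[of n] by (intro mult_mono) auto
        with \<omega> show False by (simp add: vec.scale norm_smult mult_ac)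
      qed
    qed
    then have "measure S ?B \<le> measure S ?A" by (intro P.finite_measure_mono) auto
    then show "norm (measure S ?B) \<le> measure S ?A" by simp
  qed
  then show "c *s v \<in> ?F" using C by (intro CollectI exI[of _ "C * (norm c + 1)"]) (auto simp: add_nonneg_pos)
qed

text \<open>
  A subspace of smallest dimension that carries \<open>\<nu>\<close> is contained in every subspace that carries \<open>\<nu>\<close>. By
  stationarity its preimage under almost every matrix carries \<open>\<nu>\<close> too, so it is invariant.
\<close>

lemma minimal_full_subspace:
  fixes \<nu> :: "('k ^ 'n) set measure"
  assumes st: "stationary_on \<mu> A \<nu>"
  obtains E where "invariant_subspace \<mu> E" "E \<noteq> {0}"
    "\<And>F. vec.subspace F \<Longrightarrow> AE L in \<nu>. L \<in> proj F \<Longrightarrow> E \<subseteq> F"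
proof -
  have \<nu>: "proj_prob \<nu>" by (rule stationary_proj_prob[OF st])
  interpret \<nu>: prob_space \<nu> using \<nu> by (rule proj_probD)
  interpret MN: pair_prob_space \<mu> \<nu> ..
  note sp = proj_probD(3)[OF \<nu>]
  have mem: "L \<in> proj E \<longleftrightarrow> rep L \<in> E" if "vec.subspace E" "L \<in> proj UNIV" for L and E :: "('k ^ 'n) set"
    using line_in_proj_iff[OF that(1) rep_nonzero[OF that(2)]] line_rep[OF that(2)] by simp
  define full where "full E \<longleftrightarrow> vec.subspace E \<and> (AE L in \<nu>. L \<in> proj E)" for E :: "('k ^ 'n) set"
  have "full UNIV" unfolding full_def using sp by (auto intro!: AE_I2)
  then obtain E where E: "full E" "\<And>F. full F \<Longrightarrow> vec.dim E \<le> vec.dim F"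
    using ex_has_least_nat[of full UNIV vec.dim] by blast
  have sub: "vec.subspace E" and AE_E: "AE L in \<nu>. L \<in> proj E" using E(1) by (auto simp: full_def)
  have least: "E \<subseteq> F" if "vec.subspace F" "AE L in \<nu>. L \<in> proj F" for F
  proof -
    have EF: "vec.subspace (E \<inter> F)" by (intro vec.subspace_inter sub that)
    have "AE L in \<nu>. L \<in> proj (E \<inter> F)"
      using AE_E that(2) AE_space
      by eventually_elim (use mem sub that(1) EF sp in auto)
    then have "full (E \<inter> F)" using EF by (simp add: full_def)
    then have "E \<inter> F = E" using E(2) by (intro vec.subspace_dim_equal EF sub) auto
    then show ?thesis by blast
  qed
  have "E \<noteq> {0}"
  proof
    assume "E = {0}"
    then have "AE L in \<nu>. False" using AE_E by (simp add: proj_def)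
    then show False by simp
  qed
  have conv: "convolve \<mu> \<nu> = \<nu>" using st by (simp add: stationary_on_def)
  have "AE L in convolve \<mu> \<nu>. L \<in> proj E" unfolding conv by (rule AE_E)
  then have "AE z in \<mu> \<Otimes>\<^sub>M \<nu>. (case z of (g, L) \<Rightarrow> (*v) g ` L) \<in> proj E"
    unfolding convolve_def by (rule AE_distrD[OF act_pair_measurable[OF \<nu>]])
  then have "AE g in \<mu>. AE L in \<nu>. (*v) g ` L \<in> proj E"
    using MN.AE_pair[of "\<lambda>z. (case z of (g, L) \<Rightarrow> (*v) g ` L) \<in> proj E"] by simp
  then have "AE g in \<mu>. preserves E g"
    using AE_space
  proof eventually_elim
    case (elim g)
    then have g: "g \<in> GL" by (simp add: space_\<mu>)
    have H: "vec.subspace ((*v) g -` E)" by (rule vec.subspace_vimage[OF sub])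
    have "AE L in \<nu>. L \<in> proj ((*v) g -` E)"
      using elim(1) AE_space
    proof eventually_elim
      case (elim L)
      then have L: "L \<in> proj UNIV" using sp by simp
      have "g *v rep L \<in> E"
        using elim(1) unfolding act_eq_line[OF L] line_in_proj_iff[OF sub GL_mult_nonzero[OF g rep_nonzero[OF L]]] .
      then show ?case using mem[OF H L] by simp
    qed
    then have "E \<subseteq> (*v) g -` E" by (rule least[OF H])
    then show ?case by (auto simp: preserves_def)
  qed
  then have "invariant_subspace \<mu> E" using sub by (simp add: invariant_subspace_iff_AE)
  then show ?thesis using \<open>E \<noteq> {0}\<close> least that by blast
qed

text \<open>
  Convergence in probability for \<open>\<nu>\<close>-almost every line holds along a fixed sequence of times \<open>r\<close>. The
  vectors that are slow along \<open>r\<close> form a subspace \<open>F\<close> that carries \<open>\<nu>\<close>; it therefore contains the minimal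
  subspace \<open>E\<close>, and it meets \<open>W\<close> only in 0.
\<close>

theorem ex_invariant_complement:
  assumes inv: "invariant_subspace \<mu> W" and gap: "top_lyapunov_quot \<mu> W < beta_min \<mu> W"
    and st: "stationary_on \<mu> (proj UNIV - proj W) \<nu>"
  shows "\<exists>W'. invariant_subspace \<mu> W' \<and> W' \<noteq> {0} \<and> W' \<inter> W = {0}"
proof -
  have W: "vec.subspace W" "AE g in \<mu>. preserves W g" using inv by (simp_all add: invariant_subspace_iff_AE)
  have \<nu>: "proj_prob \<nu>" by (rule stationary_proj_prob[OF st])
  note sp = proj_probD(3)[OF \<nu>]
  have "W \<noteq> UNIV" using st by (auto simp: stationary_on_def)
  then obtain \<gamma> where \<gamma>: "top_lyapunov_quot \<mu> W = ereal \<gamma>"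
    "AE \<omega> in S. (\<lambda>n. ln (quot_op_norm W (random_product \<omega> n)) / real n) \<longlonglongrightarrow> \<gamma>"
    using quotient_lyapunov_exponent[OF W(1) _ W(2)] by blast
  obtain \<rho> where \<rho>: "\<gamma> < \<rho>" "ereal \<rho> < beta_min \<mu> W"
    using ereal_dense2[OF gap] by (auto simp: \<gamma>(1))
  have pos: "AE \<omega> in S. \<forall>n. quot_op_norm W (random_product \<omega> n) > 0"
    using AE_preserves_product[OF W(2)] AE_space
    by eventually_elim (use quot_op_norm_pos[OF W(1) \<open>W \<noteq> UNIV\<close> product_GL] in blast)
  let ?p = "\<lambda>n L. measure S {\<omega> \<in> space S. exp (real n * \<rho>) < norm (random_product \<omega> n *v rep L)}"
  note slow = slow_growth_off_subspace[OF W(1) st \<gamma>(2) \<rho>(1) pos]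
  obtain r0 where r0: "strict_mono r0" "AE L in \<nu>. (\<lambda>n. ?p (r0 n) L) \<longlonglongrightarrow> 0"
    using tendsto_L1_AE_subseq[of \<nu> ?p, OF slow(2)] slow(1) by auto
  \<comment> \<open>The shift by one keeps the times positive.\<close>
  define r where "r n = r0 (Suc n)" for n
  have r: "1 \<le> r n" for n using strict_monoD[OF r0(1), of n "Suc n"] by (simp add: r_def)
  have r_lim: "filterlim r at_top sequentially"
    unfolding r_def by (rule filterlim_compose[OF filterlim_subseq[OF r0(1)] filterlim_Suc])
  define F where "F = {v. \<exists>C>0. (\<lambda>n. measure S {\<omega> \<in> space S.
    C * exp (real (r n) * \<rho>) < norm (random_product \<omega> (r n) *v v)}) \<longlonglongrightarrow> 0}"
  have F: "vec.subspace F" unfolding F_def by (rule subspace_slow_growth) simp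
  have "AE L in \<nu>. L \<in> proj F"
    using r0(2) AE_space
  proof eventually_elim
    case (elim L)
    then have L: "L \<in> proj UNIV" using sp by simp
    have "(\<lambda>n. ?p (r n) L) \<longlonglongrightarrow> 0" unfolding r_def by (rule LIMSEQ_Suc[OF elim(1)])
    then have "rep L \<in> F" unfolding F_def by (intro CollectI exI[of _ 1]) simp
    then show ?case using line_in_proj[OF rep_nonzero[OF L], of F] line_rep[OF L] by simp
  qed
  moreover obtain E where E: "invariant_subspace \<mu> E" "E \<noteq> {0}"
    "\<And>F. vec.subspace F \<Longrightarrow> AE L in \<nu>. L \<in> proj F \<Longrightarrow> E \<subseteq> F"
    using minimal_full_subspace[OF st] by blast
  ultimately have "E \<subseteq> F" using F by blast
  have "w = 0" if w: "w \<in> E \<inter> W" for w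
  proof (rule ccontr)
    assume "w \<noteq> 0"
    obtain C where "C > 0" "(\<lambda>n. measure S {\<omega> \<in> space S.
      C * exp (real (r n) * \<rho>) < norm (random_product \<omega> (r n) *v w)}) \<longlonglongrightarrow> 0"
      using w \<open>E \<subseteq> F\<close> unfolding F_def by blast
    then have "beta_min \<mu> W \<le> ereal \<rho>"
      using w \<open>w \<noteq> 0\<close> by (intro beta_min_le_growth[OF W _ _ r r_lim]) auto
    then show False using \<rho>(2) by simp
  qed
  moreover have "0 \<in> E \<inter> W" using E(1) W(1) by (auto simp: invariant_subspace_def intro: vec.subspace_0)
  ultimately have "E \<inter> W = {0}" by blast
  then show ?thesis using E by blast
qed

theorem ex_stationary_on_invariant_subspace:
  fixes W :: "('k ^ 'n) set"
  assumes inv: "invariant_subspace \<mu> W" and "W \<noteq> {0}"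
  shows "\<exists>\<nu>. stationary_on \<mu> (proj W) \<nu>"
proof -
  have W: "vec.subspace W" "AE g in \<mu>. preserves W g" using inv by (simp_all add: invariant_subspace_iff_AE)
  obtain w where "w \<in> W" "w \<noteq> 0" using vec.subspace_0[OF W(1)] \<open>W \<noteq> {0}\<close> by blast
  then show ?thesis using krylov_bogoliubov[OF W, of w Suc] filterlim_Suc by auto
qed

end

lemma disjoint_proj:
  assumes "vec.subspace W" "W' \<inter> W = {0}"
  shows "proj W' \<inter> proj W = {}"
proof (rule ccontr)
  assume "proj W' \<inter> proj W \<noteq> {}"
  then obtain v w where "v \<in> W'" "v \<noteq> 0" "w \<in> W" "w \<noteq> 0" "line v = line w" by (auto simp: proj_def)
  then have "v \<in> W" using line_subset_iff[OF assms(1)] by (metis (no_types, lifting))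
  with \<open>v \<in> W'\<close> \<open>v \<noteq> 0\<close> assms(2) show False by blast
qed

theorem corollary1p6:
  fixes \<mu> :: "('k::{real_normed_field, euclidean_space} ^ 'n ^ 'n) measure"
    and W :: "('k ^ 'n) set"
  assumes "prob_space \<mu>" and "sets \<mu> = sets GL_borel"
    and "finite_first_moment \<mu>"
    and "invariant_subspace \<mu> W"
    and "top_lyapunov_quot \<mu> W < beta_min \<mu> W"
  shows "(\<exists>\<nu>. stationary_on \<mu> (proj UNIV - proj W) \<nu>) \<longleftrightarrow>
         (\<exists>W'. invariant_subspace \<mu> W' \<and> W' \<noteq> {0} \<and> W' \<inter> W = {0})"
proof
  interpret matrix_walk \<mu> using assms(1-3) by (rule matrix_walk.intro)
  show "\<exists>W'. invariant_subspace \<mu> W' \<and> W' \<noteq> {0} \<and> W' \<inter> W = {0}"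
    if "\<exists>\<nu>. stationary_on \<mu> (proj UNIV - proj W) \<nu>"
    using that ex_invariant_complement[OF assms(4,5)] by blast
  show "\<exists>\<nu>. stationary_on \<mu> (proj UNIV - proj W) \<nu>"
    if "\<exists>W'. invariant_subspace \<mu> W' \<and> W' \<noteq> {0} \<and> W' \<inter> W = {0}"
  proof -
    obtain W' where W': "invariant_subspace \<mu> W'" "W' \<noteq> {0}" "W' \<inter> W = {0}" using \<open>\<exists>W'. _\<close> by blast
    obtain \<nu> where \<nu>: "stationary_on \<mu> (proj W') \<nu>"
      using ex_stationary_on_invariant_subspace[OF W'(1,2)] by blast
    have W: "vec.subspace W" using assms(4) by (simp add: invariant_subspace_def)
    have sets_eq: "sets \<nu> = sets proj_borel" and prob: "prob_space \<nu>" and one: "emeasure \<nu> (proj W') = 1"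
      using \<nu> by (auto simp: stationary_on_def)
    interpret \<nu>: prob_space \<nu> by fact
    have "proj W' \<subseteq> proj UNIV - proj W" using disjoint_proj[OF W W'(3)] proj_mono[of W' UNIV] by auto
    moreover have "proj UNIV - proj W \<in> sets \<nu>"
      using sets.Diff[OF sets.top proj_measurable[OF W]] sets_eq by simp
    ultimately have "emeasure \<nu> (proj W') \<le> emeasure \<nu> (proj UNIV - proj W)" by (rule emeasure_mono)
    then have "emeasure \<nu> (proj UNIV - proj W) = 1" using one \<nu>.emeasure_le_1 antisym by metis
    then show ?thesis using \<nu> by (auto simp: stationary_on_def)
  qed
qed

end
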